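(* Let $\mathcal{A}$ be a unital $C^*$-algebra, $\mathcal{B}$ a von Neumann algebra and $\phi:\mathcal{A}\to\mathcal{B}$ a positive unital linear map. Then, for every monotone convex function $f:I\to\mathbb{R}$ defined on some open interval $I\subseteq\mathbb{R}$, and for every self-adjoint element $a\in\mathcal{A}$ whose spectrum is contained in $I$, $$f(\phi(a))\precsim \phi(f(a)),$$ where $\precsim$ is the spectral preorder on the self-adjoint elements of $\mathcal{B}$.
   Context: A linear map $\phi$ between $C^*$-algebras is positive if it maps positive elements to positive elements, and unital if it maps the unit to the unit. Monotone means non-decreasing or non-increasing. For a self-adjoint element $x$, $f(x)$ is defined by continuous functional calculus (the spectrum of $\phi(a)$ is again contained in $I$). Spectral preorder: for a self-adjoint element $x$ of a von Neumann algebra $\mathcal{B}$ and a Borel set $S\subseteq\mathbb{R}$, let $E_S[x]=\chi_S(x)$ be the spectral projection of $x$ corresponding to $S$. For self-adjoint $x,y\in\mathcal{B}$, $x\precsim y$ means that for every real $\alpha$ the projection $E_{(\alpha,+\infty)}[x]$ is Murray-von Neumann equivalent (in $\mathcal{B}$) to a subprojection of $E_{(\alpha,+\infty)}[y]$. *)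

theory Defs
  imports "HOL-Analysis.Analysis"
begin

section \<open>Complex normed spaces and C*-algebras\<close>

class complex_normed_vector = real_normed_vector +
  fixes scaleC :: "complex \<Rightarrow> 'a \<Rightarrow> 'a"  (infixr "*\<^sub>C" 75)
  assumes scaleC_add_right: "c *\<^sub>C (x + y) = c *\<^sub>C x + c *\<^sub>C y"
    and scaleC_add_left: "(c + d) *\<^sub>C x = c *\<^sub>C x + d *\<^sub>C x"
    and scaleC_scaleC: "c *\<^sub>C d *\<^sub>C x = (c * d) *\<^sub>C x"
    and scaleC_of_real: "complex_of_real r *\<^sub>C x = r *\<^sub>R x"
    and norm_scaleC: "norm (c *\<^sub>C x) = cmod c * norm x"

text \<open>Unital C*-algebras.  The sort does not contain \<^class>\<open>zero_neq_one\<close>: the zero algebra is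
  allowed, so that the bounded operators on the zero Hilbert space are an instance.\<close>

class cstar_algebra = complex_normed_vector + real_normed_algebra + monoid_mult + banach +
  fixes adj :: "'a \<Rightarrow> 'a"
  assumes scaleC_mult_left: "(c *\<^sub>C x) * y = c *\<^sub>C (x * y)"
    and scaleC_mult_right: "x * (c *\<^sub>C y) = c *\<^sub>C (x * y)"
    and adj_adj: "adj (adj x) = x"
    and adj_add: "adj (x + y) = adj x + adj y"
    and adj_scaleC: "adj (c *\<^sub>C x) = cnj c *\<^sub>C adj x"
    and adj_mult: "adj (x * y) = adj y * adj x"
    and cstar_identity: "norm (adj x * x) = (norm x)\<^sup>2"

definition self_adjoint :: "'a::cstar_algebra \<Rightarrow> bool" where
  "self_adjoint x \<longleftrightarrow> adj x = x"

definition spectrum :: "'a::cstar_algebra \<Rightarrow> complex set" where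
  "spectrum x = {c. \<not> (\<exists>y. y * (x - c *\<^sub>C 1) = 1 \<and> (x - c *\<^sub>C 1) * y = 1)}"

definition positive :: "'a::cstar_algebra \<Rightarrow> bool" where
  "positive x \<longleftrightarrow> self_adjoint x \<and> spectrum x \<subseteq> complex_of_real ` {0..}"

definition complex_linear ::
    "('a::complex_normed_vector \<Rightarrow> 'b::complex_normed_vector) \<Rightarrow> bool" where
  "complex_linear \<phi> \<longleftrightarrow>
    (\<forall>x y. \<phi> (x + y) = \<phi> x + \<phi> y) \<and> (\<forall>c x. \<phi> (c *\<^sub>C x) = c *\<^sub>C \<phi> x)"

definition positive_map :: "('a::cstar_algebra \<Rightarrow> 'b::cstar_algebra) \<Rightarrow> bool" where
  "positive_map \<phi> \<longleftrightarrow> (\<forall>x. positive x \<longrightarrow> positive (\<phi> x))"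

section \<open>Continuous functional calculus\<close>

text \<open>\<open>\<Phi>\<close> is a unital *-homomorphism from \<open>C(\<sigma>(x))\<close> to the algebra that sends the identity
  function to \<open>x\<close>.  A continuous function on \<open>\<sigma>(x)\<close> is represented by any total function that
  extends it; the second condition makes \<open>\<Phi>\<close> independent of the extension.  Such a \<open>\<Phi>\<close> exists
  for every normal, in particular for every self-adjoint, \<open>x\<close>, and it is unique on functions
  that are continuous on \<open>\<sigma>(x)\<close>.\<close>

definition cfc_hom :: "'a::cstar_algebra \<Rightarrow> ((complex \<Rightarrow> complex) \<Rightarrow> 'a) \<Rightarrow> bool" where
  "cfc_hom x \<Phi> \<longleftrightarrow>
     \<Phi> (\<lambda>z. 1) = 1 \<and> \<Phi> (\<lambda>z. z) = x \<and>
     (\<forall>g h. continuous_on (spectrum x) g \<and> (\<forall>z\<in>spectrum x. g z = h z) \<longrightarrow> \<Phi> g = \<Phi> h) \<and>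
     (\<forall>g h. continuous_on (spectrum x) g \<and> continuous_on (spectrum x) h \<longrightarrow>
        \<Phi> (\<lambda>z. g z + h z) = \<Phi> g + \<Phi> h \<and> \<Phi> (\<lambda>z. g z * h z) = \<Phi> g * \<Phi> h) \<and>
     (\<forall>c g. continuous_on (spectrum x) g \<longrightarrow>
        \<Phi> (\<lambda>z. c * g z) = c *\<^sub>C \<Phi> g \<and> \<Phi> (\<lambda>z. cnj (g z)) = adj (\<Phi> g))"

text \<open>\<open>f(x)\<close> for a real function \<open>f\<close> and a self-adjoint \<open>x\<close>; only the values of \<open>f\<close> on the
  (real) spectrum of \<open>x\<close> matter.\<close>

definition cfc :: "(real \<Rightarrow> real) \<Rightarrow> 'a::cstar_algebra \<Rightarrow> 'a" where
  "cfc f x = (THE b. \<exists>\<Phi>. cfc_hom x \<Phi> \<and> b = \<Phi> (\<lambda>z. complex_of_real (f (Re z))))"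

section \<open>Complex Hilbert spaces\<close>

text \<open>The complex inner product is linear in its first argument.\<close>

class chilbert_space = complex_normed_vector + real_inner + banach +
  fixes cinner :: "'a \<Rightarrow> 'a \<Rightarrow> complex"
  assumes cinner_commute: "cinner x y = cnj (cinner y x)"
    and cinner_add_left: "cinner (x + y) z = cinner x z + cinner y z"
    and cinner_scaleC_left: "cinner (c *\<^sub>C x) y = c * cinner x y"
    and Re_cinner: "Re (cinner x y) = inner x y"

lemma chilbert_Riesz:
  fixes l :: "'h::chilbert_space \<Rightarrow> real"
  assumes "bounded_linear l"
  obtains z where "\<And>x. l x = inner x z"
proof -
  interpret l: bounded_linear l by fact
  define J where "J x = (norm x)\<^sup>2 / 2 - l x" for x
  obtain K where K: "\<And>x. norm (l x) \<le> norm x * K"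
    using l.bounded by blast
  have J_ge: "- (K\<^sup>2 / 2) \<le> J x" for x
  proof -
    have "0 \<le> (norm x - K)\<^sup>2" by simp
    moreover have "l x \<le> norm x * K" using K[of x] by simp
    ultimately show ?thesis by (simp add: J_def power2_diff)
  qed
  have bdd: "bdd_below (range J)"
    using J_ge by (auto intro!: bdd_belowI)
  define m where "m = Inf (range J)"
  have m: "m \<le> J x" for x
    unfolding m_def using bdd by (auto intro: cInf_lower)
  have para: "(norm (x - y))\<^sup>2 = 4 * (J x + J y - 2 * J ((1/2) *\<^sub>R (x + y)))" for x y
    by (simp add: J_def l.add l.scaleR power2_norm_eq_inner inner_add inner_diff inner_commute
        algebra_simps)
  have "\<exists>x. J x < m + inverse (real (Suc n))" for n
  proof -
    have "m < m + inverse (real (Suc n))" by simp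
    then show ?thesis
      unfolding m_def using bdd by (subst (asm) cInf_less_iff) auto
  qed
  then obtain X where X: "\<And>n. J (X n) < m + inverse (real (Suc n))"
    by metis
  have "Cauchy X"
  proof (rule metric_CauchyI)
    fix e :: real assume e: "e > 0"
    obtain N where N: "inverse (real (Suc N)) < e\<^sup>2 / 8"
      using reals_Archimedean[of "e\<^sup>2 / 8"] e by auto
    have lin: "n < E" if "n = 4 * (p + q - 2 * h)" "m \<le> h" "p < m + u" "q < m + v"
      "u \<le> w" "v \<le> w" "w < E / 8" for n p q h u v w E :: real
      using that by simp
    have "dist (X i) (X j) < e" if "i \<ge> N" "j \<ge> N" for i j
    proof -
      have "inverse (real (Suc i)) \<le> inverse (real (Suc N))"
        "inverse (real (Suc j)) \<le> inverse (real (Suc N))"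
        using that by (auto intro!: le_imp_inverse_le)
      then have "(norm (X i - X j))\<^sup>2 < e\<^sup>2"
        using lin[OF para m X X] N by blast
      then show ?thesis
        using e by (simp add: dist_norm power_less_imp_less_base)
    qed
    then show "\<exists>M. \<forall>i\<ge>M. \<forall>j\<ge>M. dist (X i) (X j) < e" by blast
  qed
  then obtain z where z: "X \<longlonglongrightarrow> z"
    using convergent_eq_Cauchy by metis
  have "(\<lambda>n. J (X n)) \<longlonglongrightarrow> J z"
    unfolding J_def by (intro tendsto_intros z l.tendsto) simp
  moreover have "(\<lambda>n. m + inverse (real (Suc n))) \<longlonglongrightarrow> m + 0"
    by (intro tendsto_intros LIMSEQ_inverse_real_of_nat)
  ultimately have "J z \<le> m + 0"
    using X by (intro LIMSEQ_le[of _ "J z"]) (auto intro: less_imp_le)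
  then have Jz: "J z \<le> J y" for y
    using m[of y] by simp
  have "l x = inner x z" for x
  proof -
    define d where "d = inner x z - l x"
    define s where "s = 1 + (norm x)\<^sup>2"
    have s: "s > 0" by (simp add: s_def add_pos_nonneg)
    have "(norm (z + t *\<^sub>R x))\<^sup>2 = (norm z)\<^sup>2 + 2 * t * inner x z + t\<^sup>2 * (norm x)\<^sup>2" for t
      unfolding power2_norm_eq_inner
      by (simp add: inner_add inner_commute power2_eq_square algebra_simps)
    then have "J (z + t *\<^sub>R x) = J z + t * d + t\<^sup>2 * (norm x)\<^sup>2 / 2" for t
      by (simp add: J_def d_def l.add l.scaleR algebra_simps)
    then have ge: "0 \<le> t * d + t\<^sup>2 * (norm x)\<^sup>2 / 2" for t
      using Jz[of "z + t *\<^sub>R x"] by simp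
    have "t * d + t\<^sup>2 * (norm x)\<^sup>2 / 2 \<le> t * d + t\<^sup>2 * s / 2" for t
      by (simp add: s_def mult_left_mono)
    then have "0 \<le> - (d / s) * d + (- (d / s))\<^sup>2 * s / 2"
      using ge[of "- (d / s)"] by (meson order_trans)
    also have "\<dots> = - (d\<^sup>2 / (2 * s))"
      using s by (simp add: field_simps power2_eq_square)
    finally have "d\<^sup>2 / (2 * s) \<le> 0" by simp
    then have "d\<^sup>2 \<le> 0"
      using s by (simp add: divide_le_0_iff)
    then show ?thesis by (simp add: d_def)
  qed
  then show ?thesis using that by blast
qed

lemma Im_cinner:
  fixes x y :: "'h::chilbert_space"
  shows "Im (cinner x y) = - inner (\<i> *\<^sub>C x) y"
  using Re_cinner[of "\<i> *\<^sub>C x" y] by (simp add: cinner_scaleC_left)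

lemma cinner_eqI:
  fixes x y :: "'h::chilbert_space"
  assumes "\<And>z. cinner z x = cinner z y"
  shows "x = y"
  using assms Re_cinner by (metis inner_eq_zero_iff inner_diff_right right_minus_eq)

lemma cinner_scaleC_right:
  fixes x y :: "'h::chilbert_space"
  shows "cinner x (c *\<^sub>C y) = cnj c * cinner x y"
  using cinner_commute cinner_scaleC_left by (metis complex_cnj_mult)

lemma cinner_add_right:
  fixes x y :: "'h::chilbert_space"
  shows "cinner x (y + z) = cinner x y + cinner x z"
  using cinner_commute cinner_add_left by (metis complex_cnj_add)

section \<open>The C*-algebra of bounded operators\<close>

typedef (overloaded) ('h::chilbert_space) bop =
  "{T :: 'h \<Rightarrow>\<^sub>L 'h. \<forall>c x. blinfun_apply T (c *\<^sub>C x) = c *\<^sub>C blinfun_apply T x}"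
  morphisms blinfun_of_bop Abs_bop
  by (rule exI[of _ id_blinfun]) simp

setup_lifting type_definition_bop

lift_definition bop_apply :: "'h::chilbert_space bop \<Rightarrow> 'h \<Rightarrow> 'h"  (infixr "\<bullet>\<bullet>" 76)
  is blinfun_apply .

lemma scaleC_zero_right [simp]: "c *\<^sub>C (0::'a::complex_normed_vector) = 0"
  using scaleC_add_right[of c 0 "0::'a"] by simp

lemma scaleC_one_left [simp]: "1 *\<^sub>C (x::'a::complex_normed_vector) = x"
  using scaleC_of_real[of 1 x] by simp

lemma scaleC_minus_right: "c *\<^sub>C (- x) = - (c *\<^sub>C (x::'a::complex_normed_vector))"
  using scaleC_add_right[of c x "- x"] by (simp add: eq_neg_iff_add_eq_0 add.commute)

lemma scaleC_diff_right: "c *\<^sub>C (x - y) = c *\<^sub>C x - c *\<^sub>C (y::'a::complex_normed_vector)"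
  using scaleC_add_right[of c x "- y"] by (simp add: scaleC_minus_right)

lemma scaleC_scaleR: "c *\<^sub>C (r *\<^sub>R x) = r *\<^sub>R (c *\<^sub>C (x::'a::complex_normed_vector))"
  by (metis scaleC_of_real scaleC_scaleC mult.commute)

lemma bounded_linear_scaleC: "bounded_linear (\<lambda>x::'a::complex_normed_vector. c *\<^sub>C x)"
  by (rule bounded_linear_intro[of _ "cmod c"])
    (simp_all add: scaleC_add_right scaleC_scaleR norm_scaleC mult.commute)

lift_definition blinfun_scaleC :: "complex \<Rightarrow> ('h \<Rightarrow>\<^sub>L 'h) \<Rightarrow> ('h::chilbert_space \<Rightarrow>\<^sub>L 'h)"
  is "\<lambda>c T x. c *\<^sub>C T x"
  by (rule bounded_linear_compose[OF bounded_linear_scaleC])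

instantiation bop :: (chilbert_space) real_normed_vector
begin

lift_definition zero_bop :: "'a bop" is 0 by simp
lift_definition plus_bop :: "'a bop \<Rightarrow> 'a bop \<Rightarrow> 'a bop" is "(+)"
  by (simp add: blinfun.add_left scaleC_add_right)
lift_definition minus_bop :: "'a bop \<Rightarrow> 'a bop \<Rightarrow> 'a bop" is "(-)"
  by (simp add: blinfun.diff_left scaleC_diff_right)
lift_definition uminus_bop :: "'a bop \<Rightarrow> 'a bop" is uminus
  by (simp add: blinfun.minus_left scaleC_minus_right)
lift_definition scaleR_bop :: "real \<Rightarrow> 'a bop \<Rightarrow> 'a bop" is "(*\<^sub>R)"
  by (simp add: blinfun.scaleR_left scaleC_scaleR)
lift_definition norm_bop :: "'a bop \<Rightarrow> real" is norm .
definition sgn_bop :: "'a bop \<Rightarrow> 'a bop" where "sgn_bop T = inverse (norm T) *\<^sub>R T"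
definition dist_bop :: "'a bop \<Rightarrow> 'a bop \<Rightarrow> real" where "dist_bop S T = norm (S - T)"
definition uniformity_bop :: "('a bop \<times> 'a bop) filter" where
  "uniformity_bop = (INF e\<in>{0<..}. principal {(x, y). dist x y < e})"
definition open_bop :: "'a bop set \<Rightarrow> bool" where
  "open_bop U = (\<forall>x\<in>U. \<forall>\<^sub>F (x', y) in uniformity. x' = x \<longrightarrow> y \<in> U)"

instance
proof
  fix S T U :: "'a bop" and r s :: real
  show "S + T + U = S + (T + U)" "S + T = T + S" "0 + S = S" "- S + S = 0" "S - T = S + - T"
    by (transfer; simp)+
  show "r *\<^sub>R (S + T) = r *\<^sub>R S + r *\<^sub>R T" "(r + s) *\<^sub>R S = r *\<^sub>R S + s *\<^sub>R S"
    by (transfer; simp add: scaleR_add_right scaleR_add_left)+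
  show "r *\<^sub>R s *\<^sub>R S = (r * s) *\<^sub>R S" "1 *\<^sub>R S = S"
    by (transfer; simp)+
  show "norm S = 0 \<longleftrightarrow> S = 0" "norm (r *\<^sub>R S) = \<bar>r\<bar> * norm S" 
    by (transfer; simp)+
  show "norm (S + T) \<le> norm S + norm T"
    by (transfer; rule norm_triangle_ineq)
qed (simp_all add: sgn_bop_def dist_bop_def uniformity_bop_def open_bop_def)

end

instantiation bop :: (chilbert_space) complex_normed_vector
begin

lift_definition scaleC_bop :: "complex \<Rightarrow> 'a bop \<Rightarrow> 'a bop" is blinfun_scaleC
  by (simp add: blinfun_scaleC.rep_eq scaleC_scaleC mult.commute)

instance
proof
  fix c d :: complex and S T :: "'a bop" and r :: real
  show "c *\<^sub>C (S + T) = c *\<^sub>C S + c *\<^sub>C T"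
    by transfer (auto intro!: blinfun_eqI simp: blinfun_scaleC.rep_eq blinfun.add_left scaleC_add_right)
  show "(c + d) *\<^sub>C S = c *\<^sub>C S + d *\<^sub>C S"
    by transfer (auto intro!: blinfun_eqI simp: blinfun_scaleC.rep_eq blinfun.add_left scaleC_add_left)
  show "c *\<^sub>C d *\<^sub>C S = (c * d) *\<^sub>C S"
    by transfer (auto intro!: blinfun_eqI simp: blinfun_scaleC.rep_eq scaleC_scaleC)
  show "complex_of_real r *\<^sub>C S = r *\<^sub>R S"
    by transfer (auto intro!: blinfun_eqI simp: blinfun_scaleC.rep_eq blinfun.scaleR_left scaleC_of_real)
  have le: "norm (blinfun_scaleC c T) \<le> cmod c * norm T" for c and T :: "'a \<Rightarrow>\<^sub>L 'a"
    by (rule norm_blinfun_bound)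
      (auto simp: blinfun_scaleC.rep_eq norm_scaleC mult.assoc intro!: mult_left_mono norm_blinfun)
  have "norm (blinfun_scaleC c T) = cmod c * norm T" for T :: "'a \<Rightarrow>\<^sub>L 'a"
  proof (cases "c = 0")
    case True
    then show ?thesis using le[of c T] by simp
  next
    case False
    have "T = blinfun_scaleC (inverse c) (blinfun_scaleC c T)"
      using False by (intro blinfun_eqI) (simp add: blinfun_scaleC.rep_eq scaleC_scaleC)
    then have "norm T \<le> cmod (inverse c) * norm (blinfun_scaleC c T)"
      using le by metis
    then have "cmod c * norm T \<le> norm (blinfun_scaleC c T)"
      using False by (simp add: norm_divide field_simps)
    then show ?thesis using le[of c T] by simp
  qed
  then show "norm (c *\<^sub>C S) = cmod c * norm S"
    by transfer auto
qed

end

instance bop :: (chilbert_space) banach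
proof
  fix X :: "nat \<Rightarrow> 'a bop"
  assume X: "Cauchy X"
  have dist: "dist S T = dist (blinfun_of_bop S) (blinfun_of_bop T)" for S T :: "'a bop"
    by (simp add: dist_norm norm_bop.rep_eq minus_bop.rep_eq)
  have "Cauchy (\<lambda>n. blinfun_of_bop (X n))"
    using X by (simp add: Cauchy_def dist)
  then obtain L where L: "(\<lambda>n. blinfun_of_bop (X n)) \<longlonglongrightarrow> L"
    using convergent_eq_Cauchy by metis
  have lin: "blinfun_of_bop T (c *\<^sub>C x) = c *\<^sub>C blinfun_of_bop T x" for T :: "'a bop" and c x
    using blinfun_of_bop[of T] by simp
  have app: "(\<lambda>n. blinfun_of_bop (X n) x) \<longlonglongrightarrow> L x" for x
    by (intro blinfun.tendsto L tendsto_const)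
  have "L (c *\<^sub>C x) = c *\<^sub>C L x" for c x
  proof (rule LIMSEQ_unique[OF app])
    show "(\<lambda>n. blinfun_of_bop (X n) (c *\<^sub>C x)) \<longlonglongrightarrow> c *\<^sub>C L x"
      using bounded_linear.tendsto[OF bounded_linear_scaleC app, of c x]
      by (simp add: lin)
  qed
  then have "blinfun_of_bop (Abs_bop L) = L"
    by (intro Abs_bop_inverse) simp
  then have "X \<longlonglongrightarrow> Abs_bop L"
    using L by (simp add: tendsto_iff dist)
  then show "convergent X"
    by (auto simp: convergent_def)
qed

lemma bop_eqI: "(\<And>x. S \<bullet>\<bullet> x = T \<bullet>\<bullet> x) \<Longrightarrow> S = T"
  by transfer (auto intro: blinfun_eqI)

lemma bop_adjoint_exists:
  fixes T :: "'h::chilbert_space bop"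
  shows "\<exists>!S. \<forall>x y. cinner (T \<bullet>\<bullet> x) y = cinner x (S \<bullet>\<bullet> y)"
proof (rule ex_ex1I)
  have bl: "bounded_linear (\<lambda>x. inner (blinfun_of_bop T x) y)" for y
    by (intro bounded_linear_compose[OF bounded_linear_inner_left] blinfun.bounded_linear_right)
  have "\<exists>z. \<forall>x. inner (T \<bullet>\<bullet> x) y = inner x z" for y
    using chilbert_Riesz[OF bl[of y]] by (auto simp: bop_apply.rep_eq)
  then obtain S where "\<And>x y. inner (T \<bullet>\<bullet> x) y = inner x (S y)"
    by metis
  moreover have "T \<bullet>\<bullet> (\<i> *\<^sub>C x) = \<i> *\<^sub>C (T \<bullet>\<bullet> x)" for x
    by transfer simp
  ultimately have S: "cinner (T \<bullet>\<bullet> x) y = cinner x (S y)" for x y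
    by (intro complex_eqI) (simp_all add: Re_cinner Im_cinner flip: \<open>\<And>x. T \<bullet>\<bullet> (\<i> *\<^sub>C x) = _\<close>)
  have add: "S (x + y) = S x + S y" for x y
    by (rule cinner_eqI) (simp add: cinner_add_right flip: S)
  have scale: "S (c *\<^sub>C x) = c *\<^sub>C S x" for c x
    by (rule cinner_eqI) (simp add: cinner_scaleC_right flip: S)
  define K where "K = norm (blinfun_of_bop T)"
  have "norm (S y) \<le> norm y * K" for y
  proof (cases "S y = 0")
    case False
    have "norm (S y) * norm (S y) = inner (T \<bullet>\<bullet> S y) y"
      by (metis Re_cinner S power2_eq_square power2_norm_eq_inner)
    also have "\<dots> \<le> norm (T \<bullet>\<bullet> S y) * norm y"
      by (rule norm_cauchy_schwarz)
    also have "\<dots> \<le> (K * norm (S y)) * norm y"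
      unfolding K_def bop_apply.rep_eq by (intro mult_right_mono norm_blinfun) simp
    finally show ?thesis using False by (simp add: mult.commute mult.left_commute)
  qed (simp add: K_def)
  then have "bounded_linear S"
    using scale[of "complex_of_real _"]
    by (intro bounded_linear_intro[of _ K]) (simp_all add: add scaleC_of_real)
  then have "bop_apply (Abs_bop (Blinfun S)) = S"
    using scale by (auto simp: bop_apply.rep_eq Abs_bop_inverse bounded_linear_Blinfun_apply)
  then show "\<exists>S. \<forall>x y. cinner (T \<bullet>\<bullet> x) y = cinner x (S \<bullet>\<bullet> y)"
    using S by metis
qed (metis bop_eqI cinner_eqI)

instantiation bop :: (chilbert_space) cstar_algebra
begin

lift_definition one_bop :: "'a bop" is id_blinfun by simp
lift_definition times_bop :: "'a bop \<Rightarrow> 'a bop \<Rightarrow> 'a bop" is "(o\<^sub>L)" by simp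
definition adj_bop :: "'a bop \<Rightarrow> 'a bop" where
  "adj_bop T = (THE S. \<forall>x y. cinner (T \<bullet>\<bullet> x) y = cinner x (S \<bullet>\<bullet> y))"

lemma bop_apply_simps:
  "(S * T) \<bullet>\<bullet> x = S \<bullet>\<bullet> (T \<bullet>\<bullet> x)" "(1::'a bop) \<bullet>\<bullet> x = x" "(S + T) \<bullet>\<bullet> x = S \<bullet>\<bullet> x + T \<bullet>\<bullet> x"
  "(c *\<^sub>C S) \<bullet>\<bullet> x = c *\<^sub>C (S \<bullet>\<bullet> x)" "(r *\<^sub>R S) \<bullet>\<bullet> x = r *\<^sub>R (S \<bullet>\<bullet> x)"
  "S \<bullet>\<bullet> (x + y) = S \<bullet>\<bullet> x + S \<bullet>\<bullet> y" "S \<bullet>\<bullet> (c *\<^sub>C x) = c *\<^sub>C (S \<bullet>\<bullet> x)" "S \<bullet>\<bullet> (r *\<^sub>R x) = r *\<^sub>R (S \<bullet>\<bullet> x)"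
  for S T :: "'a bop"
  by (transfer; simp add: blinfun.add_left blinfun.add_right blinfun.scaleR_left
      blinfun.scaleR_right blinfun_scaleC.rep_eq)+

lemma cinner_adj: "cinner (T \<bullet>\<bullet> x) y = cinner x (adj T \<bullet>\<bullet> y)" for T :: "'a bop"
  unfolding adj_bop_def using theI'[OF bop_adjoint_exists[of T]] by blast

lemma norm_bop_apply: "norm (T \<bullet>\<bullet> x) \<le> norm T * norm x" for T :: "'a bop"
  by transfer (rule norm_blinfun)

lemma norm_bop_bound: "0 \<le> b \<Longrightarrow> (\<And>x. norm (T \<bullet>\<bullet> x) \<le> b * norm x) \<Longrightarrow> norm T \<le> b"
  for T :: "'a bop"
  by transfer (rule norm_blinfun_bound)

instance
proof
  fix S T U :: "'a bop" and c :: complex and r :: real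
  have eq: "A = B" if "\<And>x y. cinner x (A \<bullet>\<bullet> y) = cinner x (B \<bullet>\<bullet> y)" for A B :: "'a bop"
    using that by (intro bop_eqI cinner_eqI)
  have adj2: "cinner x (T \<bullet>\<bullet> y) = cinner (adj T \<bullet>\<bullet> x) y" for T :: "'a bop" and x y
    using cinner_adj[of T y x] cinner_commute[of x "T \<bullet>\<bullet> y"] cinner_commute[of "adj T \<bullet>\<bullet> x" y]
    by simp
  show "S * T * U = S * (T * U)" "1 * S = S" "S * 1 = S"
    "(S + T) * U = S * U + T * U" "S * (T + U) = S * T + S * U"
    "r *\<^sub>R S * T = r *\<^sub>R (S * T)" "S * r *\<^sub>R T = r *\<^sub>R (S * T)"
    "c *\<^sub>C S * T = c *\<^sub>C (S * T)" "S * c *\<^sub>C T = c *\<^sub>C (S * T)"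
    by (rule bop_eqI; simp add: bop_apply_simps)+
  show nm: "norm (S * T) \<le> norm S * norm T" for S T :: "'a bop"
    by transfer (rule norm_blinfun_compose)
  show aa: "adj (adj S) = S" for S :: "'a bop"
    by (rule eq) (simp only: adj2[of _ S] cinner_adj[of "adj S", symmetric])
  show "adj (S + T) = adj S + adj T"
    by (rule eq) (simp add: cinner_add_left cinner_add_right bop_apply_simps flip: cinner_adj)
  show "adj (c *\<^sub>C S) = cnj c *\<^sub>C adj S"
    by (rule eq)
      (simp add: cinner_scaleC_left cinner_scaleC_right bop_apply_simps flip: cinner_adj)
  show "adj (S * T) = adj T * adj S"
    by (rule eq) (simp add: bop_apply_simps flip: cinner_adj)
  have sq: "(norm T)\<^sup>2 \<le> norm (adj T * T)" for T :: "'a bop"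
  proof -
    have "norm (T \<bullet>\<bullet> x) \<le> sqrt (norm (adj T * T)) * norm x" for x
    proof (rule power2_le_imp_le)
      have "(norm (T \<bullet>\<bullet> x))\<^sup>2 = inner x ((adj T * T) \<bullet>\<bullet> x)"
        by (simp add: bop_apply_simps power2_norm_eq_inner flip: Re_cinner cinner_adj)
      also have "\<dots> \<le> norm x * norm ((adj T * T) \<bullet>\<bullet> x)"
        by (rule norm_cauchy_schwarz)
      also have "\<dots> \<le> norm x * (norm (adj T * T) * norm x)"
        by (intro mult_left_mono norm_bop_apply) simp
      also have "\<dots> = (sqrt (norm (adj T * T)) * norm x)\<^sup>2"
        by (simp add: power_mult_distrib power2_eq_square[of "norm x"] mult.left_commute)
      finally show "(norm (T \<bullet>\<bullet> x))\<^sup>2 \<le> (sqrt (norm (adj T * T)) * norm x)\<^sup>2" .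
    qed simp
    then have "norm T \<le> sqrt (norm (adj T * T))"
      by (intro norm_bop_bound) auto
    then have "(norm T)\<^sup>2 \<le> (sqrt (norm (adj T * T)))\<^sup>2"
      by (intro power_mono) simp_all
    then show ?thesis by simp
  qed
  have "norm T \<le> norm (adj T)" for T :: "'a bop"
  proof (cases "norm T = 0")
    case False
    then show ?thesis
      using order_trans[OF sq nm[of "adj T" T]] by (simp add: power2_eq_square)
  qed simp
  from this[of S] this[of "adj S"] have "norm (adj S) = norm S"
    using aa[of S] by (simp add: order_antisym)
  then show "norm (adj S * S) = (norm S)\<^sup>2"
    using sq[of S] nm[of "adj S" S] by (simp add: power2_eq_square)
qed

end

section \<open>Von Neumann algebras and the spectral preorder\<close>

text \<open>A von Neumann algebra is represented by its carrier, a set of bounded operators.  Spectra,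
  positivity and functional calculus of its elements are those of \<^typ>\<open>'h bop\<close>; by spectral
  permanence they agree with the ones formed inside the algebra.\<close>

definition commutant :: "'h::chilbert_space bop set \<Rightarrow> 'h bop set" where
  "commutant N = {y. \<forall>x\<in>N. x * y = y * x}"

definition von_neumann_algebra :: "'h::chilbert_space bop set \<Rightarrow> bool" where
  "von_neumann_algebra M \<longleftrightarrow> (\<forall>x\<in>M. adj x \<in> M) \<and> commutant (commutant M) = M"

definition projection :: "'h::chilbert_space bop \<Rightarrow> bool" where
  "projection p \<longleftrightarrow> adj p = p \<and> p * p = p"

text \<open>The scalar measure \<open>S \<mapsto> \<langle>E(S)\<xi>, \<xi>\<rangle>\<close> of a projection-valued measure \<open>E\<close>.\<close>

definition scalar_measure ::
    "(real set \<Rightarrow> 'h::chilbert_space bop) \<Rightarrow> 'h \<Rightarrow> real measure" where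
  "scalar_measure E \<xi> = measure_of UNIV (sets borel) (\<lambda>S. ennreal (Re (cinner (E S \<bullet>\<bullet> \<xi>) \<xi>)))"

text \<open>\<open>E\<close> is a projection-valued Borel measure on the real line with bounded support and
  \<open>x = \<integral> t dE(t)\<close> (in the weak sense).  The spectral theorem provides such an \<open>E\<close> for every
  self-adjoint \<open>x\<close>, unique on Borel sets.\<close>

definition spectral_measure ::
    "'h::chilbert_space bop \<Rightarrow> (real set \<Rightarrow> 'h bop) \<Rightarrow> bool" where
  "spectral_measure x E \<longleftrightarrow>
     (\<forall>S\<in>sets borel. projection (E S)) \<and> E UNIV = 1 \<and>
     (\<forall>A :: nat \<Rightarrow> real set. range A \<subseteq> sets borel \<and> disjoint_family A \<longrightarrow>
        (\<forall>\<xi>. (\<lambda>n. E (A n) \<bullet>\<bullet> \<xi>) sums (E (\<Union>n. A n) \<bullet>\<bullet> \<xi>))) \<and>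
     (\<exists>R. E {-R..R} = 1) \<and>
     (\<forall>\<xi>. cinner (x \<bullet>\<bullet> \<xi>) \<xi> = complex_of_real (\<integral>t. t \<partial>scalar_measure E \<xi>))"

text \<open>The spectral projection \<open>\<chi>\<^sub>S(x)\<close>, for a self-adjoint \<open>x\<close> and a Borel set \<open>S\<close>.\<close>

definition spectral_projection ::
    "real set \<Rightarrow> 'h::chilbert_space bop \<Rightarrow> 'h bop" where
  "spectral_projection S x = (THE p. \<exists>E. spectral_measure x E \<and> p = E S)"

definition mvn_equivalent ::
    "'h::chilbert_space bop set \<Rightarrow> 'h bop \<Rightarrow> 'h bop \<Rightarrow> bool" where
  "mvn_equivalent M p q \<longleftrightarrow> projection p \<and> projection q \<and>
     (\<exists>v\<in>M. adj v * v = p \<and> v * adj v = q)"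

definition subprojection :: "'h::chilbert_space bop \<Rightarrow> 'h bop \<Rightarrow> bool" where
  "subprojection r q \<longleftrightarrow> projection r \<and> projection q \<and> q * r = r"

definition spectral_le ::
    "'h::chilbert_space bop set \<Rightarrow> 'h bop \<Rightarrow> 'h bop \<Rightarrow> bool" where
  "spectral_le M x y \<longleftrightarrow>
     x \<in> M \<and> self_adjoint x \<and> y \<in> M \<and> self_adjoint y \<and>
     (\<forall>\<alpha>. \<exists>r\<in>M. subprojection r (spectral_projection {\<alpha><..} y) \<and>
        mvn_equivalent M (spectral_projection {\<alpha><..} x) r)"

end

theory Submission
  imports Defs "HOL-Computational_Algebra.Fundamental_Theorem_Algebra"
begin

text \<open>
  Fix \<open>\<alpha>\<close>, and let \<open>p\<close> and \<open>q\<close> be the spectral projections of \<open>f(\<phi>(a))\<close> and \<open>\<phi>(f(a))\<close> for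
  \<open>(\<alpha>, \<infinity>)\<close>.  If \<open>\<xi>\<close> is a unit vector with \<open>p \<xi> = \<xi>\<close>, then \<open>f \<langle>\<phi>(a) \<xi>, \<xi>\<rangle> > \<alpha>\<close> since \<open>f\<close> is
  monotone; if \<open>q \<xi> = 0\<close>, then \<open>\<langle>\<phi>(f(a)) \<xi>, \<xi>\<rangle> \<le> \<alpha>\<close>.  Jensen's inequality for the state
  \<open>b \<mapsto> \<langle>\<phi>(b) \<xi>, \<xi>\<rangle>\<close> excludes that both hold.  Hence \<open>q p\<close> has the same kernel as \<open>p\<close>, and the
  partial isometry in its polar decomposition carries \<open>p\<close> to a subprojection of \<open>q\<close>.

  The functional calculus rests on an elementary proof that \<open>\<parallel>h\<parallel>\<close> or \<open>- \<parallel>h\<parallel>\<close> lies in the spectrum of a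
  self-adjoint \<open>h\<close>; it uses only square roots of \<open>1 - u\<close> for \<open>\<parallel>u\<parallel> < 1\<close>.
  The spectral measure of \<open>y\<close> comes from the Stieltjes measures of \<open>t \<mapsto> \<parallel>\<xi>\<parallel>\<^sup>2 - \<parallel>q\<^sub>t \<xi>\<parallel>\<^sup>2\<close>, where \<open>q\<^sub>t\<close>
  is the support projection of \<open>(y - t)\<^sub>+\<close>.
\<close>

section \<open>Invertible and self-adjoint elements\<close>

text \<open>A convex \<open>f\<close> need not be operator convex, so
  \<open>f(\<phi>(a)) \<le> \<phi>(f(a))\<close> can fail as an operator inequality; Jensen's
  inequality is available only in one vector state at a time. The spectral preorder needs no more
  than that: the range of \<open>p\<close> and the kernel of \<open>q\<close> must meet trivially,
  which is a statement about single vectors. Monotonicity makes the set where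
  \<open>f > \<alpha>\<close> a half-line inside \<open>I\<close>, and on the spectral subspace of a
  half-line the quadratic form of \<open>\<phi>(a)\<close> takes its unit-vector values in that
  half-line. Both \<open>cfc\<close> and \<open>spectral_projection\<close> are definite
  descriptions, so existence and uniqueness have to be settled before either can be used. For the
  projections only half-lines matter. They are pinned down by \<open>upper_projection\<close>, a
  condition on the quadratic form of \<open>y\<close> that is satisfied by every spectral measure of
  \<open>y\<close> and also by the support of the positive part of \<open>y - \<alpha>\<close>; the
  two therefore agree.\<close>

lemma scaleC_minus_left: "(- c) *\<^sub>C (x::'a::complex_normed_vector) = - (c *\<^sub>C x)"
proof -
  have "0 *\<^sub>C x = 0"
    using scaleC_of_real[of 0 x] by simp
  then show ?thesis
    using scaleC_add_left[of c "- c" x] by (simp add: eq_neg_iff_add_eq_0 add.commute)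
qed

lemma scaleC_zero_left [simp]: "0 *\<^sub>C (x::'a::complex_normed_vector) = 0"
  using scaleC_of_real[of 0 x] by simp

lemma scaleC_diff_left: "(c - d) *\<^sub>C (x::'a::complex_normed_vector) = c *\<^sub>C x - d *\<^sub>C x"
  using scaleC_add_left[of c "- d" x] by (simp add: scaleC_minus_left)

lemma adj_zero [simp]: "adj (0::'a::cstar_algebra) = 0"
  using adj_add[of 0 "0::'a"] by simp

lemma adj_minus: "adj (- x) = - adj (x::'a::cstar_algebra)"
  using adj_add[of x "- x"] by (simp add: eq_neg_iff_add_eq_0 add.commute)

lemma adj_diff: "adj (x - y) = adj x - adj (y::'a::cstar_algebra)"
  using adj_add[of x "- y"] by (simp add: adj_minus)

lemma adj_scaleR: "adj (r *\<^sub>R x) = r *\<^sub>R adj (x::'a::cstar_algebra)"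
  using adj_scaleC[of "complex_of_real r" x] by (simp add: scaleC_of_real)

lemma adj_one [simp]: "adj (1::'a::cstar_algebra) = 1"
  by (metis adj_adj adj_mult mult_1_left mult_1_right)

lemma norm_adj [simp]: "norm (adj x) = norm (x::'a::cstar_algebra)"
proof -
  have le: "norm y \<le> norm (adj y)" for y :: 'a
  proof (cases "norm y = 0")
    case False
    have "norm y * norm y \<le> norm (adj y) * norm y"
      using cstar_identity[of y] norm_mult_ineq[of "adj y" y] by (simp add: power2_eq_square)
    then show ?thesis using False by simp
  qed simp
  show ?thesis using le[of x] le[of "adj x"] by (simp add: adj_adj)
qed

text \<open>Only an inequality, because the norm of the unit is 0 in the zero algebra, which the
  class admits.\<close>

lemma norm_one_le: "norm (1::'a::cstar_algebra) \<le> 1"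
  using cstar_identity[of "1::'a"] by (auto simp: power2_eq_square)

lemma bounded_linear_adj: "bounded_linear (adj :: 'a::cstar_algebra \<Rightarrow> 'a)"
  by (rule bounded_linear_intro[of _ 1]) (simp_all add: adj_add adj_scaleR)

lemma self_adjoint_add: "self_adjoint x \<Longrightarrow> self_adjoint y \<Longrightarrow> self_adjoint (x + y)"
  by (simp add: self_adjoint_def adj_add)

lemma self_adjoint_diff: "self_adjoint x \<Longrightarrow> self_adjoint y \<Longrightarrow> self_adjoint (x - y)"
  by (simp add: self_adjoint_def adj_diff)

lemma self_adjoint_scaleR: "self_adjoint x \<Longrightarrow> self_adjoint (r *\<^sub>R x)"
  by (simp add: self_adjoint_def adj_scaleR)

lemma self_adjoint_one [simp]: "self_adjoint 1"
  by (simp add: self_adjoint_def)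

lemma self_adjoint_square: "self_adjoint x \<Longrightarrow> self_adjoint (x * x)"
  by (simp add: self_adjoint_def adj_mult)

lemma norm_square: "self_adjoint x \<Longrightarrow> norm (x * x) = (norm x)\<^sup>2"
  using cstar_identity[of x] by (simp add: self_adjoint_def)

lemma continuous_on_adj [continuous_intros]:
  "continuous_on S f \<Longrightarrow> continuous_on S (\<lambda>t. adj (f t :: 'a::cstar_algebra))"
  by (rule bounded_linear.continuous_on[OF bounded_linear_adj])

section \<open>Invertible elements, square roots near the unit, and spectral values\<close>

definition has_inverse :: "'a::monoid_mult \<Rightarrow> bool" where
  "has_inverse x \<longleftrightarrow> (\<exists>y. y * x = 1 \<and> x * y = 1)"

lemma spectrum_iff: "c \<in> spectrum x \<longleftrightarrow> \<not> has_inverse (x - c *\<^sub>C 1)"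
  by (simp add: spectrum_def has_inverse_def)

lemma has_inverseI_left_right: "y * x = 1 \<Longrightarrow> x * z = 1 \<Longrightarrow> has_inverse x"
  unfolding has_inverse_def by (metis mult.assoc mult_1_left mult_1_right)

lemma has_inverse_mult: "has_inverse x \<Longrightarrow> has_inverse y \<Longrightarrow> has_inverse (x * y)"
  unfolding has_inverse_def by (metis mult.assoc mult_1_left mult_1_right)

lemma inverse_commute:
  fixes y :: "'a::monoid_mult"
  assumes "y * x = 1" "x * y = 1" "c * x = x * c"
  shows "c * y = y * c"
  by (metis assms mult.assoc mult_1_left mult_1_right)

lemma self_adjoint_inverse:
  fixes y :: "'a::cstar_algebra"
  assumes "y * x = 1" "x * y = 1" "self_adjoint x"
  shows "self_adjoint y"
  by (metis assms adj_mult adj_one mult.assoc mult_1_left mult_1_right self_adjoint_def)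

lemma has_inverse_scaleC:
  fixes x :: "'a::cstar_algebra"
  assumes "c \<noteq> 0" "has_inverse x"
  shows "has_inverse (c *\<^sub>C x)"
proof -
  obtain y where "y * x = 1" "x * y = 1"
    using assms by (auto simp: has_inverse_def)
  then show ?thesis
    using assms(1) unfolding has_inverse_def
    by (intro exI[of _ "inverse c *\<^sub>C y"]) (simp add: scaleC_mult_left scaleC_mult_right scaleC_scaleC)
qed


text \<open>In place of the Neumann series, a right and a left inverse are found as fixed points of
  the contractions \<open>y \<mapsto> 1 + b * y\<close> and
  \<open>y \<mapsto> 1 + y * b\<close>.\<close>

lemma has_inverse_one_minus:
  fixes b :: "'a::cstar_algebra"
  assumes "norm b < 1"
  shows "has_inverse (1 - b)"
proof -
  have "\<exists>!y. y \<in> UNIV \<and> 1 + b * y = y"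
  proof (rule Banach_fix[of _ "norm b"])
    show "dist (1 + b * x) (1 + b * y) \<le> norm b * dist x y" for x y
      using norm_mult_ineq[of b "x - y"] by (simp add: dist_norm right_diff_distrib)
  qed (use assms in \<open>simp_all add: complete_UNIV\<close>)
  then obtain y where "1 + b * y = y" by auto
  then have y: "(1 - b) * y = 1"
    by (metis add_diff_cancel_right' left_diff_distrib mult_1_left)
  have "\<exists>!y. y \<in> UNIV \<and> 1 + y * b = y"
  proof (rule Banach_fix[of _ "norm b"])
    show "dist (1 + x * b) (1 + y * b) \<le> norm b * dist x y" for x y
      using norm_mult_ineq[of "x - y" b] by (simp add: dist_norm left_diff_distrib mult.commute)
  qed (use assms in \<open>simp_all add: complete_UNIV\<close>)
  then obtain z where "1 + z * b = z" by auto
  then have z: "z * (1 - b) = 1"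
    by (metis add_diff_cancel_right' right_diff_distrib mult_1_right)
  show ?thesis
    by (rule has_inverseI_left_right[OF z y])
qed

text \<open>From \<open>y = 1 + y * b\<close> the term \<open>y * b\<close> is absorbed on the left.
  The bound 2 does not depend on \<open>b\<close>, which allows \<open>\<delta>\<close> to be fixed
  before \<open>t\<close> in \<open>no_inverse_one_minus_square\<close>.\<close>

lemma norm_inverse_one_minus_le:
  fixes b :: "'a::cstar_algebra"
  assumes "norm b \<le> 1/2" and "y * (1 - b) = 1"
  shows "norm y \<le> 2"
proof -
  have "y = 1 + y * b"
    using assms(2) by (simp add: right_diff_distrib diff_eq_eq add.commute)
  then have "norm y \<le> norm (1::'a) + norm (y * b)"
    by (metis norm_triangle_ineq)
  also have "\<dots> \<le> 1 + norm y * (1/2)"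
    using norm_mult_ineq[of y b] mult_left_mono[OF assms(1) norm_ge_zero[of y]] norm_one_le[where 'a='a]
    by linarith
  finally show ?thesis by simp
qed

text \<open>The square root is \<open>1 - y\<close>, where \<open>y\<close> is the fixed point of \<open>y \<mapsto> (u + y\<^sup>2) / 2\<close>.\<close>

lemma sqrt_one_minus:
  fixes u :: "'a::cstar_algebra"
  assumes "self_adjoint u" and "norm u < 1"
  obtains s where "self_adjoint s" "s * s = 1 - u" "\<And>c. c * u = u * c \<Longrightarrow> c * s = s * c"
proof -
  define r where "r = norm u"
  have r: "0 \<le> r" "r < 1" using assms(2) by (auto simp: r_def)
  \<comment> \<open>Self-adjointness and commutation with everything that commutes with
    \<open>u\<close> are closed conditions preserved by the map, so the fixed point inherits them
    from \<open>S\<close>. The radius \<open>r\<close> works because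
    \<open>(r + r * r) / 2 \<le> r\<close>, and on this ball the map contracts by the factor
    \<open>r\<close>.\<close>
  define S where "S = cball 0 r \<inter> {y. adj y = y} \<inter> (\<Inter>c\<in>{c. c * u = u * c}. {y. c * y = y * c})"
  have S_iff: "y \<in> S \<longleftrightarrow> norm y \<le> r \<and> adj y = y \<and> (\<forall>c. c * u = u * c \<longrightarrow> c * y = y * c)" for y
    unfolding S_def mem_cball_0[symmetric] by blast
  have "closed S"
    unfolding S_def
    by (intro closed_Int closed_INT ballI closed_cball closed_Collect_eq continuous_intros)
  have "\<exists>!y. y \<in> S \<and> (1/2) *\<^sub>R (u + y * y) = y"
  proof (rule Banach_fix[of _ r])
    show "complete S"
      using \<open>closed S\<close> by (simp add: complete_eq_closed)
    have "u \<in> S"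
      using assms unfolding S_iff r_def self_adjoint_def by blast
    then show "S \<noteq> {}" by auto
    show "(\<lambda>y. (1/2) *\<^sub>R (u + y * y)) ` S \<subseteq> S"
    proof (intro image_subsetI)
      fix y assume y: "y \<in> S"
      then have ny: "norm y \<le> r" and ay: "adj y = y"
        unfolding S_iff by blast+
      have "norm (y * y) \<le> r * r"
        by (intro order_trans[OF norm_mult_ineq] mult_mono ny r norm_ge_zero)
      also have "r * r \<le> r" using r by (simp add: mult_left_le)
      finally have "norm (u + y * y) \<le> r + r"
        using norm_triangle_ineq[of u "y * y"] by (simp add: r_def)
      moreover have "c * (y * y) = y * y * c" if "c * u = u * c" for c
      proof -
        have "c * y = y * c" using y that unfolding S_iff by blast
        then show ?thesis by (metis mult.assoc)
      qed
      ultimately have "norm ((1/2) *\<^sub>R (u + y * y)) \<le> r"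
        "\<And>c. c * u = u * c \<Longrightarrow> c * ((1/2) *\<^sub>R (u + y * y)) = (1/2) *\<^sub>R (u + y * y) * c"
        by (simp_all add: distrib_left distrib_right)
      moreover have "adj ((1/2) *\<^sub>R (u + y * y)) = (1/2) *\<^sub>R (u + y * y)"
        using ay assms(1) by (simp add: adj_scaleR adj_add adj_mult self_adjoint_def)
      ultimately show "(1/2) *\<^sub>R (u + y * y) \<in> S"
        unfolding S_iff by blast
    qed
    show "dist ((1/2) *\<^sub>R (u + x * x)) ((1/2) *\<^sub>R (u + y * y)) \<le> r * dist x y"
      if "x \<in> S" "y \<in> S" for x y
    proof -
      have "x * x - y * y = x * (x - y) + (x - y) * y"
        by (simp add: algebra_simps)
      then have "norm (x * x - y * y) \<le> norm x * norm (x - y) + norm (x - y) * norm y"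
        by (metis norm_triangle_le add_mono norm_mult_ineq)
      also have "\<dots> \<le> r * norm (x - y) + norm (x - y) * r"
        using that S_iff by (intro add_mono mult_mono) (auto intro: r)
      finally show ?thesis
        by (simp add: dist_norm flip: scaleR_diff_right)
    qed
  qed (use r in auto)
  then obtain y where y: "y \<in> S" "(1/2) *\<^sub>R (u + y * y) = y" by blast
  from y(2) have "y + y = u + y * y"
    by (metis scaleR_half_double scaleR_add_right)
  then have "(1 - y) * (1 - y) = 1 - u"
    by (simp add: algebra_simps)
  moreover have "self_adjoint (1 - y)"
    using y(1) unfolding S_iff self_adjoint_def adj_diff by simp
  moreover have "c * (1 - y) = (1 - y) * c" if "c * u = u * c" for c
  proof -
    have "c * y = y * c" using y(1) that unfolding S_iff by blast
    then show ?thesis by (simp add: right_diff_distrib left_diff_distrib)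
  qed
  ultimately show ?thesis using that by blast
qed

text \<open>The element \<open>x + \<i> y\<close> is \<open>B\<close> times a unitary with real part \<open>x\<close>.\<close>

lemma norm_le_of_sum_squares:
  fixes x y :: "'a::cstar_algebra"
  assumes "self_adjoint x" "self_adjoint y" "x * y = y * x" "x * x + y * y = (B\<^sup>2) *\<^sub>R 1" "0 \<le> B"
  shows "norm x \<le> B"
proof -
  define w where "w = x + \<i> *\<^sub>C y"
  have adj_w: "adj w = x - \<i> *\<^sub>C y"
    using assms(1,2) by (simp add: w_def adj_add adj_scaleC self_adjoint_def scaleC_minus_left)
  have "adj w * w = x * x + y * y"
    unfolding adj_w
    by (simp add: w_def algebra_simps scaleC_mult_left scaleC_mult_right scaleC_scaleC
        scaleC_minus_left scaleC_add_right scaleC_diff_right assms(3))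
  then have "(norm w)\<^sup>2 = norm ((B\<^sup>2) *\<^sub>R (1::'a))"
    using cstar_identity[of w] assms(4) by simp
  also have "\<dots> \<le> B\<^sup>2"
    using norm_one_le[where 'a='a] by (simp add: mult_left_le)
  finally have "norm w \<le> B"
    using assms(5) by (rule power2_le_imp_le)
  have "norm (w + adj w) \<le> norm w + norm w"
    by (metis norm_adj norm_triangle_ineq)
  moreover have "w + adj w = 2 *\<^sub>R x"
    unfolding adj_w by (simp add: w_def scaleR_2)
  ultimately show ?thesis using \<open>norm w \<le> B\<close> by simp
qed

text \<open>If \<open>1 - h\<^sup>2\<close> had an inverse, then \<open>1 - t h\<^sup>2\<close> would, for \<open>t < 1\<close> close to 1, be
  bounded below by some \<open>\<delta>\<close> that does not depend on \<open>t\<close>; this would give \<open>t \<parallel>h\<^sup>2\<parallel> \<le> 1 - \<delta>\<close>.\<close>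

lemma no_inverse_one_minus_square:
  fixes h :: "'a::cstar_algebra"
  assumes h: "self_adjoint h" and "norm h = 1"
  shows "\<not> has_inverse (1 - h * h)"
proof
  assume "has_inverse (1 - h * h)"
  define u where "u = h * h"
  have u: "self_adjoint u" "norm u = 1" and hu: "h * u = u * h"
    using assms by (simp_all add: u_def self_adjoint_square norm_square mult.assoc)
  obtain d where d: "d * (1 - u) = 1" "(1 - u) * d = 1"
    using \<open>has_inverse (1 - h * h)\<close> by (auto simp: has_inverse_def u_def)
  \<comment> \<open>The element \<open>g\<close> below will have norm at most
    \<open>2 * norm d\<close>, so this makes \<open>\<delta> *\<^sub>R g\<close> shorter than 1;
    \<open>\<delta> \<le> 1/2\<close> keeps \<open>1 - \<delta>\<close> positive.\<close>
  define \<delta> where "\<delta> = 1 / (2 * norm d + 2)"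
  have \<delta>: "0 < \<delta>" "\<delta> \<le> 1/2" "\<delta> * (2 * norm d) < 1"
    by (simp_all add: \<delta>_def field_simps add_pos_nonneg add_nonneg_pos)
  \<comment> \<open>Close enough to 1 for \<open>norm b \<le> 1/2\<close>, and
    \<open>1 - t < \<delta>\<close> contradicts the final bound
    \<open>t \<le> 1 - \<delta>\<close>.\<close>
  define t where "t = 1 - \<delta> / 2"
  have t: "0 < t" "t < 1" "1 - t = \<delta> / 2" using \<delta> by (auto simp: t_def)
  \<comment> \<open>Solves \<open>(1 - u) * (1 - b) = 1 - t *\<^sub>R u\<close>, given that
    \<open>d\<close> inverts \<open>1 - u\<close>.\<close>
  define b where "b = - ((1 - t) *\<^sub>R (d * u))"
  have "norm b = (\<delta> / 2) * norm (d * u)"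
    unfolding b_def t(3) using \<delta> by simp
  also have "\<dots> \<le> (\<delta> / 2) * norm d"
    using norm_mult_ineq[of d u] u \<delta> by (intro mult_left_mono) auto
  also have "\<dots> \<le> 1/2" using \<delta> by simp
  finally have b: "norm b \<le> 1/2" .
  then obtain e where e: "e * (1 - b) = 1" "(1 - b) * e = 1"
    using has_inverse_one_minus[of b] by (auto simp: has_inverse_def)
  have fact: "(1 - u) * (1 - b) = 1 - t *\<^sub>R u"
  proof -
    have "(1 - u) * (1 - b) = (1 - u) + (1 - t) *\<^sub>R (((1 - u) * d) * u)"
      by (simp add: b_def distrib_left mult.assoc right_diff_distrib)
    then show ?thesis by (simp only: d) (simp add: algebra_simps)
  qed
  define g where "g = e * d"
  have g2: "(1 - t *\<^sub>R u) * g = 1"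
  proof -
    have "(1 - u) * (1 - b) * (e * d) = (1 - u) * ((1 - b) * e) * d"
      by (simp only: mult.assoc)
    then show ?thesis by (simp add: d e g_def flip: fact)
  qed
  have g1: "g * (1 - t *\<^sub>R u) = 1"
  proof -
    have "e * d * ((1 - u) * (1 - b)) = e * (d * (1 - u)) * (1 - b)"
      by (simp only: mult.assoc)
    then show ?thesis by (simp add: d e g_def flip: fact)
  qed
  have sa: "self_adjoint (t *\<^sub>R u)" "self_adjoint (1 - t *\<^sub>R u)"
    using u by (simp_all add: self_adjoint_scaleR self_adjoint_diff)
  have g_sa: "self_adjoint g"
    by (rule self_adjoint_inverse[OF g1 g2 sa(2)])
  have "norm g \<le> 2 * norm d"
    using norm_mult_ineq[of e d] norm_inverse_one_minus_le[OF b e(1)]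
    by (simp add: g_def) (meson mult_right_mono norm_ge_zero order_trans)
  then have "\<delta> * norm g \<le> \<delta> * (2 * norm d)"
    using \<delta> by (intro mult_left_mono) auto
  then have "\<delta> * norm g < 1"
    using \<delta>(3) by linarith
  then have "norm (\<delta> *\<^sub>R g) < 1"
    using \<delta>(1) by simp
  then obtain m where m: "self_adjoint m" "m * m = 1 - \<delta> *\<^sub>R g"
      "\<And>c. c * (\<delta> *\<^sub>R g) = \<delta> *\<^sub>R g * c \<Longrightarrow> c * m = m * c"
    using sqrt_one_minus[of "\<delta> *\<^sub>R g"] self_adjoint_scaleR[OF g_sa] by blast
  have "norm (t *\<^sub>R u) < 1" using u t by simp
  then obtain s where s: "self_adjoint s" "s * s = 1 - t *\<^sub>R u"
      "\<And>c. c * (t *\<^sub>R u) = t *\<^sub>R u * c \<Longrightarrow> c * s = s * c"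
    using sqrt_one_minus[OF sa(1)] by blast
  have com_g: "c * g = g * c" if "c * u = u * c" for c
    by (rule inverse_commute[OF g1 g2]) (simp add: algebra_simps that)
  have com_m: "c * m = m * c" if "c * u = u * c" for c
    by (rule m(3)) (simp add: com_g[OF that])
  have com_s: "c * s = s * c" if "c * u = u * c" for c
    by (rule s(3)) (simp add: that)
  have "s * u = u * s" using com_s[of u] by simp
  then have sm: "s * m = m * s" by (rule com_m)
  have hs: "h * s = s * h" and hm: "h * m = m * h" by (rule com_s com_m, rule hu)+
  \<comment> \<open>Since \<open>s * s\<close> and \<open>g\<close> are inverse to each other,
    multiplying it by \<open>1 - \<delta> *\<^sub>R g\<close> subtracts the scalar
    \<open>\<delta>\<close>. So \<open>s * m\<close> is a square root of
    \<open>1 - t *\<^sub>R u - \<delta> *\<^sub>R 1\<close>. The detour is needed because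
    \<open>t *\<^sub>R u + \<delta> *\<^sub>R 1\<close> is only known to have norm at most
    \<open>t + \<delta>\<close>, which exceeds 1.\<close>
  have "(s * m) * (s * m) = (s * s) * (m * m)"
    by (metis sm mult.assoc)
  also have "\<dots> = 1 - t *\<^sub>R u - \<delta> *\<^sub>R 1"
    unfolding s(2) m(2) right_diff_distrib mult_scaleR_right g2 by simp
  finally have sm2: "(s * m) * (s * m) = 1 - t *\<^sub>R u - \<delta> *\<^sub>R 1" .
  have "norm (sqrt t *\<^sub>R h) \<le> sqrt (1 - \<delta>)"
  proof (rule norm_le_of_sum_squares[of _ "s * m"])
    show "self_adjoint (s * m)"
      using s(1) m(1) sm by (simp add: self_adjoint_def adj_mult)
    show "(sqrt t *\<^sub>R h) * (s * m) = s * m * (sqrt t *\<^sub>R h)"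
      using hs hm by (simp add: mult.assoc) (metis mult.assoc)
    show "sqrt t *\<^sub>R h * sqrt t *\<^sub>R h + s * m * (s * m) = (sqrt (1 - \<delta>))\<^sup>2 *\<^sub>R 1"
      unfolding sm2 using \<delta> t by (simp add: u_def scaleR_diff_left)
  qed (use h \<delta> in \<open>auto intro: self_adjoint_scaleR\<close>)
  then have "sqrt t \<le> sqrt (1 - \<delta>)"
    using assms(2) t(1) by simp
  then have "t \<le> 1 - \<delta>" by simp
  then show False using t(3) \<delta>(1) by linarith
qed

text \<open>After scaling to norm one the two candidates are 1 and -1, and \<open>1 - k * k\<close>
  is, up to sign, the product of \<open>k - 1\<close> and \<open>k + 1\<close>, which cannot both be
  invertible. This does the work of the spectral radius formula and shows that the spectrum is not
  empty; in the zero algebra every spectrum is empty.\<close>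

lemma norm_in_spectrum:
  fixes h :: "'a::cstar_algebra"
  assumes "self_adjoint h" and "(1::'a) \<noteq> 0"
  shows "complex_of_real (norm h) \<in> spectrum h \<or> complex_of_real (- norm h) \<in> spectrum h"
proof (cases "h = 0")
  case True
  then show ?thesis
    using assms(2) by (auto simp: spectrum_def)
next
  case False
  define k where "k = (1 / norm h) *\<^sub>R h"
  have hk: "h = norm h *\<^sub>R k" using False by (simp add: k_def)
  have k: "self_adjoint k" "norm k = 1"
    using False assms(1) by (simp_all add: k_def self_adjoint_scaleR)
  have sc: "has_inverse (k - r *\<^sub>R 1)" if "has_inverse (h - complex_of_real (norm h * r) *\<^sub>C 1)" for r
  proof -
    have "k - r *\<^sub>R 1 = complex_of_real (1 / norm h) *\<^sub>C (h - complex_of_real (norm h * r) *\<^sub>C 1)"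
      using False by (simp add: scaleC_of_real k_def scaleR_diff_right del: of_real_mult of_real_divide)
    then show ?thesis using has_inverse_scaleC[OF _ that, of "complex_of_real (1 / norm h)"] False by simp
  qed
  have "\<not> (has_inverse (k - 1 *\<^sub>R 1) \<and> has_inverse (k - (-1) *\<^sub>R 1))"
  proof
    assume "has_inverse (k - 1 *\<^sub>R 1) \<and> has_inverse (k - (-1) *\<^sub>R 1)"
    then have "has_inverse ((-1) *\<^sub>C ((k - 1 *\<^sub>R 1) * (k - (-1) *\<^sub>R 1)))"
      by (intro has_inverse_scaleC has_inverse_mult) auto
    moreover have "(-1) *\<^sub>C ((k - 1 *\<^sub>R 1) * (k - (-1) *\<^sub>R 1)) = 1 - k * k"
      by (simp add: scaleC_minus_left algebra_simps)
    ultimately show False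
      using no_inverse_one_minus_square[OF k] by simp
  qed
  then show ?thesis
    using sc[of 1] sc[of "-1"] by (auto simp: spectrum_iff)
qed

section \<open>Norm bound, reality and compactness of the spectrum\<close>

lemma has_inverse_diff_scaleC:
  fixes x :: "'a::cstar_algebra"
  assumes "norm x < cmod c"
  shows "has_inverse (x - c *\<^sub>C 1)"
proof -
  have c: "c \<noteq> 0" using assms norm_ge_zero[of x] by auto
  have "norm (inverse c *\<^sub>C x) = norm x / cmod c"
    by (simp only: norm_scaleC norm_inverse divide_inverse mult.commute)
  then have "norm (inverse c *\<^sub>C x) < 1"
    using assms c by simp
  then have "has_inverse ((- c) *\<^sub>C (1 - inverse c *\<^sub>C x))"
    using c by (intro has_inverse_scaleC has_inverse_one_minus) simp_all
  moreover have "(- c) *\<^sub>C (1 - inverse c *\<^sub>C x) = x - c *\<^sub>C 1"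
    using c by (simp add: scaleC_diff_right scaleC_scaleC scaleC_minus_left)
  ultimately show ?thesis by simp
qed

lemma spectrum_norm_le: "c \<in> spectrum x \<Longrightarrow> cmod c \<le> norm x"
  using has_inverse_diff_scaleC[of x c] by (auto simp: spectrum_iff not_less[symmetric])

text \<open>Apply the norm bound on the spectrum to \<open>x + \<i> t\<close>, whose norm is at most
  \<open>sqrt (\<parallel>x\<parallel>\<^sup>2 + t\<^sup>2)\<close>.\<close>

lemma spectrum_real:
  fixes x :: "'a::cstar_algebra"
  assumes x: "self_adjoint x" and c: "c \<in> spectrum x"
  shows "Im c = 0"
proof (rule ccontr)
  assume b: "Im c \<noteq> 0"
  \<comment> \<open>Chosen so that \<open>2 * Im c * t\<close> is the square of
    \<open>norm x\<close> plus 1, which pushes the spectral value \<open>c + \<i> * t\<close> of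
    \<open>z\<close> beyond the norm of \<open>z\<close>.\<close>
  define t where "t = ((norm x)\<^sup>2 + 1) / (2 * Im c)"
  define z where "z = x + (\<i> * complex_of_real t) *\<^sub>C 1"
  have adj_z: "adj z = x - (\<i> * complex_of_real t) *\<^sub>C 1"
    using x by (simp add: z_def adj_add adj_scaleC self_adjoint_def scaleC_minus_left)
  have "adj z * z = x * x + (t\<^sup>2) *\<^sub>R 1"
    unfolding adj_z
    by (simp add: z_def algebra_simps scaleC_mult_left scaleC_mult_right scaleC_scaleC
        scaleC_minus_left scaleC_add_right scaleC_diff_right power2_eq_square
        flip: scaleC_of_real)
  then have "(norm z)\<^sup>2 \<le> norm (x * x) + norm ((t\<^sup>2) *\<^sub>R (1::'a))"
    by (metis cstar_identity norm_triangle_ineq)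
  also have "\<dots> \<le> (norm x)\<^sup>2 + t\<^sup>2"
    using norm_one_le[where 'a='a] x by (simp add: norm_square mult_left_le)
  finally have z: "(norm z)\<^sup>2 \<le> (norm x)\<^sup>2 + t\<^sup>2" .
  have "(c + \<i> * complex_of_real t) \<in> spectrum z"
    using c by (simp add: spectrum_iff z_def scaleC_add_left)
  then have "(cmod (c + \<i> * complex_of_real t))\<^sup>2 \<le> (norm z)\<^sup>2"
    by (intro power_mono spectrum_norm_le) auto
  moreover have "(cmod (c + \<i> * complex_of_real t))\<^sup>2 = (Re c)\<^sup>2 + (Im c)\<^sup>2 + 2 * Im c * t + t\<^sup>2"
    by (simp add: cmod_power2 power2_sum)
  moreover have "2 * Im c * t = (norm x)\<^sup>2 + 1"
    using b by (simp add: t_def)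
  ultimately show False
    using z zero_le_power2[of "Re c"] zero_le_power2[of "Im c"] by linarith
qed

text \<open>If \<open>y\<close> inverts \<open>x - c\<close>, then \<open>x - c'\<close> is the
  product of \<open>x - c\<close> and \<open>1 - (c' - c) * y\<close>, hence invertible for
  \<open>c'\<close> near \<open>c\<close>. The 1 added in the radius covers \<open>y = 0\<close>,
  which occurs in the zero algebra.\<close>

lemma compact_spectrum: "compact (spectrum (x::'a::cstar_algebra))"
proof (rule compact_eq_bounded_closed[THEN iffD2], intro conjI)
  show "bounded (spectrum x)"
    using spectrum_norm_le by (auto simp: bounded_iff)
  have "open (- spectrum x)"
    unfolding open_contains_ball
  proof
    fix c assume "c \<in> - spectrum x"
    then obtain y where y: "y * (x - c *\<^sub>C 1) = 1" "(x - c *\<^sub>C 1) * y = 1"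
      by (auto simp: spectrum_def)
    have "has_inverse (x - c' *\<^sub>C 1)" if "cmod (c' - c) * norm y < 1" for c'
    proof -
      have "has_inverse ((x - c *\<^sub>C 1) * (1 - (c' - c) *\<^sub>C y))"
        using y that
        by (intro has_inverse_mult has_inverse_one_minus) (auto simp: has_inverse_def norm_scaleC)
      moreover have "(x - c *\<^sub>C 1) * (1 - (c' - c) *\<^sub>C y) = x - c *\<^sub>C 1 - (c' - c) *\<^sub>C 1"
        using y by (simp add: right_diff_distrib scaleC_mult_right)
      ultimately show ?thesis by (simp add: scaleC_diff_left)
    qed
    then have *: "\<And>c'. cmod (c' - c) * norm y < 1 \<Longrightarrow> has_inverse (x - c' *\<^sub>C 1)" by blast
    have "ball c (1 / (norm y + 1)) \<subseteq> - spectrum x"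
    proof (intro subsetI)
      fix c' assume "c' \<in> ball c (1 / (norm y + 1))"
      then have "cmod (c' - c) < 1 / (norm y + 1)"
        by (simp add: dist_norm norm_minus_commute)
      then have "cmod (c' - c) * (norm y + 1) < 1"
        using pos_less_divide_eq[of "norm y + 1" "cmod (c' - c)" 1] by (simp add: add_nonneg_pos)
      then have "cmod (c' - c) * norm y < 1"
        unfolding distrib_left using norm_ge_zero[of "c' - c"] by linarith
      then show "c' \<in> - spectrum x"
        using * by (simp add: spectrum_iff)
    qed
    then show "\<exists>e>0. ball c e \<subseteq> - spectrum x"
      by (intro exI[of _ "1 / (norm y + 1)"]) (simp add: add_nonneg_pos)
  qed
  then show "closed (spectrum x)" by (simp add: closed_def)
qed

section \<open>Continuous functional calculus\<close>

definition poly_apply :: "complex poly \<Rightarrow> 'a::cstar_algebra \<Rightarrow> 'a" where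
  "poly_apply p x = fold_coeffs (\<lambda>c y. c *\<^sub>C 1 + x * y) p 0"

lemma poly_apply_0 [simp]: "poly_apply 0 x = 0"
  by (simp add: poly_apply_def)

lemma poly_apply_pCons [simp]: "poly_apply (pCons c p) x = c *\<^sub>C 1 + x * poly_apply p x"
  by (cases "p = 0 \<and> c = 0") (auto simp: poly_apply_def)

lemma poly_apply_add: "poly_apply (p + q) x = poly_apply p x + poly_apply q x"
  by (induction p q rule: poly_induct2) (simp_all add: scaleC_add_left distrib_left add_ac)

lemma poly_apply_smult: "poly_apply (smult c p) x = c *\<^sub>C poly_apply p x"
  by (induction p) (simp_all add: scaleC_add_right scaleC_scaleC scaleC_mult_right)

lemma poly_apply_diff: "poly_apply (p - q) x = poly_apply p x - poly_apply q x"
  using poly_apply_add[of "p - q" q x] by simp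

lemma poly_apply_mult: "poly_apply (p * q) x = poly_apply p x * poly_apply q x"
  by (induction p)
    (simp_all add: poly_apply_add poly_apply_smult distrib_right scaleC_mult_left mult.assoc)

lemma poly_apply_commute:
  "c * x = x * c \<Longrightarrow> c * poly_apply p x = poly_apply p x * c"
  by (induction p)
    (simp_all add: distrib_left distrib_right scaleC_mult_left scaleC_mult_right mult.assoc[symmetric],
     simp add: mult.assoc)

lemma adj_poly_apply:
  "self_adjoint x \<Longrightarrow> adj (poly_apply p x) = poly_apply (map_poly cnj p) x"
proof (induction p)
  case (pCons c p)
  then have "poly_apply (map_poly cnj p) x * x = x * poly_apply (map_poly cnj p) x"
    by (intro poly_apply_commute[symmetric] refl)
  then show ?case
    using pCons by (simp add: map_poly_pCons adj_add adj_scaleC adj_mult self_adjoint_def)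
qed simp

lemma poly_map_cnj: "poly (map_poly cnj p) (cnj z) = cnj (poly p z)"
  by (induction p) (simp_all add: map_poly_pCons)

text \<open>Half of the spectral mapping theorem: \<open>p\<close> splits into linear factors over
  the complex numbers, and each factor \<open>x - z\<close> is invertible because its root
  \<open>z\<close> lies outside the spectrum.\<close>

lemma has_inverse_poly_apply:
  assumes "p \<noteq> 0" and "\<And>z. z \<in> spectrum x \<Longrightarrow> poly p z \<noteq> 0"
  shows "has_inverse (poly_apply p x)"
  using assms
proof (induction "degree p" arbitrary: p)
  case 0
  then obtain c where "p = [:c:]" "c \<noteq> 0"
    by (metis degree_eq_zeroE pCons_0_0)
  then show ?case
    using has_inverse_scaleC[of c 1] by (simp add: has_inverse_def)
next
  case (Suc n)
  then have "\<not> constant (poly p)"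
    by (simp add: constant_degree)
  then obtain z where z: "poly p z = 0"
    using fundamental_theorem_of_algebra by blast
  then obtain q where q: "p = [:- z, 1:] * q"
    by (auto simp: poly_eq_0_iff_dvd)
  with Suc.prems have "q \<noteq> 0" by auto
  then have "degree p = Suc (degree q)"
    unfolding q by (subst degree_mult_eq) auto
  then have "has_inverse (poly_apply q x)"
    using Suc q \<open>q \<noteq> 0\<close> by auto
  moreover have "has_inverse (x - z *\<^sub>C 1)"
    using Suc.prems(2) z by (auto simp: spectrum_iff)
  ultimately have "has_inverse ((x - z *\<^sub>C 1) * poly_apply q x)"
    by (rule has_inverse_mult[rotated])
  moreover have "poly_apply [:- z, 1:] x = x - z *\<^sub>C 1"
    by (simp add: scaleC_minus_left)
  ultimately show ?case
    unfolding q poly_apply_mult by simp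
qed

text \<open>By the C*-identity it is enough to bound the self-adjoint
  \<open>y = adj (p x) * p x\<close>. One of \<open>norm y\<close> and \<open>- norm y\<close> is a
  spectral value of \<open>y\<close>, so by spectral mapping it is a value of \<open>r\<close> on
  the spectrum of \<open>x\<close>; there \<open>r\<close> is the squared modulus of
  \<open>p\<close>, since the spectrum is real.\<close>

lemma norm_poly_apply_le:
  fixes x :: "'a::cstar_algebra"
  assumes x: "self_adjoint x" and "0 \<le> B" and B: "\<And>z. z \<in> spectrum x \<Longrightarrow> cmod (poly p z) \<le> B"
  shows "norm (poly_apply p x) \<le> B"
proof (cases "(1::'a) = 0")
  case True
  then have "poly_apply p x = 0"
    by (metis mult_1_left mult_zero_left)
  then show ?thesis using assms(2) by simp
next
  case False
  define r where "r = map_poly cnj p * p"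
  define y where "y = poly_apply r x"
  have y: "y = adj (poly_apply p x) * poly_apply p x"
    by (simp add: y_def r_def poly_apply_mult adj_poly_apply[OF x])
  then have "self_adjoint y"
    by (simp add: self_adjoint_def adj_mult adj_adj)
  then obtain c where c: "c \<in> spectrum y" "cmod c = norm y"
    using norm_in_spectrum[OF _ False, of y] by fastforce
  have "poly_apply (r - [:c:]) x = y - c *\<^sub>C 1"
    by (simp add: poly_apply_diff y_def)
  then have "\<not> has_inverse (poly_apply (r - [:c:]) x)"
    using c by (simp add: spectrum_iff)
  moreover have "spectrum x \<noteq> {}"
    using norm_in_spectrum[OF x False] by auto
  ultimately obtain z where z: "z \<in> spectrum x" "poly r z = c"
    using has_inverse_poly_apply[of "r - [:c:]" x] by fastforce
  have "cnj z = z"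
    using spectrum_real[OF x z(1)] by (simp add: complex_eq_iff)
  then have "poly r z = cnj (poly p z) * poly p z"
    using poly_map_cnj[of p z] by (simp add: r_def)
  then have "cmod c = (cmod (poly p z))\<^sup>2"
    using z by (simp add: norm_mult power2_eq_square)
  also have "\<dots> \<le> B\<^sup>2"
    using B[OF z(1)] by (intro power_mono) auto
  finally have "(norm (poly_apply p x))\<^sup>2 \<le> B\<^sup>2"
    using c(2) cstar_identity[of "poly_apply p x"] by (simp add: y)
  then show ?thesis
    using assms(2) by (rule power2_le_imp_le)
qed

text \<open>The spectrum is real, so Weierstrass approximation on a compact set of reals, applied to
  the real and the imaginary part of \<open>g\<close>, is enough.\<close>

lemma poly_approximation:
  fixes x :: "'a::cstar_algebra"
  assumes x: "self_adjoint x" and g: "continuous_on (spectrum x) g" and e: "0 < e"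
  obtains p where "\<And>z. z \<in> spectrum x \<Longrightarrow> cmod (poly p z - g z) < e"
proof -
  define S where "S = Re ` spectrum x"
  have comp: "compact S"
    unfolding S_def by (intro compact_continuous_image compact_spectrum continuous_intros)
  have real: "complex_of_real (Re z) = z" if "z \<in> spectrum x" for z
    using spectrum_real[OF x that] by (simp add: complex_eq_iff)
  have cont: "continuous_on S (\<lambda>t. g (complex_of_real t))"
    using real by (intro continuous_on_compose2[OF g] continuous_intros) (auto simp: S_def)
  have real_poly: "\<exists>p. \<forall>t\<in>S. cmod (poly p (complex_of_real t) - complex_of_real (u t)) < e / 2"
    if u: "continuous_on S u" for u
  proof -
    obtain v where v: "real_polynomial_function v" "\<And>t. t \<in> S \<Longrightarrow> \<bar>u t - v t\<bar> < e / 2"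
      using Stone_Weierstrass_real_polynomial_function[OF comp u, of "e / 2"] e by auto
    obtain a n where a: "v = (\<lambda>t. \<Sum>i\<le>n. a i * t ^ i)"
      using v(1) by (auto simp: real_polynomial_function_iff_sum)
    have "poly (\<Sum>i\<le>n. monom (complex_of_real (a i)) i) (complex_of_real t) = complex_of_real (v t)" for t
      by (simp add: a poly_sum poly_monom)
    moreover have "cmod (complex_of_real (v t) - complex_of_real (u t)) < e / 2" if "t \<in> S" for t
      using v(2)[OF that] by (simp only: norm_of_real abs_minus_commute flip: of_real_diff)
    ultimately show ?thesis by metis
  qed
  obtain p where p: "\<And>t. t \<in> S \<Longrightarrow> cmod (poly p (complex_of_real t) - complex_of_real (Re (g (complex_of_real t)))) < e / 2"
    using real_poly[of "\<lambda>t. Re (g (complex_of_real t))"] continuous_on_Re[OF cont] by blast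
  obtain q where q: "\<And>t. t \<in> S \<Longrightarrow> cmod (poly q (complex_of_real t) - complex_of_real (Im (g (complex_of_real t)))) < e / 2"
    using real_poly[of "\<lambda>t. Im (g (complex_of_real t))"] continuous_on_Im[OF cont] by blast
  have "cmod (poly (p + smult \<i> q) z - g z) < e" if "z \<in> spectrum x" for z
  proof -
    have z: "Re z \<in> S" "complex_of_real (Re z) = z"
      using that real by (auto simp: S_def)
    have "poly (p + smult \<i> q) z - g z =
        (poly p z - complex_of_real (Re (g z))) + \<i> * (poly q z - complex_of_real (Im (g z)))"
      using complex_eq[of "g z"] by (simp add: algebra_simps)
    then have "cmod (poly (p + smult \<i> q) z - g z) \<le>
        cmod (poly p z - complex_of_real (Re (g z))) + cmod (poly q z - complex_of_real (Im (g z)))"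
      by (metis norm_triangle_ineq norm_mult norm_ii mult_1_left)
    also have "\<dots> < e"
      using p[OF z(1)] q[OF z(1)] z(2) by simp
    finally show ?thesis .
  qed
  then show ?thesis by (rule that)
qed

text \<open>A relation rather than a function: the algebraic rules can then be checked on
  approximating polynomials, without first choosing a value.\<close>

definition cfc_value :: "'a::cstar_algebra \<Rightarrow> (complex \<Rightarrow> complex) \<Rightarrow> 'a \<Rightarrow> bool" where
  "cfc_value x g b \<longleftrightarrow> (\<exists>p. uniform_limit (spectrum x) (\<lambda>n. poly (p n)) g sequentially \<and>
     (\<lambda>n. poly_apply (p n) x) \<longlonglongrightarrow> b)"

text \<open>The polynomial bound passes to the limit. Applied with \<open>B = 0\<close> to a
  difference, it shows that values are unique.\<close>

lemma cfc_value_norm_le: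
  assumes x: "self_adjoint x" and v: "cfc_value x g b" and "0 \<le> B"
    and B: "\<And>z. z \<in> spectrum x \<Longrightarrow> cmod (g z) \<le> B"
  shows "norm b \<le> B"
proof (rule field_le_epsilon)
  fix e :: real assume e: "0 < e"
  obtain p where p: "uniform_limit (spectrum x) (\<lambda>n. poly (p n)) g sequentially"
    and lim: "(\<lambda>n. poly_apply (p n) x) \<longlonglongrightarrow> b"
    using v by (auto simp: cfc_value_def)
  have "\<forall>\<^sub>F n in sequentially. norm (poly_apply (p n) x) \<le> B + e"
    using uniform_limitD[OF p e]
  proof eventually_elim
    case (elim n)
    show ?case
    proof (rule norm_poly_apply_le[OF x])
      fix z assume z: "z \<in> spectrum x"
      have "cmod (poly (p n) z) \<le> cmod (g z) + cmod (poly (p n) z - g z)"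
        by (metis add.commute diff_add_cancel norm_triangle_ineq)
      then show "cmod (poly (p n) z) \<le> B + e"
        using B[OF z] elim z by (force simp: dist_norm)
    qed (use e assms(3) in simp)
  qed
  then show "norm b \<le> B + e"
    by (intro tendsto_upperbound[OF tendsto_norm[OF lim]]) auto
qed

lemma cfc_value_poly: "cfc_value x (poly p) (poly_apply p x)"
  unfolding cfc_value_def
  by (intro exI[of _ "\<lambda>_. p"] conjI uniform_limit_const tendsto_const)

lemma cfc_value_add:
  "cfc_value x g b \<Longrightarrow> cfc_value x h c \<Longrightarrow> cfc_value x (\<lambda>z. g z + h z) (b + c)"
  unfolding cfc_value_def
proof (elim exE conjE)
  fix p q
  assume "uniform_limit (spectrum x) (\<lambda>n. poly (p n)) g sequentially"
    "uniform_limit (spectrum x) (\<lambda>n. poly (q n)) h sequentially"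
    "(\<lambda>n. poly_apply (p n) x) \<longlonglongrightarrow> b" "(\<lambda>n. poly_apply (q n) x) \<longlonglongrightarrow> c"
  moreover have "poly (p n + q n) = (\<lambda>z. poly (p n) z + poly (q n) z)" for n
    by auto
  ultimately show "\<exists>p. uniform_limit (spectrum x) (\<lambda>n. poly (p n)) (\<lambda>z. g z + h z) sequentially \<and>
      (\<lambda>n. poly_apply (p n) x) \<longlonglongrightarrow> b + c"
    by (intro exI[of _ "\<lambda>n. p n + q n"]) (simp add: poly_apply_add tendsto_add uniform_limit_add)
qed

lemma cfc_value_scale:
  assumes "cfc_value x g b"
  shows "cfc_value x (\<lambda>z. c * g z) (c *\<^sub>C b)"
proof -
  obtain p where p: "uniform_limit (spectrum x) (\<lambda>n. poly (p n)) g sequentially"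
    and lim: "(\<lambda>n. poly_apply (p n) x) \<longlonglongrightarrow> b"
    using assms by (auto simp: cfc_value_def)
  have "poly (smult c (p n)) = (\<lambda>z. c * poly (p n) z)" for n
    by auto
  then show ?thesis
    unfolding cfc_value_def
    using bounded_linear.tendsto[OF bounded_linear_scaleC lim]
      bounded_linear.uniform_limit[OF bounded_linear_mult_right p]
    by (intro exI[of _ "\<lambda>n. smult c (p n)"]) (simp add: poly_apply_smult)
qed

lemma cfc_value_cnj:
  assumes "self_adjoint x" and "cfc_value x g b"
  shows "cfc_value x (\<lambda>z. cnj (g z)) (adj b)"
proof -
  obtain p where p: "uniform_limit (spectrum x) (\<lambda>n. poly (p n)) g sequentially"
    and lim: "(\<lambda>n. poly_apply (p n) x) \<longlonglongrightarrow> b"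
    using assms by (auto simp: cfc_value_def)
  have "uniform_limit (spectrum x) (\<lambda>n. poly (map_poly cnj (p n))) (\<lambda>z. cnj (g z)) sequentially"
  proof (rule uniform_limit_cong'[THEN iffD1])
    show "uniform_limit (spectrum x) (\<lambda>n z. cnj (poly (p n) z)) (\<lambda>z. cnj (g z)) sequentially"
      by (rule bounded_linear.uniform_limit[OF bounded_linear_cnj p])
    show "cnj (poly (p n) z) = poly (map_poly cnj (p n)) z" if "z \<in> spectrum x" for n z
      using spectrum_real[OF assms(1) that] poly_map_cnj[of "p n" z]
      by (metis Reals_cnj_iff complex_is_Real_iff)
  qed simp
  then show ?thesis
    unfolding cfc_value_def
    by (intro exI[of _ "\<lambda>n. map_poly cnj (p n)"] conjI)
      (auto simp: bounded_linear.tendsto[OF bounded_linear_adj lim] simp flip: adj_poly_apply[OF assms(1)])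
qed

lemma cfc_value_unique:
  assumes "self_adjoint x" "cfc_value x g b" "cfc_value x h c" "\<And>z. z \<in> spectrum x \<Longrightarrow> g z = h z"
  shows "b = c"
proof -
  have "cfc_value x (\<lambda>z. g z + (-1) * h z) (b + (-1) *\<^sub>C c)"
    by (intro cfc_value_add cfc_value_scale assms)
  then have "norm (b + (-1) *\<^sub>C c) \<le> 0"
    by (rule cfc_value_norm_le[OF assms(1)]) (simp_all add: assms(4))
  then show ?thesis by (simp add: scaleC_minus_left)
qed

lemma cfc_value_exists:
  assumes x: "self_adjoint x" and g: "continuous_on (spectrum x) g"
  shows "\<exists>b. cfc_value x g b"
proof -
  have "\<exists>p. \<forall>z\<in>spectrum x. cmod (poly p z - g z) < inverse (real (Suc n))" for n
    using poly_approximation[OF x g, of "inverse (real (Suc n))"] by (metis of_nat_0_less_iff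
      positive_imp_inverse_positive zero_less_Suc)
  then obtain p where p: "\<And>n z. z \<in> spectrum x \<Longrightarrow> cmod (poly (p n) z - g z) < inverse (real (Suc n))"
    by metis
  have ul: "uniform_limit (spectrum x) (\<lambda>n. poly (p n)) g sequentially"
  proof (rule uniform_limitI)
    fix e :: real assume "0 < e"
    then have "\<forall>\<^sub>F n in sequentially. inverse (real (Suc n)) < e"
      using LIMSEQ_inverse_real_of_nat by (rule order_tendstoD(2)[rotated])
    then show "\<forall>\<^sub>F n in sequentially. \<forall>z\<in>spectrum x. dist (poly (p n) z) (g z) < e"
      by eventually_elim (metis p dist_norm less_trans)
  qed
  have "Cauchy (\<lambda>n. poly_apply (p n) x)"
  proof (rule metric_CauchyI)
    fix e :: real assume e: "0 < e"
    then obtain N where N: "\<And>n z. n \<ge> N \<Longrightarrow> z \<in> spectrum x \<Longrightarrow> cmod (poly (p n) z - g z) < e / 4"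
      using uniform_limitD[OF ul, of "e / 4"] by (auto simp: eventually_sequentially dist_norm)
    have "dist (poly_apply (p m) x) (poly_apply (p n) x) < e" if "m \<ge> N" "n \<ge> N" for m n
    proof -
      have "norm (poly_apply (p m - p n) x) \<le> e / 2"
      proof (rule norm_poly_apply_le[OF x])
        fix z assume z: "z \<in> spectrum x"
        have "cmod (poly (p m - p n) z) \<le> cmod (poly (p m) z - g z) + cmod (poly (p n) z - g z)"
          using norm_triangle_ineq4[of "poly (p m) z - g z" "poly (p n) z - g z"] by simp
        then show "cmod (poly (p m - p n) z) \<le> e / 2"
          using N[OF that(1) z] N[OF that(2) z] by linarith
      qed (use e in simp)
      then show ?thesis using e by (simp add: dist_norm poly_apply_diff)
    qed
    then show "\<exists>M. \<forall>m\<ge>M. \<forall>n\<ge>M. dist (poly_apply (p m) x) (poly_apply (p n) x) < e" by blast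
  qed
  then obtain b where "(\<lambda>n. poly_apply (p n) x) \<longlonglongrightarrow> b"
    using convergent_eq_Cauchy by metis
  then show ?thesis using ul by (auto simp: cfc_value_def)
qed

text \<open>Continuity makes \<open>g\<close> and \<open>h\<close> bounded on the compact spectrum;
  products of uniform limits need this.\<close>

lemma cfc_value_mult:
  assumes "cfc_value x g b" "cfc_value x h c"
    and "continuous_on (spectrum x) g" "continuous_on (spectrum x) h"
  shows "cfc_value x (\<lambda>z. g z * h z) (b * c)"
proof -
  obtain p where p: "uniform_limit (spectrum x) (\<lambda>n. poly (p n)) g sequentially"
    and limp: "(\<lambda>n. poly_apply (p n) x) \<longlonglongrightarrow> b"
    using assms by (auto simp: cfc_value_def)
  obtain q where q: "uniform_limit (spectrum x) (\<lambda>n. poly (q n)) h sequentially"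
    and limq: "(\<lambda>n. poly_apply (q n) x) \<longlonglongrightarrow> c"
    using assms by (auto simp: cfc_value_def)
  have bdd: "bounded (g ` spectrum x)" "bounded (h ` spectrum x)"
    by (intro compact_imp_bounded compact_continuous_image compact_spectrum assms)+
  have "poly (p n * q n) = (\<lambda>z. poly (p n) z * poly (q n) z)" for n
    by auto
  then show ?thesis
    unfolding cfc_value_def
    using uniform_lim_mult[OF p q bdd] tendsto_mult[OF limp limq]
    by (intro exI[of _ "\<lambda>n. p n * q n"]) (simp add: poly_apply_mult)
qed

lemma cfc_value_commute:
  assumes "cfc_value x g b" "c * x = x * c"
  shows "c * b = b * c"
proof -
  obtain p where lim: "(\<lambda>n. poly_apply (p n) x) \<longlonglongrightarrow> b"
    using assms by (auto simp: cfc_value_def)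
  have "(\<lambda>n. c * poly_apply (p n) x) \<longlonglongrightarrow> c * b" "(\<lambda>n. poly_apply (p n) x * c) \<longlonglongrightarrow> b * c"
    by (intro tendsto_intros lim)+
  then show ?thesis
    unfolding poly_apply_commute[OF assms(2)] by (rule LIMSEQ_unique)
qed

lemma cfc_hom_exists:
  assumes x: "self_adjoint x"
  obtains \<Phi> where "cfc_hom x \<Phi>" "\<And>g. continuous_on (spectrum x) g \<Longrightarrow> cfc_value x g (\<Phi> g)"
proof -
  \<comment> \<open>If \<open>g\<close> is not continuous on the spectrum, this choice may be
    arbitrary; \<open>cfc_hom\<close> constrains \<open>\<Phi>\<close> only on functions continuous
    there.\<close>
  define \<Phi> where "\<Phi> g = (SOME b. cfc_value x g b)" for g
  have val: "cfc_value x g (\<Phi> g)" if "continuous_on (spectrum x) g" for g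
    unfolding \<Phi>_def by (rule someI_ex[OF cfc_value_exists[OF x that]])
  have eqI: "\<Phi> g = b" if "continuous_on (spectrum x) g" "cfc_value x h b"
    "\<And>z. z \<in> spectrum x \<Longrightarrow> g z = h z" for g h b
    by (rule cfc_value_unique[OF x val[OF that(1)] that(2,3)])
  have "cfc_hom x \<Phi>"
    unfolding cfc_hom_def
  proof (intro conjI allI impI)
    show "\<Phi> (\<lambda>z. 1) = 1"
      by (rule eqI[OF _ cfc_value_poly[of x "[:1:]", simplified]]) auto
    show "\<Phi> (\<lambda>z. z) = x"
    proof (rule eqI)
      show "cfc_value x (poly [:0, 1:]) x"
        using cfc_value_poly[of x "[:0, 1:]"] by simp
    qed (auto intro: continuous_intros)
    fix g h :: "complex \<Rightarrow> complex" and c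
    show "\<Phi> g = \<Phi> h" if "continuous_on (spectrum x) g \<and> (\<forall>z\<in>spectrum x. g z = h z)"
    proof (rule eqI)
      have "continuous_on (spectrum x) h"
        using that continuous_on_cong[of "spectrum x" "spectrum x" g h] by auto
      then show "cfc_value x h (\<Phi> h)" by (rule val)
    qed (use that in auto)
    show "\<Phi> (\<lambda>z. g z + h z) = \<Phi> g + \<Phi> h" "\<Phi> (\<lambda>z. g z * h z) = \<Phi> g * \<Phi> h"
      if "continuous_on (spectrum x) g \<and> continuous_on (spectrum x) h"
      by (rule eqI; use that in \<open>auto intro!: cfc_value_add cfc_value_mult val continuous_intros\<close>)+
    show "\<Phi> (\<lambda>z. c * g z) = c *\<^sub>C \<Phi> g" "\<Phi> (\<lambda>z. cnj (g z)) = adj (\<Phi> g)"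
      if "continuous_on (spectrum x) g"
      by (rule eqI; use that in \<open>auto intro!: cfc_value_scale cfc_value_cnj x val continuous_intros\<close>)+
  qed
  then show ?thesis using val that by blast
qed

section \<open>Uniqueness of the functional calculus\<close>

lemma cfc_hom_cong:
  assumes "cfc_hom x \<Phi>" "continuous_on (spectrum x) g" "\<And>z. z \<in> spectrum x \<Longrightarrow> g z = h z"
  shows "\<Phi> g = \<Phi> h"
  using assms(1)[unfolded cfc_hom_def, THEN conjunct2, THEN conjunct2, THEN conjunct1, rule_format, of g h]
    assms(2,3) by blast

lemma cfc_hom_add:
  assumes "cfc_hom x \<Phi>" "continuous_on (spectrum x) g" "continuous_on (spectrum x) h"
  shows "\<Phi> (\<lambda>z. g z + h z) = \<Phi> g + \<Phi> h"
  using assms(1)[unfolded cfc_hom_def, THEN conjunct2, THEN conjunct2, THEN conjunct2, THEN conjunct1,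
      rule_format, of g h] assms(2,3) by blast

lemma cfc_hom_mult:
  assumes "cfc_hom x \<Phi>" "continuous_on (spectrum x) g" "continuous_on (spectrum x) h"
  shows "\<Phi> (\<lambda>z. g z * h z) = \<Phi> g * \<Phi> h"
  using assms(1)[unfolded cfc_hom_def, THEN conjunct2, THEN conjunct2, THEN conjunct2, THEN conjunct1,
      rule_format, of g h] assms(2,3) by blast

lemma cfc_hom_scale:
  assumes "cfc_hom x \<Phi>" "continuous_on (spectrum x) g"
  shows "\<Phi> (\<lambda>z. c * g z) = c *\<^sub>C \<Phi> g"
  using assms(1)[unfolded cfc_hom_def, THEN conjunct2, THEN conjunct2, THEN conjunct2, THEN conjunct2,
      rule_format, OF assms(2), of c] by blast

lemma cfc_hom_const:
  assumes "cfc_hom x \<Phi>"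
  shows "\<Phi> (\<lambda>z. c) = c *\<^sub>C 1"
  using cfc_hom_scale[OF assms continuous_on_const, of c 1] assms by (simp add: cfc_hom_def)

text \<open>Continuity is not among the axioms of \<open>cfc_hom\<close>, so contractivity has to
  come from algebra: \<open>V = sqrt (B\<^sup>2 - u\<^sup>2)\<close> makes the squares of
  \<open>\<Phi> U\<close> and \<open>\<Phi> V\<close> add up to a scalar, as in
  \<open>norm_le_of_sum_squares\<close>.\<close>

lemma cfc_hom_norm_le:
  fixes u :: "complex \<Rightarrow> real"
  assumes x: "self_adjoint x" and hom: "cfc_hom x \<Phi>" and u: "continuous_on (spectrum x) u"
    and B: "\<And>z. z \<in> spectrum x \<Longrightarrow> \<bar>u z\<bar> \<le> B" "0 \<le> B"
  shows "norm (\<Phi> (\<lambda>z. complex_of_real (u z))) \<le> B"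
proof (rule norm_le_of_sum_squares)
  define U where "U z = complex_of_real (u z)" for z
  define V where "V z = complex_of_real (sqrt (B\<^sup>2 - (u z)\<^sup>2))" for z
  have cont: "continuous_on (spectrum x) U" "continuous_on (spectrum x) V"
    unfolding U_def V_def by (intro continuous_intros u)+
  have sa: "self_adjoint (\<Phi> g)" if "continuous_on (spectrum x) g" "\<And>z. cnj (g z) = g z" for g
    using hom[unfolded cfc_hom_def, THEN conjunct2, THEN conjunct2, THEN conjunct2, THEN conjunct2,
        rule_format, OF that(1), of 1] that(2) by (simp add: self_adjoint_def)
  show "self_adjoint (\<Phi> (\<lambda>z. complex_of_real (u z)))" "self_adjoint (\<Phi> V)"
    using sa[OF cont(1)] sa[OF cont(2)] by (simp_all add: U_def[abs_def] V_def)
  have "\<Phi> U * \<Phi> V = \<Phi> V * \<Phi> U"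
    using cfc_hom_mult[OF hom cont] cfc_hom_mult[OF hom cont(2,1)] by (simp add: mult.commute)
  then show "\<Phi> (\<lambda>z. complex_of_real (u z)) * \<Phi> V = \<Phi> V * \<Phi> (\<lambda>z. complex_of_real (u z))"
    by (simp add: U_def[abs_def])
  have "\<Phi> U * \<Phi> U + \<Phi> V * \<Phi> V = \<Phi> (\<lambda>z. U z * U z + V z * V z)"
    using cont by (simp add: cfc_hom_add[OF hom] cfc_hom_mult[OF hom] continuous_on_mult)
  also have "\<dots> = \<Phi> (\<lambda>z. complex_of_real (B\<^sup>2) * 1)"
  proof -
    have "U z * U z + V z * V z = complex_of_real (B\<^sup>2) * 1" if "z \<in> spectrum x" for z
    proof -
      have "(u z)\<^sup>2 \<le> B\<^sup>2"
        using B(1)[OF that] by (metis abs_le_square_iff abs_of_nonneg B(2))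
      then have "u z * u z + sqrt (B\<^sup>2 - (u z)\<^sup>2) * sqrt (B\<^sup>2 - (u z)\<^sup>2) = B\<^sup>2"
        by (simp add: power2_eq_square)
      then show ?thesis
        unfolding U_def V_def by (simp only: mult_1_right flip: of_real_mult of_real_add)
    qed
    moreover have "continuous_on (spectrum x) (\<lambda>z. U z * U z + V z * V z)"
      by (intro continuous_intros cont)
    ultimately show ?thesis
      by (intro cfc_hom_cong[OF hom])
  qed
  also have "\<dots> = (B\<^sup>2) *\<^sub>R 1"
    by (simp only: mult_1_right cfc_hom_const[OF hom] scaleC_of_real)
  finally show "\<Phi> (\<lambda>z. complex_of_real (u z)) * \<Phi> (\<lambda>z. complex_of_real (u z)) + \<Phi> V * \<Phi> V = (B\<^sup>2) *\<^sub>R 1"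
    by (simp add: U_def[abs_def])
qed (rule B)

text \<open>The factor 2 comes from treating real and imaginary part separately; any constant would
  do for passing to limits.\<close>

lemma cfc_hom_diff_norm_le:
  assumes x: "self_adjoint x" and hom: "cfc_hom x \<Phi>"
    and g: "continuous_on (spectrum x) g" and h: "continuous_on (spectrum x) h"
    and B: "\<And>z. z \<in> spectrum x \<Longrightarrow> cmod (g z - h z) \<le> B" "0 \<le> B"
  shows "norm (\<Phi> g - \<Phi> h) \<le> 2 * B"
proof -
  define d where "d z = g z + (-1) * h z" for z
  have d: "continuous_on (spectrum x) d"
    unfolding d_def by (intro continuous_intros g h)
  have dB: "cmod (d z) \<le> B" if "z \<in> spectrum x" for z
    using B(1)[OF that] by (simp add: d_def)
  define R where "R z = complex_of_real (Re (d z))" for z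
  define J where "J z = complex_of_real (Im (d z))" for z
  have cont: "continuous_on (spectrum x) R" "continuous_on (spectrum x) J"
    unfolding R_def J_def by (intro continuous_intros d)+
  have "norm (\<Phi> R) \<le> B"
    unfolding R_def using dB abs_Re_le_cmod B(2)
    by (intro cfc_hom_norm_le[OF x hom] continuous_intros d) (auto intro: order_trans)
  moreover have "norm (\<Phi> J) \<le> B"
    unfolding J_def using dB abs_Im_le_cmod B(2)
    by (intro cfc_hom_norm_le[OF x hom] continuous_intros d) (auto intro: order_trans)
  moreover have "\<Phi> d = \<Phi> R + \<i> *\<^sub>C \<Phi> J"
  proof -
    have "d = (\<lambda>z. R z + \<i> * J z)"
      by (simp add: R_def J_def flip: complex_eq)
    then show ?thesis
      using cfc_hom_add[OF hom cont(1) continuous_on_mult[OF continuous_on_const cont(2)], of \<i>]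
        cfc_hom_scale[OF hom cont(2), of \<i>] by simp
  qed
  moreover have "\<Phi> d = \<Phi> g + (-1) *\<^sub>C \<Phi> h"
    unfolding d_def
    using cfc_hom_add[OF hom g continuous_on_mult[OF continuous_on_const h], of "-1"]
      cfc_hom_scale[OF hom h, of "-1"] by simp
  ultimately have "\<Phi> g - \<Phi> h = \<Phi> R + \<i> *\<^sub>C \<Phi> J" "norm (\<Phi> R) \<le> B" "norm (\<i> *\<^sub>C \<Phi> J) \<le> B"
    by (simp_all add: scaleC_minus_left norm_scaleC)
  then show ?thesis
    using norm_triangle_ineq[of "\<Phi> R" "\<i> *\<^sub>C \<Phi> J"] by simp
qed

lemma cfc_hom_poly:
  assumes hom: "cfc_hom x \<Phi>"
  shows "\<Phi> (poly p) = poly_apply p x"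
proof (induction p)
  case 0
  then show ?case
    using cfc_hom_const[OF hom, of 0] by (simp add: poly_0[abs_def])
next
  case (pCons c p)
  have "\<Phi> (\<lambda>z. c + z * poly p z) = \<Phi> (\<lambda>z. c) + \<Phi> (\<lambda>z. z * poly p z)"
    by (rule cfc_hom_add[OF hom]) (intro continuous_intros)+
  also have "\<Phi> (\<lambda>z. z * poly p z) = \<Phi> (\<lambda>z. z) * \<Phi> (poly p)"
    by (rule cfc_hom_mult[OF hom]) (intro continuous_intros)+
  also have "\<Phi> (\<lambda>z. z) = x"
    using hom by (simp add: cfc_hom_def)
  also have "(\<lambda>z. c + z * poly p z) = poly (pCons c p)"
    by auto
  finally show ?case
    using pCons.IH by (simp add: cfc_hom_const[OF hom])
qed

text \<open>On polynomials \<open>\<Phi>\<close> is determined by algebra, and the preceding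
  estimate carries this to uniform limits. Hence any two such \<open>\<Phi>\<close> agree on
  continuous functions.\<close>

lemma cfc_hom_value:
  assumes x: "self_adjoint x" and hom: "cfc_hom x \<Phi>" and g: "continuous_on (spectrum x) g"
  shows "cfc_value x g (\<Phi> g)"
proof -
  obtain b where b: "cfc_value x g b"
    using cfc_value_exists[OF x g] by blast
  then obtain p where p: "uniform_limit (spectrum x) (\<lambda>n. poly (p n)) g sequentially"
    and lim: "(\<lambda>n. poly_apply (p n) x) \<longlonglongrightarrow> b"
    by (auto simp: cfc_value_def)
  have "(\<lambda>n. poly_apply (p n) x) \<longlonglongrightarrow> \<Phi> g"
  proof (rule tendstoI)
    fix e :: real assume e: "0 < e"
    have "\<forall>\<^sub>F n in sequentially. \<forall>z\<in>spectrum x. dist (poly (p n) z) (g z) < e / 4"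
      using uniform_limitD[OF p, of "e / 4"] e by simp
    then show "\<forall>\<^sub>F n in sequentially. dist (poly_apply (p n) x) (\<Phi> g) < e"
    proof eventually_elim
      case (elim n)
      have "norm (\<Phi> (poly (p n)) - \<Phi> g) \<le> 2 * (e / 4)"
        using elim e by (intro cfc_hom_diff_norm_le[OF x hom _ g]) (auto simp: dist_norm intro!: less_imp_le continuous_intros)
      then show ?case using e by (simp add: dist_norm cfc_hom_poly[OF hom])
    qed
  qed
  then have "b = \<Phi> g"
    using lim by (blast intro: LIMSEQ_unique)
  with b show ?thesis by simp
qed

text \<open>Resolves the description in \<open>cfc\<close>; the rules for \<open>cfc\<close> are
  derived from this relation.\<close>

lemma cfc_value_cfc:
  assumes x: "self_adjoint x" and f: "continuous_on (Re ` spectrum x) f"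
  shows "cfc_value x (\<lambda>z. complex_of_real (f (Re z))) (cfc f x)"
proof -
  have cont: "continuous_on (spectrum x) (\<lambda>z. complex_of_real (f (Re z)))"
    by (intro continuous_intros continuous_on_compose2[OF f]) auto
  obtain \<Phi> where \<Phi>: "cfc_hom x \<Phi>"
    using cfc_hom_exists[OF x] by blast
  have "cfc f x = \<Phi> (\<lambda>z. complex_of_real (f (Re z)))"
    unfolding cfc_def
  proof (rule the_equality)
    fix b assume "\<exists>\<Phi>. cfc_hom x \<Phi> \<and> b = \<Phi> (\<lambda>z. complex_of_real (f (Re z)))"
    then obtain \<Psi> where \<Psi>: "cfc_hom x \<Psi>" "b = \<Psi> (\<lambda>z. complex_of_real (f (Re z)))"
      by blast
    show "b = \<Phi> (\<lambda>z. complex_of_real (f (Re z)))"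
      unfolding \<Psi>(2)
      by (rule cfc_value_unique[OF x cfc_hom_value[OF x \<Psi>(1) cont] cfc_hom_value[OF x \<Phi> cont] refl])
  qed (use \<Phi> in blast)
  then show ?thesis
    using cfc_hom_value[OF x \<Phi> cont] by simp
qed

section \<open>Rules for \<open>cfc\<close>, and positivity\<close>

lemma cfc_eqI:
  assumes "self_adjoint x" "continuous_on (Re ` spectrum x) f" "cfc_value x g b"
    "\<And>z. z \<in> spectrum x \<Longrightarrow> g z = complex_of_real (f (Re z))"
  shows "cfc f x = b"
  by (rule cfc_value_unique[OF assms(1) cfc_value_cfc[OF assms(1,2)] assms(3)]) (simp add: assms(4))

lemma cfc_cong:
  assumes "self_adjoint x" "continuous_on (Re ` spectrum x) f"
    "\<And>t. t \<in> Re ` spectrum x \<Longrightarrow> f t = g t"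
  shows "cfc f x = cfc g x"
proof (rule cfc_eqI[OF assms(1,2) cfc_value_cfc[OF assms(1)]])
  show "continuous_on (Re ` spectrum x) g"
    using assms(2,3) continuous_on_cong[of _ _ f g] by auto
qed (simp add: assms(3))

lemma cfc_const:
  assumes "self_adjoint x"
  shows "cfc (\<lambda>t. r) x = r *\<^sub>R 1"
proof (rule cfc_eqI[OF assms continuous_on_const])
  show "cfc_value x (poly [:complex_of_real r:]) (r *\<^sub>R 1)"
    using cfc_value_poly[of x "[:complex_of_real r:]"] by (simp add: scaleC_of_real)
qed simp

lemma cfc_id: "self_adjoint x \<Longrightarrow> cfc (\<lambda>t. t) x = x"
  using cfc_value_poly[of x "[:0, 1:]"]
  by (intro cfc_eqI) (auto simp: complex_eq_iff spectrum_real intro: continuous_intros)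

lemma cfc_add:
  assumes "self_adjoint x" "continuous_on (Re ` spectrum x) f" "continuous_on (Re ` spectrum x) g"
  shows "cfc (\<lambda>t. f t + g t) x = cfc f x + cfc g x"
  by (rule cfc_eqI[OF assms(1) _ cfc_value_add[OF cfc_value_cfc cfc_value_cfc]])
    (use assms in \<open>auto intro: continuous_intros\<close>)

lemma cfc_mult:
  assumes "self_adjoint x" "continuous_on (Re ` spectrum x) f" "continuous_on (Re ` spectrum x) g"
  shows "cfc (\<lambda>t. f t * g t) x = cfc f x * cfc g x"
proof (rule cfc_eqI[OF assms(1) _ cfc_value_mult[OF cfc_value_cfc cfc_value_cfc]])
  show "continuous_on (spectrum x) (\<lambda>z. complex_of_real (f (Re z)))"
    "continuous_on (spectrum x) (\<lambda>z. complex_of_real (g (Re z)))"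
    by (intro continuous_intros continuous_on_compose2[OF assms(2)] continuous_on_compose2[OF assms(3)]; auto)+
qed (use assms in \<open>auto intro: continuous_intros\<close>)

lemma cfc_scaleR:
  assumes "self_adjoint x" "continuous_on (Re ` spectrum x) f"
  shows "cfc (\<lambda>t. r * f t) x = r *\<^sub>R cfc f x"
  using cfc_mult[OF assms(1) continuous_on_const assms(2), of r] cfc_const[OF assms(1), of r] by simp

lemma cfc_diff:
  assumes "self_adjoint x" "continuous_on (Re ` spectrum x) f" "continuous_on (Re ` spectrum x) g"
  shows "cfc (\<lambda>t. f t - g t) x = cfc f x - cfc g x"
  using cfc_add[OF assms(1,2), of "\<lambda>t. (-1) * g t"] cfc_scaleR[OF assms(1,3), of "-1"] assms(3)
  by (simp add: continuous_on_minus)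

lemma self_adjoint_cfc:
  assumes "self_adjoint x" "continuous_on (Re ` spectrum x) f"
  shows "self_adjoint (cfc f x)"
  unfolding self_adjoint_def
  by (rule cfc_eqI[OF assms cfc_value_cnj[OF assms(1) cfc_value_cfc[OF assms]], symmetric]) simp

lemma cfc_commute:
  assumes "self_adjoint x" "continuous_on (Re ` spectrum x) f" "c * x = x * c"
  shows "c * cfc f x = cfc f x * c"
  by (rule cfc_value_commute[OF cfc_value_cfc[OF assms(1,2)] assms(3)])

lemma cfc_norm_le:
  assumes "self_adjoint x" "continuous_on (Re ` spectrum x) f"
    "\<And>t. t \<in> Re ` spectrum x \<Longrightarrow> \<bar>f t\<bar> \<le> B" "0 \<le> B"
  shows "norm (cfc f x) \<le> B"
  by (rule cfc_value_norm_le[OF assms(1) cfc_value_cfc[OF assms(1,2)]]) (use assms in auto)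

text \<open>For a negative real \<open>c\<close>, the function \<open>f - c\<close> is strictly
  positive on the spectrum, so its reciprocal is continuous there and inverts
  \<open>cfc f x - c\<close>.\<close>

lemma positive_cfc:
  assumes x: "self_adjoint x" and f: "continuous_on (Re ` spectrum x) f"
    and nonneg: "\<And>t. t \<in> Re ` spectrum x \<Longrightarrow> 0 \<le> f t"
  shows "positive (cfc f x)"
  unfolding positive_def
proof (intro conjI subsetI)
  show sa: "self_adjoint (cfc f x)"
    by (rule self_adjoint_cfc[OF x f])
  fix c assume c: "c \<in> spectrum (cfc f x)"
  then have "Im c = 0"
    by (rule spectrum_real[OF sa])
  then have cr: "c = complex_of_real (Re c)"
    by (simp add: complex_eq_iff)
  have "0 \<le> Re c"
  proof (rule ccontr)
    assume neg: "\<not> 0 \<le> Re c"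
    define g where "g t = f t - Re c" for t
    have pos: "0 < g t" if "t \<in> Re ` spectrum x" for t
      using nonneg[OF that] neg by (simp add: g_def)
    have g: "continuous_on (Re ` spectrum x) g" "continuous_on (Re ` spectrum x) (\<lambda>t. 1 / g t)"
      using pos by (auto simp: g_def[abs_def] intro!: continuous_intros f) force
    have inv: "cfc (\<lambda>t. g t * (1 / g t)) x = 1"
    proof (rule cfc_eqI[OF x])
      show "cfc_value x (poly [:1:]) 1"
        using cfc_value_poly[of x "[:1:]"] by simp
      show "continuous_on (Re ` spectrum x) (\<lambda>t. g t * (1 / g t))"
        by (intro continuous_on_mult g)
      show "poly [:1:] z = complex_of_real (g (Re z) * (1 / g (Re z)))" if "z \<in> spectrum x" for z
        using pos[of "Re z"] that by auto
    qed
    have "cfc g x = cfc f x - c *\<^sub>C 1"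
      unfolding g_def using cfc_diff[OF x f continuous_on_const, of "Re c"] cfc_const[OF x, of "Re c"]
      by (metis cr scaleC_of_real)
    moreover have "has_inverse (cfc g x)"
      using inv cfc_mult[OF x g] cfc_mult[OF x g(2,1)]
      by (intro has_inverseI_left_right[of "cfc (\<lambda>t. 1 / g t) x" _ "cfc (\<lambda>t. 1 / g t) x"])
        (simp_all add: mult.commute)
    ultimately show False using c by (simp add: spectrum_iff)
  qed
  then show "c \<in> complex_of_real ` {0..}"
    using cr by auto
qed

lemma positive_sqrt:
  assumes "positive x"
  obtains s where "self_adjoint s" "x = s * s"
proof
  have x: "self_adjoint x" and pos: "\<And>t. t \<in> Re ` spectrum x \<Longrightarrow> 0 \<le> t"
    using assms by (auto simp: positive_def)
  have cont: "continuous_on (Re ` spectrum x) sqrt"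
    by (intro continuous_intros)
  show "self_adjoint (cfc sqrt x)"
    by (rule self_adjoint_cfc[OF x cont])
  have "x = cfc (\<lambda>t. t) x"
    by (simp add: cfc_id x)
  also have "\<dots> = cfc (\<lambda>t. sqrt t * sqrt t) x"
    using pos by (intro cfc_cong[OF x]) (auto intro: continuous_intros)
  finally show "x = cfc sqrt x * cfc sqrt x"
    by (simp only: cfc_mult[OF x cont cont])
qed

lemma spectrum_diff_scaleC: "c \<in> spectrum (x - d *\<^sub>C 1) \<longleftrightarrow> c + d \<in> spectrum x"
  by (simp add: spectrum_iff scaleC_add_left algebra_simps)

section \<open>Operators on a Hilbert space\<close>

lemma bop_apply_diff: "(S - T) \<bullet>\<bullet> x = S \<bullet>\<bullet> x - T \<bullet>\<bullet> x" "(0 :: 'h bop) \<bullet>\<bullet> x = 0"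
  for S T :: "'h::chilbert_space bop"
  by (transfer; simp add: blinfun.diff_left)+

lemma bop_diff_right: "T \<bullet>\<bullet> (x - y) = T \<bullet>\<bullet> x - T \<bullet>\<bullet> y" "T \<bullet>\<bullet> 0 = 0"
  for T :: "'h::chilbert_space bop"
  by (transfer; simp add: blinfun.diff_right)+

lemma bounded_linear_bop_apply: "bounded_linear (bop_apply T)"
  by transfer (rule blinfun.bounded_linear_right)

lemmas bop_simps = bop_apply_simps bop_apply_diff bop_diff_right

lemma inner_adj: "inner (T \<bullet>\<bullet> x) y = inner x (adj T \<bullet>\<bullet> y)" for T :: "'h::chilbert_space bop"
  using cinner_adj[of T x y] by (simp flip: Re_cinner)

lemma inner_self_adjoint:
  "self_adjoint T \<Longrightarrow> inner (T \<bullet>\<bullet> x) y = inner x (T \<bullet>\<bullet> y)" for T :: "'h::chilbert_space bop"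
  using inner_adj[of T x y] by (simp add: self_adjoint_def)

lemma norm_bop_apply_square:
  "(norm (T \<bullet>\<bullet> x))\<^sup>2 = inner ((adj T * T) \<bullet>\<bullet> x) x" for T :: "'h::chilbert_space bop"
  by (simp add: power2_norm_eq_inner bop_simps inner_adj inner_commute)

text \<open>Evaluating the form at \<open>x + T x\<close> leaves only the cross terms, which are
  twice the squared norm of \<open>T x\<close>.\<close>

lemma self_adjoint_eq_zeroI:
  fixes T :: "'h::chilbert_space bop"
  assumes T: "self_adjoint T" and 0: "\<And>x. inner (T \<bullet>\<bullet> x) x = 0"
  shows "T = 0"
proof (rule bop_eqI)
  fix x
  have "inner (T \<bullet>\<bullet> (x + T \<bullet>\<bullet> x)) (x + T \<bullet>\<bullet> x) = 2 * inner (T \<bullet>\<bullet> x) (T \<bullet>\<bullet> x)"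
    using 0[of x] 0[of "T \<bullet>\<bullet> x"]
    by (simp add: bop_simps inner_add inner_commute inner_self_adjoint[OF T])
  then have "inner (T \<bullet>\<bullet> x) (T \<bullet>\<bullet> x) = 0"
    using 0[of "x + T \<bullet>\<bullet> x"] by simp
  then show "T \<bullet>\<bullet> x = 0 \<bullet>\<bullet> x" by (simp add: bop_simps)
qed

lemma self_adjoint_eqI:
  fixes S T :: "'h::chilbert_space bop"
  assumes "self_adjoint S" "self_adjoint T" "\<And>x. inner (S \<bullet>\<bullet> x) x = inner (T \<bullet>\<bullet> x) x"
  shows "S = T"
  using self_adjoint_eq_zeroI[of "S - T"] assms
  by (simp add: self_adjoint_diff bop_simps inner_diff_left)

lemma inner_square_nonneg:
  fixes s :: "'h::chilbert_space bop"
  assumes "self_adjoint s"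
  shows "inner ((s * s) \<bullet>\<bullet> x) x = (norm (s \<bullet>\<bullet> x))\<^sup>2"
  using norm_bop_apply_square[of s x] assms by (simp add: self_adjoint_def)

lemma positive_inner_nonneg:
  fixes T :: "'h::chilbert_space bop"
  assumes "positive T"
  shows "0 \<le> inner (T \<bullet>\<bullet> x) x"
proof -
  obtain s where "self_adjoint s" "T = s * s"
    using positive_sqrt[OF assms] by blast
  then show ?thesis by (simp add: inner_square_nonneg)
qed

lemma cfc_inner_mono:
  fixes x :: "'h::chilbert_space bop"
  assumes x: "self_adjoint x" and f: "continuous_on (Re ` spectrum x) f"
    and g: "continuous_on (Re ` spectrum x) g" and le: "\<And>t. t \<in> Re ` spectrum x \<Longrightarrow> f t \<le> g t"
  shows "inner (cfc f x \<bullet>\<bullet> \<xi>) \<xi> \<le> inner (cfc g x \<bullet>\<bullet> \<xi>) \<xi>"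
proof -
  have "positive (cfc (\<lambda>t. g t - f t) x)"
    by (rule positive_cfc[OF x]) (use f g le in \<open>auto intro: continuous_intros\<close>)
  from positive_inner_nonneg[OF this, of \<xi>] show ?thesis
    by (simp add: cfc_diff x f g bop_simps inner_diff_left)
qed

text \<open>Let \<open>n\<close> be the negative part of \<open>S = adj T * T\<close>. The squared
  norm of \<open>T (n \<xi>)\<close> is the form of \<open>n * S * n\<close>, which is minus the
  form of the positive element \<open>n * n * n\<close>. Both must vanish, so the cube of
  \<open>n\<close> is 0, and the C*-identity, used twice on its fourth power, gives
  \<open>n = 0\<close>.\<close>

lemma positive_adj_mult_self: "positive (adj T * T)" for T :: "'h::chilbert_space bop"
proof -
  define S where "S = adj T * T"
  define K where "K = Re ` spectrum S"
  have S: "self_adjoint S"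
    by (simp add: S_def self_adjoint_def adj_mult adj_adj)
  define h where "h t = max (- t) 0" for t :: real
  have h: "continuous_on K h"
    unfolding h_def by (intro continuous_intros)
  define n where "n = cfc h S"
  have n: "self_adjoint n"
    unfolding n_def by (rule self_adjoint_cfc[OF S h[unfolded K_def]])
  have hh: "continuous_on K (\<lambda>t. h t * h t)"
    by (intro continuous_intros h)
  have nSn: "n * (S * n) = - (n * (n * n))"
  proof -
    have "n * (S * n) = cfc (\<lambda>t. h t * (t * h t)) S"
      using h unfolding n_def K_def
      by (subst cfc_mult[OF S], simp, intro continuous_intros, simp)
        (subst cfc_mult[OF S], intro continuous_intros, simp, simp add: cfc_id[OF S])
    also have "\<dots> = cfc (\<lambda>t. (-1) * (h t * (h t * h t))) S"
      using h by (intro cfc_cong[OF S] continuous_intros) (auto simp: K_def h_def max_def)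
    also have "\<dots> = - cfc (\<lambda>t. h t * (h t * h t)) S"
      using h hh by (subst cfc_scaleR[OF S]) (auto simp: K_def intro: continuous_intros)
    also have "cfc (\<lambda>t. h t * (h t * h t)) S = n * (n * n)"
      using h hh unfolding n_def K_def by (simp add: cfc_mult[OF S])
    finally show ?thesis .
  qed
  have cube: "inner ((n * (n * n)) \<bullet>\<bullet> \<xi>) \<xi> = 0" for \<xi>
  proof (rule antisym)
    have "0 \<le> (norm (T \<bullet>\<bullet> (n \<bullet>\<bullet> \<xi>)))\<^sup>2" by simp
    also have "\<dots> = inner (n \<bullet>\<bullet> (S \<bullet>\<bullet> (n \<bullet>\<bullet> \<xi>))) \<xi>"
      by (simp add: norm_bop_apply_square S_def inner_self_adjoint[OF n])
    also have "\<dots> = inner ((n * (S * n)) \<bullet>\<bullet> \<xi>) \<xi>"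
      by (simp add: bop_simps)
    also have "\<dots> = - inner ((n * (n * n)) \<bullet>\<bullet> \<xi>) \<xi>"
      unfolding nSn using bop_apply_diff(1)[of 0 "n * (n * n)" \<xi>] by (simp add: bop_simps)
    finally show "inner ((n * (n * n)) \<bullet>\<bullet> \<xi>) \<xi> \<le> 0" by simp
    have "positive (cfc (\<lambda>t. h t * (h t * h t)) S)"
      by (rule positive_cfc[OF S]) (use h in \<open>auto simp: K_def h_def intro!: continuous_intros\<close>)
    moreover have "cfc (\<lambda>t. h t * (h t * h t)) S = n * (n * n)"
      using h hh unfolding n_def K_def by (simp add: cfc_mult[OF S])
    ultimately show "0 \<le> inner ((n * (n * n)) \<bullet>\<bullet> \<xi>) \<xi>"
      using positive_inner_nonneg by metis
  qed
  have "n * (n * n) = 0"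
    by (rule self_adjoint_eq_zeroI[OF _ cube]) (use n in \<open>simp add: self_adjoint_def adj_mult mult.assoc\<close>)
  then have "(n * n) * (n * n) = 0"
    by (metis mult.assoc mult_zero_right)
  then have "norm n = 0"
    using norm_square[OF self_adjoint_square[OF n]] norm_square[OF n] by simp
  have "S = cfc (\<lambda>t. max t 0 - h t) S"
    using cfc_cong[OF S, of "\<lambda>t. t" "\<lambda>t. max t 0 - h t"] cfc_id[OF S]
    by (auto simp: h_def max_def)
  also have "\<dots> = cfc (\<lambda>t. max t 0) S - n"
    using h unfolding n_def K_def by (intro cfc_diff[OF S] continuous_intros)
  finally have "S = cfc (\<lambda>t. max t 0) S"
    using \<open>norm n = 0\<close> by simp
  moreover have "positive (cfc (\<lambda>t. max t 0) S)"
    by (rule positive_cfc[OF S]) (auto intro: continuous_intros)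
  ultimately show ?thesis by (simp add: S_def)
qed

section \<open>Strong limits of operators\<close>

lemma bop_exists:
  fixes f :: "'h::chilbert_space \<Rightarrow> 'h"
  assumes "\<And>x y. f (x + y) = f x + f y" and "\<And>c x. f (c *\<^sub>C x) = c *\<^sub>C f x"
    and "\<And>x. norm (f x) \<le> B * norm x"
  obtains T where "\<And>x. T \<bullet>\<bullet> x = f x"
proof -
  have "bounded_linear f"
    using assms(2)[of "complex_of_real _"] assms
    by (intro bounded_linear_intro[of _ B]) (simp_all add: scaleC_of_real mult.commute)
  then have "bop_apply (Abs_bop (Blinfun f)) = f"
    using assms(2) by (auto simp: bop_apply.rep_eq Abs_bop_inverse bounded_linear_Blinfun_apply)
  then show ?thesis
    using that[of "Abs_bop (Blinfun f)"] by simp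
qed

lemma strong_limit_exists:
  fixes V :: "nat \<Rightarrow> 'h::chilbert_space bop"
  assumes conv: "\<And>x. convergent (\<lambda>n. V n \<bullet>\<bullet> x)" and B: "\<And>n x. norm (V n \<bullet>\<bullet> x) \<le> B * norm x"
  obtains v where "\<And>x. (\<lambda>n. V n \<bullet>\<bullet> x) \<longlonglongrightarrow> v \<bullet>\<bullet> x"
proof -
  define f where "f x = lim (\<lambda>n. V n \<bullet>\<bullet> x)" for x
  have f: "(\<lambda>n. V n \<bullet>\<bullet> x) \<longlonglongrightarrow> f x" for x
    using conv[of x] by (simp add: f_def convergent_LIMSEQ_iff)
  have "\<exists>v. \<forall>x. v \<bullet>\<bullet> x = f x"
  proof (rule bop_exists[of f B])
    show "f (x + y) = f x + f y" for x y
      using tendsto_add[OF f[of x] f[of y]] f[of "x + y"] LIMSEQ_unique by (fastforce simp: bop_simps)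
    show "f (c *\<^sub>C x) = c *\<^sub>C f x" for c x
      using bounded_linear.tendsto[OF bounded_linear_scaleC f[of x], of c] f[of "c *\<^sub>C x"] LIMSEQ_unique
      by (fastforce simp: bop_simps)
    show "norm (f x) \<le> B * norm x" for x
      by (rule Lim_bounded[OF tendsto_norm[OF f]]) (simp add: B)
  qed blast
  then show ?thesis using f that by metis
qed

text \<open>The hypothesis makes \<open>a\<close> increasing, so being bounded it is Cauchy, and so
  is \<open>X\<close>. In both applications \<open>a n\<close> is the squared norm of
  \<open>X n\<close>: for the approximants of a polar decomposition and for partial sums of
  orthogonal projections.\<close>

lemma convergent_of_monotone_bound:
  fixes X :: "nat \<Rightarrow> 'a::banach"
  assumes X: "\<And>m n. m \<le> n \<Longrightarrow> (norm (X n - X m))\<^sup>2 \<le> a n - a m" and a_le: "\<And>n. a n \<le> B"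
  shows "convergent X"
proof -
  have "incseq a"
    unfolding incseq_def
  proof (intro allI impI)
    fix m n :: nat assume "m \<le> n"
    then show "a m \<le> a n"
      using X[of m n] zero_le_power2[of "norm (X n - X m)"] by linarith
  qed
  then have conv: "convergent a"
    using incseq_convergent[of a] a_le by (metis convergentI)
  show ?thesis
  proof (rule Cauchy_convergent, rule metric_CauchyI)
    fix e :: real assume e: "0 < e"
    obtain N where N: "\<And>m n. N \<le> m \<Longrightarrow> N \<le> n \<Longrightarrow> dist (a m) (a n) < e\<^sup>2"
      using metric_CauchyD[OF convergent_Cauchy[OF conv], of "e\<^sup>2"] e by auto
    have *: "dist (X m) (X n) < e" if "N \<le> m" "m \<le> n" for m n
    proof -
      have "(norm (X n - X m))\<^sup>2 < e\<^sup>2"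
        using X[OF that(2)] N[of m n] that by (simp add: dist_real_def)
      then show ?thesis
        using e by (simp add: dist_norm norm_minus_commute power_less_imp_less_base)
    qed
    show "\<exists>M. \<forall>m\<ge>M. \<forall>n\<ge>M. dist (X m) (X n) < e"
      using * by (metis dist_commute nat_le_linear)
  qed
qed

section \<open>Projections and polar decomposition\<close>

lemma projection_self_adjoint: "projection p \<Longrightarrow> self_adjoint p"
  by (simp add: projection_def self_adjoint_def)

lemma projection_idem: "projection p \<Longrightarrow> p \<bullet>\<bullet> (p \<bullet>\<bullet> x) = p \<bullet>\<bullet> x"
  by (metis projection_def bop_apply_simps(1))

lemma projection_inner: "projection p \<Longrightarrow> inner (p \<bullet>\<bullet> x) x = (norm (p \<bullet>\<bullet> x))\<^sup>2"
  using norm_bop_apply_square[of p x] by (simp add: projection_def)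

lemma projection_complement: "projection p \<Longrightarrow> projection (1 - p)"
  by (simp add: projection_def adj_diff algebra_simps)

lemma projection_norm_le: "projection p \<Longrightarrow> norm (p \<bullet>\<bullet> x) \<le> norm x"
proof (cases "p \<bullet>\<bullet> x = 0")
  case False
  assume "projection p"
  then have "norm (p \<bullet>\<bullet> x) * norm (p \<bullet>\<bullet> x) \<le> norm (p \<bullet>\<bullet> x) * norm x"
    using norm_cauchy_schwarz[of "p \<bullet>\<bullet> x" x] by (simp add: projection_inner power2_eq_square)
  then show ?thesis using False by simp
qed simp

lemma projection_eqI:
  assumes p: "projection p" and q: "projection q"
    and ker: "\<And>x. p \<bullet>\<bullet> x = 0 \<longleftrightarrow> q \<bullet>\<bullet> x = 0"
  shows "p = q"
proof -
  have "p \<bullet>\<bullet> (x - q \<bullet>\<bullet> x) = 0" "q \<bullet>\<bullet> (x - p \<bullet>\<bullet> x) = 0" for x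
    using p q ker[of "x - q \<bullet>\<bullet> x"] ker[of "x - p \<bullet>\<bullet> x"] by (simp_all add: bop_simps projection_idem)
  then have "p \<bullet>\<bullet> x = (p * q) \<bullet>\<bullet> x" "q \<bullet>\<bullet> x = (q * p) \<bullet>\<bullet> x" for x
    by (simp_all add: bop_simps)
  then have "p = p * q" "q = q * p"
    by (auto intro: bop_eqI)
  then show ?thesis
    using p q by (metis adj_mult projection_def)
qed

text \<open>The partial isometry \<open>v\<close> in the polar decomposition of \<open>T\<close> is the strong limit of
  \<open>T (T\<^sup>*T + 1/n)\<^sup>-\<^sup>1\<^sup>/\<^sup>2\<close>.\<close>

lemma polar_decomposition:
  fixes T :: "'h::chilbert_space bop"
  obtains v where "projection (adj v * v)"
    and "\<And>\<xi>. (adj v * v) \<bullet>\<bullet> \<xi> = 0 \<longleftrightarrow> T \<bullet>\<bullet> \<xi> = 0"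
    and "\<And>c. c * T = T * c \<Longrightarrow> c * adj T = adj T * c \<Longrightarrow> c * v = v * c"
    and "\<And>q. q * T = T \<Longrightarrow> q * v = v"
    and "\<And>\<xi> e. 0 < e \<Longrightarrow> \<exists>\<eta>. norm ((adj v * v) \<bullet>\<bullet> \<xi> - adj T \<bullet>\<bullet> \<eta>) < e"
proof -
  define S where "S = adj T * T"
  define K where "K = Re ` spectrum S"
  have "positive S"
    by (simp add: S_def positive_adj_mult_self)
  then have S: "self_adjoint S" and pos: "0 \<le> t" if "t \<in> K" for t
    using that by (auto simp: positive_def K_def)
  have S: "self_adjoint S"
    using \<open>positive S\<close> by (simp add: positive_def)
  define \<epsilon> where "\<epsilon> n = inverse (real (Suc n))" for n
  have \<epsilon>: "0 < \<epsilon> n" for n by (simp add: \<epsilon>_def)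
  have \<epsilon>_lim: "\<epsilon> \<longlonglongrightarrow> 0"
    unfolding \<epsilon>_def by (rule LIMSEQ_inverse_real_of_nat)
  have \<epsilon>_mono: "\<epsilon> n \<le> \<epsilon> m" if "m \<le> n" for m n
    using that by (simp add: \<epsilon>_def)
  \<comment> \<open>A regularised inverse square root. The function \<open>k n\<close> is
    \<open>t * (g n t)\<^sup>2\<close>, so its form \<open>a n\<close> is the squared norm of
    \<open>V n \<xi>\<close>.\<close>
  define g where "g n t = 1 / sqrt (t + \<epsilon> n)" for n t
  define k where "k n t = t / (t + \<epsilon> n)" for n t
  have tpos: "0 < t + \<epsilon> n" if "t \<in> K" for t n
    using pos[OF that] \<epsilon>[of n] by linarith
  have cont: "continuous_on K (g n)" "continuous_on K (k n)" for n
    unfolding g_def k_def using tpos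
    by (auto intro!: continuous_intros) (metis less_irrefl)+
  have cont_id: "continuous_on K (\<lambda>t. t)" by (rule continuous_on_id)
  have gg: "t * (g n t * g n t) = k n t" if "t \<in> K" for n t
    using tpos[OF that, of n] by (simp add: g_def k_def)
  note [simp] = cfc_id[OF S]
  note C = cfc_mult[OF S, folded K_def] cfc_diff[OF S, folded K_def]
  define G where "G n = cfc (g n) S" for n
  have G: "self_adjoint (G n)" for n
    unfolding G_def by (rule self_adjoint_cfc[OF S cont(1)[unfolded K_def]])
  define V where "V n = T * G n" for n
  have form: "inner (S \<bullet>\<bullet> (cfc h S \<bullet>\<bullet> \<xi>)) (cfc h S \<bullet>\<bullet> \<xi>) = inner (cfc (\<lambda>t. t * (h t * h t)) S \<bullet>\<bullet> \<xi>) \<xi>"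
    if h: "continuous_on K h" for h \<xi>
  proof -
    have "cfc (\<lambda>t. h t * (t * h t)) S = cfc h S * (S * cfc h S)"
      using C(1)[OF h continuous_on_mult[OF cont_id h]] C(1)[OF cont_id h] by simp
    then have "inner (S \<bullet>\<bullet> (cfc h S \<bullet>\<bullet> \<xi>)) (cfc h S \<bullet>\<bullet> \<xi>) = inner (cfc (\<lambda>t. h t * (t * h t)) S \<bullet>\<bullet> \<xi>) \<xi>"
      using inner_self_adjoint[OF self_adjoint_cfc[OF S h[unfolded K_def]]]
      by (simp add: bop_simps)
    then show ?thesis by (simp add: mult_ac)
  qed
  have formT: "(norm (T \<bullet>\<bullet> (cfc h S \<bullet>\<bullet> \<xi>)))\<^sup>2 = inner (cfc (\<lambda>t. t * (h t * h t)) S \<bullet>\<bullet> \<xi>) \<xi>"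
    if h: "continuous_on K h" for h \<xi>
    using form[OF h] by (simp add: norm_bop_apply_square S_def)
  define a where "a n \<xi> = inner (cfc (k n) S \<bullet>\<bullet> \<xi>) \<xi>" for n \<xi>
  have kcong: "cfc (\<lambda>t. t * (g n t * g n t)) S = cfc (k n) S" for n
    by (rule cfc_cong[OF S, folded K_def]) (auto simp: gg intro!: continuous_intros cont)
  have normV: "(norm (V n \<bullet>\<bullet> \<xi>))\<^sup>2 = a n \<xi>" for n \<xi>
    using formT[OF cont(1), of n \<xi>] by (simp add: V_def G_def a_def bop_simps kcong)
  have diffV: "(norm (V n \<bullet>\<bullet> \<xi> - V m \<bullet>\<bullet> \<xi>))\<^sup>2 \<le> a n \<xi> - a m \<xi>" if "m \<le> n" for m n \<xi>
  proof -
    have gd: "continuous_on K (\<lambda>t. g n t - g m t)"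
      by (intro continuous_intros cont)
    have "(norm (V n \<bullet>\<bullet> \<xi> - V m \<bullet>\<bullet> \<xi>))\<^sup>2 = (norm (T \<bullet>\<bullet> (cfc (\<lambda>t. g n t - g m t) S \<bullet>\<bullet> \<xi>)))\<^sup>2"
      by (simp add: V_def G_def bop_simps C(2)[OF cont(1) cont(1)])
    also have "\<dots> \<le> inner (cfc (\<lambda>t. k n t - k m t) S \<bullet>\<bullet> \<xi>) \<xi>"
      unfolding formT[OF gd]
    proof (rule cfc_inner_mono[OF S, folded K_def])
      fix t assume t: "t \<in> K"
      \<comment> \<open>Because \<open>0 \<le> g m t \<le> g n t\<close>, the square of the
        difference is at most the difference of the squares. This bounds the squared distance
        between \<open>V n \<xi>\<close> and \<open>V m \<xi>\<close> by the increment of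
        \<open>a\<close>.\<close>
      have "0 \<le> g m t"
        using tpos[OF t, of m] by (simp add: g_def)
      moreover have "g m t \<le> g n t"
        unfolding g_def using tpos[OF t] \<epsilon>_mono[OF that] by (intro divide_left_mono) auto
      ultimately have "0 \<le> 2 * (g m t * (g n t - g m t))"
        by simp
      then have "(g n t - g m t) * (g n t - g m t) \<le> g n t * g n t - g m t * g m t"
        by (simp add: algebra_simps)
      then have "t * ((g n t - g m t) * (g n t - g m t)) \<le> t * (g n t * g n t - g m t * g m t)"
        by (rule mult_left_mono[OF _ pos[OF t]])
      then show "t * ((g n t - g m t) * (g n t - g m t)) \<le> k n t - k m t"
        by (simp add: right_diff_distrib gg[OF t] flip: gg[OF t])
    qed (intro continuous_intros gd cont)+
    finally show ?thesis
      by (simp add: C(2)[OF cont(2) cont(2)] a_def bop_simps inner_diff_left)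
  qed
  have a_le: "a n \<xi> \<le> (norm \<xi>)\<^sup>2" for n \<xi>
  proof -
    have "a n \<xi> \<le> inner (cfc (\<lambda>t. 1) S \<bullet>\<bullet> \<xi>) \<xi>"
      unfolding a_def
    proof (rule cfc_inner_mono[OF S, folded K_def])
      show "k n t \<le> 1" if "t \<in> K" for t
        using tpos[OF that, of n] \<epsilon>[of n] by (simp add: k_def)
    qed (intro continuous_intros cont)+
    then show ?thesis
      by (simp add: cfc_const[OF S] bop_simps power2_norm_eq_inner)
  qed
  have V_conv: "convergent (\<lambda>n. V n \<bullet>\<bullet> \<xi>)" for \<xi>
    by (rule convergent_of_monotone_bound[OF diffV a_le])
  have V_le: "norm (V n \<bullet>\<bullet> \<xi>) \<le> 1 * norm \<xi>" for n \<xi>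
    using normV[of n \<xi>] a_le[of n \<xi>] by (auto intro: power2_le_imp_le)
  obtain v where v: "\<And>\<xi>. (\<lambda>n. V n \<bullet>\<bullet> \<xi>) \<longlonglongrightarrow> v \<bullet>\<bullet> \<xi>"
    using strong_limit_exists[OF V_conv V_le] by blast
  have v_le: "norm (v \<bullet>\<bullet> \<xi>) \<le> norm \<xi>" for \<xi>
    using Lim_bounded[OF tendsto_norm[OF v[of \<xi>]], of 0 "norm \<xi>"] V_le by simp
  define P where "P = adj v * v"
  have P: "self_adjoint P"
    by (simp add: P_def self_adjoint_def adj_mult adj_adj)
  have formP: "inner (P \<bullet>\<bullet> \<xi>) \<xi> = (norm (v \<bullet>\<bullet> \<xi>))\<^sup>2" for \<xi>
    by (simp add: P_def norm_bop_apply_square)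
  have a_lim: "(\<lambda>n. a n \<xi>) \<longlonglongrightarrow> inner (P \<bullet>\<bullet> \<xi>) \<xi>" for \<xi>
    unfolding formP normV[symmetric] by (intro tendsto_intros v)
  have kerT: "T \<bullet>\<bullet> \<xi> = 0" if "S \<bullet>\<bullet> \<xi> = 0" for \<xi>
    using that norm_bop_apply_square[of T \<xi>] by (simp add: S_def)
  have kS: "cfc (k n) S = cfc (\<lambda>t. g n t * g n t) S * S" "cfc (k n) S = S * cfc (\<lambda>t. g n t * g n t) S" for n
    using C(1)[OF continuous_on_mult[OF cont(1) cont(1)] cont_id, of n n]
      C(1)[OF cont_id continuous_on_mult[OF cont(1) cont(1)], of n n] kcong[of n]
    by (simp_all add: mult.commute)
  have ker_v: "v \<bullet>\<bullet> \<xi> = 0" if "S \<bullet>\<bullet> \<xi> = 0" for \<xi>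
  proof -
    have "a n \<xi> = 0" for n
      unfolding a_def kS(1) by (simp add: bop_simps that)
    then have "V n \<bullet>\<bullet> \<xi> = 0" for n
      using normV[of n \<xi>] by simp
    then show ?thesis
      using v[of \<xi>] by (simp add: LIMSEQ_const_iff)
  qed
  \<comment> \<open>For \<open>\<zeta>\<close> in the range of \<open>S\<close> the defect
    \<open>\<parallel>\<zeta>\<parallel>\<^sup>2 - a n \<zeta>\<close> is at most
    \<open>\<epsilon> n * B\<close>, so the form of \<open>P\<close> at \<open>\<zeta>\<close>
    reaches the squared norm of \<open>\<zeta>\<close>. As \<open>P\<close> is a contraction, this
    forces \<open>P \<zeta> = \<zeta>\<close>.\<close>
  have PS: "P * S = S"
  proof (rule bop_eqI)
    fix \<eta>
    define \<zeta> where "\<zeta> = S \<bullet>\<bullet> \<eta>"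
    define B where "B = inner (S \<bullet>\<bullet> \<eta>) \<eta>"
    have "(norm \<zeta>)\<^sup>2 - a n \<zeta> \<le> \<epsilon> n * B" for n
    proof -
      have ck: "continuous_on K (\<lambda>t. t * (t * k n t))"
        by (intro continuous_intros cont)
      have "cfc (k n) S * S = S * cfc (k n) S"
        using cfc_commute[OF S cont(2)[unfolded K_def], of S n] by simp
      then have "a n \<zeta> = inner ((S * (S * cfc (k n) S)) \<bullet>\<bullet> \<eta>) \<eta>"
        by (metis (no_types, lifting) a_def \<zeta>_def bop_apply_simps(1) inner_commute inner_self_adjoint[OF S])
      also have "S * (S * cfc (k n) S) = cfc (\<lambda>t. t * (t * k n t)) S"
        using C(1)[OF cont_id continuous_on_mult[OF cont_id cont(2)], of n] C(1)[OF cont_id cont(2), of n] by simp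
      finally have 1: "a n \<zeta> = inner (cfc (\<lambda>t. t * (t * k n t)) S \<bullet>\<bullet> \<eta>) \<eta>" .
      have "(norm \<zeta>)\<^sup>2 = inner (cfc (\<lambda>t. t * t) S \<bullet>\<bullet> \<eta>) \<eta>"
        unfolding \<zeta>_def C(1)[OF cont_id cont_id] using inner_square_nonneg[OF S] by simp
      then have "(norm \<zeta>)\<^sup>2 - a n \<zeta> = inner (cfc (\<lambda>t. t * t - t * (t * k n t)) S \<bullet>\<bullet> \<eta>) \<eta>"
        unfolding 1 C(2)[OF continuous_on_mult[OF cont_id cont_id] ck]
        by (simp add: bop_simps inner_diff_left)
      also have "\<dots> \<le> inner (cfc (\<lambda>t. \<epsilon> n * t) S \<bullet>\<bullet> \<eta>) \<eta>"
      proof (rule cfc_inner_mono[OF S, folded K_def])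
        fix t assume t: "t \<in> K"
        have "t * t - t * (t * k n t) = t * (\<epsilon> n * k n t)"
          using tpos[OF t, of n] by (simp add: k_def field_simps)
        also have "\<dots> \<le> t * (\<epsilon> n * 1)"
          using tpos[OF t, of n] pos[OF t] \<epsilon>[of n] by (intro mult_left_mono) (auto simp: k_def)
        finally show "t * t - t * (t * k n t) \<le> \<epsilon> n * t"
          by (simp add: mult.commute)
      qed (intro continuous_intros ck)+
      finally show ?thesis
        by (simp add: cfc_scaleR[OF S] bop_simps B_def)
    qed
    moreover have "(\<lambda>n. (norm \<zeta>)\<^sup>2 - a n \<zeta>) \<longlonglongrightarrow> (norm \<zeta>)\<^sup>2 - inner (P \<bullet>\<bullet> \<zeta>) \<zeta>"
      by (intro tendsto_intros a_lim)
    moreover have "(\<lambda>n. \<epsilon> n * B) \<longlonglongrightarrow> 0 * B"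
      by (intro tendsto_intros \<epsilon>_lim)
    ultimately have "(norm \<zeta>)\<^sup>2 - inner (P \<bullet>\<bullet> \<zeta>) \<zeta> \<le> 0 * B"
      by (intro LIMSEQ_le) auto
    then have low: "(norm \<zeta>)\<^sup>2 \<le> inner (P \<bullet>\<bullet> \<zeta>) \<zeta>" by simp
    have "norm (adj v) \<le> 1"
      using norm_bop_bound[of 1 v] v_le by simp
    then have "norm (P \<bullet>\<bullet> \<zeta>) \<le> norm \<zeta>"
      using norm_bop_apply[of "adj v" "v \<bullet>\<bullet> \<zeta>"] v_le[of \<zeta>]
        mult_mono[of "norm (adj v)" 1 "norm (v \<bullet>\<bullet> \<zeta>)" "norm \<zeta>"]
      by (simp add: P_def bop_simps del: norm_adj)
    then have "(norm (P \<bullet>\<bullet> \<zeta>))\<^sup>2 \<le> (norm \<zeta>)\<^sup>2"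
      by (intro power_mono) auto
    moreover have "(norm (P \<bullet>\<bullet> \<zeta> - \<zeta>))\<^sup>2 = (norm (P \<bullet>\<bullet> \<zeta>))\<^sup>2 - 2 * inner (P \<bullet>\<bullet> \<zeta>) \<zeta> + (norm \<zeta>)\<^sup>2"
      by (simp add: power2_norm_eq_inner inner_diff inner_commute)
    ultimately have "(norm (P \<bullet>\<bullet> \<zeta> - \<zeta>))\<^sup>2 \<le> 0"
      using low by linarith
    then show "(P * S) \<bullet>\<bullet> \<eta> = S \<bullet>\<bullet> \<eta>"
      by (simp add: bop_simps \<zeta>_def)
  qed
  then have SP: "S * P = S"
    using P S adj_mult[of P S] by (simp add: self_adjoint_def)
  \<comment> \<open>By \<open>S * P = S\<close>, the vector \<open>\<xi> - P \<xi>\<close> lies in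
    the kernel of \<open>S\<close>, where \<open>v\<close> vanishes. Idempotence of
    \<open>P = adj v * v\<close> follows.\<close>
  have vP: "v * P = v"
  proof (rule bop_eqI)
    fix \<xi>
    have "S \<bullet>\<bullet> (\<xi> - P \<bullet>\<bullet> \<xi>) = 0"
      using arg_cong[OF SP, of "\<lambda>X. X \<bullet>\<bullet> \<xi>"] by (simp add: bop_simps)
    from ker_v[OF this] show "(v * P) \<bullet>\<bullet> \<xi> = v \<bullet>\<bullet> \<xi>"
      by (simp add: bop_simps)
  qed
  show ?thesis
  proof
    show proj: "projection (adj v * v)"
      using P vP by (simp add: projection_def self_adjoint_def P_def mult.assoc)
    show "(adj v * v) \<bullet>\<bullet> \<xi> = 0 \<longleftrightarrow> T \<bullet>\<bullet> \<xi> = 0" for \<xi>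
    proof
      assume "(adj v * v) \<bullet>\<bullet> \<xi> = 0"
      then have "S \<bullet>\<bullet> \<xi> = 0"
        using arg_cong[OF SP, of "\<lambda>X. X \<bullet>\<bullet> \<xi>"] by (simp add: P_def bop_simps)
      then show "T \<bullet>\<bullet> \<xi> = 0" by (rule kerT)
    next
      assume "T \<bullet>\<bullet> \<xi> = 0"
      then have "S \<bullet>\<bullet> \<xi> = 0" by (simp add: S_def bop_simps)
      then show "(adj v * v) \<bullet>\<bullet> \<xi> = 0"
        by (simp add: bop_simps ker_v)
    qed
    show "c * v = v * c" if c: "c * T = T * c" "c * adj T = adj T * c" for c
    proof (rule bop_eqI)
      fix \<xi>
      have "c * S = S * c"
        unfolding S_def by (metis c mult.assoc)
      then have "c * G n = G n * c" for n
        unfolding G_def using cfc_commute[OF S] cont(1) K_def by blast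
      then have "c * V n = V n * c" for n
        unfolding V_def by (metis c(1) mult.assoc)
      then have "c \<bullet>\<bullet> (V n \<bullet>\<bullet> \<xi>) = V n \<bullet>\<bullet> (c \<bullet>\<bullet> \<xi>)" for n
        by (metis bop_apply_simps(1))
      then have "(\<lambda>n. V n \<bullet>\<bullet> (c \<bullet>\<bullet> \<xi>)) \<longlonglongrightarrow> c \<bullet>\<bullet> (v \<bullet>\<bullet> \<xi>)"
        using bounded_linear.tendsto[OF bounded_linear_bop_apply v, of c \<xi>] by simp
      then show "(c * v) \<bullet>\<bullet> \<xi> = (v * c) \<bullet>\<bullet> \<xi>"
        using v[of "c \<bullet>\<bullet> \<xi>"] LIMSEQ_unique by (auto simp: bop_simps)
    qed
    show "q * v = v" if q: "q * T = T" for q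
    proof (rule bop_eqI)
      fix \<xi>
      have "q * V n = V n" for n
        unfolding V_def by (metis q mult.assoc)
      then have "q \<bullet>\<bullet> (V n \<bullet>\<bullet> \<xi>) = V n \<bullet>\<bullet> \<xi>" for n
        by (metis bop_apply_simps(1))
      then have "(\<lambda>n. V n \<bullet>\<bullet> \<xi>) \<longlonglongrightarrow> q \<bullet>\<bullet> (v \<bullet>\<bullet> \<xi>)"
        using bounded_linear.tendsto[OF bounded_linear_bop_apply v, of q \<xi>] by simp
      then show "(q * v) \<bullet>\<bullet> \<xi> = v \<bullet>\<bullet> \<xi>"
        using v[of \<xi>] LIMSEQ_unique by (auto simp: bop_simps)
    qed
    show "\<exists>\<eta>. norm ((adj v * v) \<bullet>\<bullet> \<xi> - adj T \<bullet>\<bullet> \<eta>) < e" if e: "0 < e" for \<xi> e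
    proof -
      \<comment> \<open>The operators \<open>cfc (k n) S\<close> converge strongly to
        \<open>P\<close>, and each is \<open>S = adj T * T\<close> times another operator, so its
        values lie in the range of \<open>adj T\<close>.\<close>
      have "(norm (P \<bullet>\<bullet> \<xi> - cfc (k n) S \<bullet>\<bullet> \<xi>))\<^sup>2 \<le> inner (P \<bullet>\<bullet> \<xi>) \<xi> - a n \<xi>" for n
      proof -
        define L where "L = cfc (k n) S"
        have "P * L = L"
          unfolding L_def kS(2) by (simp add: PS flip: mult.assoc)
        then have PL: "inner (L \<bullet>\<bullet> \<xi>) (P \<bullet>\<bullet> \<xi>) = a n \<xi>"
          using inner_self_adjoint[OF P, of "L \<bullet>\<bullet> \<xi>" \<xi>]
          by (simp add: a_def L_def flip: bop_apply_simps(1))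
        have L: "self_adjoint L"
          unfolding L_def by (rule self_adjoint_cfc[OF S cont(2)[unfolded K_def]])
        have "(norm (L \<bullet>\<bullet> \<xi>))\<^sup>2 = inner (cfc (\<lambda>t. k n t * k n t) S \<bullet>\<bullet> \<xi>) \<xi>"
          using inner_square_nonneg[OF L, of \<xi>] by (simp add: L_def C(1)[OF cont(2) cont(2)])
        also have "\<dots> \<le> a n \<xi>"
          unfolding a_def
        proof (rule cfc_inner_mono[OF S, folded K_def])
          show "k n t * k n t \<le> k n t" if "t \<in> K" for t
            using tpos[OF that, of n] pos[OF that] \<epsilon>[of n] by (intro mult_left_le) (simp_all add: k_def)
        qed (intro continuous_intros cont)+
        finally have "(norm (L \<bullet>\<bullet> \<xi>))\<^sup>2 \<le> a n \<xi>" .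
        moreover have "(norm (P \<bullet>\<bullet> \<xi>))\<^sup>2 = inner (P \<bullet>\<bullet> \<xi>) \<xi>"
          using projection_inner[OF proj] by (simp add: P_def)
        moreover have "(norm (P \<bullet>\<bullet> \<xi> - L \<bullet>\<bullet> \<xi>))\<^sup>2 =
            (norm (P \<bullet>\<bullet> \<xi>))\<^sup>2 - 2 * inner (L \<bullet>\<bullet> \<xi>) (P \<bullet>\<bullet> \<xi>) + (norm (L \<bullet>\<bullet> \<xi>))\<^sup>2"
          by (simp add: power2_norm_eq_inner inner_diff inner_commute)
        ultimately show ?thesis using PL by (simp add: L_def)
      qed
      moreover have "\<forall>\<^sub>F n in sequentially. inner (P \<bullet>\<bullet> \<xi>) \<xi> - a n \<xi> < e\<^sup>2"
      proof (rule order_tendstoD(2))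
        show "(\<lambda>n. inner (P \<bullet>\<bullet> \<xi>) \<xi> - a n \<xi>) \<longlonglongrightarrow> inner (P \<bullet>\<bullet> \<xi>) \<xi> - inner (P \<bullet>\<bullet> \<xi>) \<xi>"
          by (intro tendsto_intros a_lim)
      qed (use e in simp)
      ultimately obtain n where "(norm (P \<bullet>\<bullet> \<xi> - cfc (k n) S \<bullet>\<bullet> \<xi>))\<^sup>2 < e\<^sup>2"
        using le_less_trans by (fastforce dest: eventually_happens)
      then have "norm (P \<bullet>\<bullet> \<xi> - cfc (k n) S \<bullet>\<bullet> \<xi>) < e"
        using e by (simp add: power_less_imp_less_base)
      then have "norm (P \<bullet>\<bullet> \<xi> - adj T \<bullet>\<bullet> (T \<bullet>\<bullet> (cfc (\<lambda>t. g n t * g n t) S \<bullet>\<bullet> \<xi>))) < e"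
        unfolding kS(2) by (simp add: S_def bop_simps)
      then show ?thesis unfolding P_def by blast
    qed
  qed
qed


text \<open>At the vector \<open>q \<xi>\<close> the second form already uses up the whole squared
  norm, leaving nothing for \<open>p\<close>.\<close>

lemma orthogonal_projectionsI:
  assumes p: "projection p" and q: "projection q"
    and le: "\<And>\<xi>. inner (p \<bullet>\<bullet> \<xi>) \<xi> + inner (q \<bullet>\<bullet> \<xi>) \<xi> \<le> (norm \<xi>)\<^sup>2"
  shows "p * q = 0"
proof (rule bop_eqI)
  fix \<xi>
  have "(norm (p \<bullet>\<bullet> (q \<bullet>\<bullet> \<xi>)))\<^sup>2 \<le> 0"
    using le[of "q \<bullet>\<bullet> \<xi>"]
    by (simp add: projection_inner p q projection_idem power2_norm_eq_inner[of "q \<bullet>\<bullet> \<xi>"])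
  then show "(p * q) \<bullet>\<bullet> \<xi> = 0 \<bullet>\<bullet> \<xi>"
    by (simp add: bop_simps)
qed

lemma projection_sums:
  fixes P :: "nat \<Rightarrow> 'h::chilbert_space bop"
  assumes P: "\<And>n. projection (P n)" and orth: "\<And>i j. i \<noteq> j \<Longrightarrow> P i * P j = 0"
  obtains W where "projection W" "\<And>\<xi>. (\<lambda>n. P n \<bullet>\<bullet> \<xi>) sums (W \<bullet>\<bullet> \<xi>)"
proof -
  define V where "V n = (\<Sum>i<n. P i)" for n
  have VP: "V n * P k = (if k < n then P k else 0)" "P k * V n = (if k < n then P k else 0)" for k n
    by (induction n)
      (auto simp: V_def distrib_left distrib_right orth less_Suc_eq P[unfolded projection_def])
  have VV: "V m * V n = V m" if "m \<le> n" for m n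
    using that by (induction m) (auto simp: V_def distrib_right VP(2)[unfolded V_def])
  have adjV: "adj (V n) = V n" for n
    by (induction n) (use P in \<open>auto simp: V_def adj_add projection_def\<close>)
  have V: "projection (V n)" for n
    using VV adjV by (simp add: projection_def)
  have Vx: "V n \<bullet>\<bullet> \<xi> = (\<Sum>i<n. P i \<bullet>\<bullet> \<xi>)" for n \<xi>
    by (induction n) (simp_all add: V_def bop_simps)
  have "convergent (\<lambda>n. V n \<bullet>\<bullet> \<xi>)" for \<xi>
  proof (rule convergent_of_monotone_bound)
    fix m n :: nat assume "m \<le> n"
    then have "inner (V n \<bullet>\<bullet> \<xi>) (V m \<bullet>\<bullet> \<xi>) = (norm (V m \<bullet>\<bullet> \<xi>))\<^sup>2"
      using VV[of m n] inner_self_adjoint[OF projection_self_adjoint[OF V], of m "V n \<bullet>\<bullet> \<xi>" \<xi>]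
      by (simp add: projection_inner[OF V] flip: bop_apply_simps(1))
    then show "(norm (V n \<bullet>\<bullet> \<xi> - V m \<bullet>\<bullet> \<xi>))\<^sup>2 \<le> (norm (V n \<bullet>\<bullet> \<xi>))\<^sup>2 - (norm (V m \<bullet>\<bullet> \<xi>))\<^sup>2"
      by (simp add: power2_norm_eq_inner inner_diff inner_commute)
  next
    show "(norm (V n \<bullet>\<bullet> \<xi>))\<^sup>2 \<le> (norm \<xi>)\<^sup>2" for n
      by (intro power_mono projection_norm_le V norm_ge_zero)
  qed
  then obtain W where W: "\<And>\<xi>. (\<lambda>n. V n \<bullet>\<bullet> \<xi>) \<longlonglongrightarrow> W \<bullet>\<bullet> \<xi>"
    using strong_limit_exists[of V 1] projection_norm_le[OF V] by auto
  \<comment> \<open>\<open>V n\<close> fixes the range of \<open>V k\<close> once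
    \<open>k \<le> n\<close>, hence so does the limit \<open>W\<close>; letting \<open>k\<close>
    grow then gives \<open>W * W = W\<close>.\<close>
  have "W * V k = V k" for k
  proof (rule bop_eqI)
    fix \<xi>
    have "\<forall>\<^sub>F n in sequentially. V n \<bullet>\<bullet> (V k \<bullet>\<bullet> \<xi>) = V k \<bullet>\<bullet> \<xi>"
    proof (rule eventually_sequentiallyI)
      fix n assume "k \<le> n"
      then have "V n * V k = V k"
        using VV[of k n] adjV adj_mult by metis
      then show "V n \<bullet>\<bullet> (V k \<bullet>\<bullet> \<xi>) = V k \<bullet>\<bullet> \<xi>"
        by (metis bop_apply_simps(1))
    qed
    then show "(W * V k) \<bullet>\<bullet> \<xi> = V k \<bullet>\<bullet> \<xi>"
      using LIMSEQ_unique[OF W[of "V k \<bullet>\<bullet> \<xi>"] tendsto_eventually] by (simp add: bop_simps)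
  qed
  then have "W \<bullet>\<bullet> (V k \<bullet>\<bullet> \<xi>) = V k \<bullet>\<bullet> \<xi>" for k \<xi>
    by (metis bop_apply_simps(1))
  then have "(\<lambda>k. V k \<bullet>\<bullet> \<xi>) \<longlonglongrightarrow> W \<bullet>\<bullet> (W \<bullet>\<bullet> \<xi>)" for \<xi>
    using bounded_linear.tendsto[OF bounded_linear_bop_apply W, of W \<xi>] by simp
  then have WW: "W \<bullet>\<bullet> (W \<bullet>\<bullet> \<xi>) = W \<bullet>\<bullet> \<xi>" for \<xi>
    using W LIMSEQ_unique by blast
  have "inner (W \<bullet>\<bullet> \<xi>) \<eta> = inner \<xi> (W \<bullet>\<bullet> \<eta>)" for \<xi> \<eta>
  proof (rule LIMSEQ_unique)
    show "(\<lambda>n. inner (V n \<bullet>\<bullet> \<xi>) \<eta>) \<longlonglongrightarrow> inner (W \<bullet>\<bullet> \<xi>) \<eta>"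
      by (intro tendsto_intros W)
    show "(\<lambda>n. inner (V n \<bullet>\<bullet> \<xi>) \<eta>) \<longlonglongrightarrow> inner \<xi> (W \<bullet>\<bullet> \<eta>)"
      unfolding inner_self_adjoint[OF projection_self_adjoint[OF V]] by (intro tendsto_intros W)
  qed
  then have "inner \<xi> (adj W \<bullet>\<bullet> \<eta> - W \<bullet>\<bullet> \<eta>) = 0" for \<xi> \<eta>
    by (simp add: inner_adj inner_diff_right)
  then have "adj W \<bullet>\<bullet> \<eta> - W \<bullet>\<bullet> \<eta> = 0" for \<eta>
    using inner_eq_zero_iff by blast
  then have "adj W = W"
    by (intro bop_eqI) simp
  moreover have "W * W = W"
    by (intro bop_eqI) (simp add: bop_simps WW)
  ultimately have "projection W"
    by (simp add: projection_def)
  moreover have "(\<lambda>n. P n \<bullet>\<bullet> \<xi>) sums (W \<bullet>\<bullet> \<xi>)" for \<xi>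
    using W[of \<xi>] by (simp add: sums_def Vx)
  ultimately show ?thesis by (rule that)
qed

section \<open>Support projections\<close>

text \<open>For self-adjoint \<open>z\<close> this is the projection onto the closure of the range
  of \<open>z\<close>. The description by the kernel makes uniqueness immediate;
  \<open>support_approx\<close> recovers the range.\<close>

definition support :: "'h::chilbert_space bop \<Rightarrow> 'h bop" where
  "support z = (SOME p. projection p \<and> (\<forall>\<xi>. p \<bullet>\<bullet> \<xi> = 0 \<longleftrightarrow> z \<bullet>\<bullet> \<xi> = 0))"

lemma support_eqI:
  assumes "projection p" "\<And>\<xi>. p \<bullet>\<bullet> \<xi> = 0 \<longleftrightarrow> z \<bullet>\<bullet> \<xi> = 0"
  shows "support z = p"
proof -
  have "projection (support z) \<and> (\<forall>\<xi>. support z \<bullet>\<bullet> \<xi> = 0 \<longleftrightarrow> z \<bullet>\<bullet> \<xi> = 0)"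
    unfolding support_def by (rule someI[of _ p]) (use assms in blast)
  then show ?thesis
    using assms by (intro projection_eqI) auto
qed

lemma support:
  fixes z :: "'h::chilbert_space bop"
  assumes z: "self_adjoint z"
  shows projection_support: "projection (support z)"
    and support_apply_eq_zero_iff: "support z \<bullet>\<bullet> \<xi> = 0 \<longleftrightarrow> z \<bullet>\<bullet> \<xi> = 0"
    and support_commute: "c * z = z * c \<Longrightarrow> c * support z = support z * c"
    and support_approx: "0 < e \<Longrightarrow> \<exists>\<eta>. norm (support z \<bullet>\<bullet> \<xi> - z \<bullet>\<bullet> \<eta>) < e"
proof -
  obtain v where v: "projection (adj v * v)" "\<And>\<xi>. (adj v * v) \<bullet>\<bullet> \<xi> = 0 \<longleftrightarrow> z \<bullet>\<bullet> \<xi> = 0"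
    "\<And>c. c * z = z * c \<Longrightarrow> c * adj z = adj z * c \<Longrightarrow> c * v = v * c"
    "\<And>q. q * z = z \<Longrightarrow> q * v = v"
    "\<And>\<xi> e. 0 < e \<Longrightarrow> \<exists>\<eta>. norm ((adj v * v) \<bullet>\<bullet> \<xi> - adj z \<bullet>\<bullet> \<eta>) < e"
    by (rule polar_decomposition[of z]) (rule that)
  have adj_z: "adj z = z"
    using z by (simp add: self_adjoint_def)
  have eq: "support z = adj v * v"
    by (rule support_eqI[OF v(1,2)])
  show "projection (support z)" "support z \<bullet>\<bullet> \<xi> = 0 \<longleftrightarrow> z \<bullet>\<bullet> \<xi> = 0"
    using v(1,2) by (simp_all add: eq)
  show "\<exists>\<eta>. norm (support z \<bullet>\<bullet> \<xi> - z \<bullet>\<bullet> \<eta>) < e" if "0 < e"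
    using v(5)[OF that] by (simp add: eq adj_z)
  show "c * support z = support z * c" if c: "c * z = z * c"
  proof -
    \<comment> \<open>Commutation of \<open>c\<close> with \<open>adj v\<close> is obtained by
      taking adjoints, so it must be started from \<open>adj c\<close>, which need not equal
      \<open>c\<close>.\<close>
    have "adj c * z = z * adj c"
      using c adj_z by (metis adj_mult)
    then have "adj c * v = v * adj c"
      by (intro v(3)) (simp_all add: adj_z)
    then have 1: "adj v * c = c * adj v"
      by (metis adj_mult adj_adj)
    have 2: "c * v = v * c"
      using c by (intro v(3)) (simp_all add: adj_z)
    have "c * (adj v * v) = adj v * (c * v)"
      by (simp only: 1[symmetric] flip: mult.assoc)
    also have "\<dots> = adj v * v * c"
      by (simp only: 2 mult.assoc)
    finally have "c * (adj v * v) = adj v * v * c" .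
    then show ?thesis by (simp add: eq)
  qed
qed

lemma support_mult_self:
  assumes "self_adjoint z"
  shows "support z * z = z" "z * support z = z"
proof -
  have "support z \<bullet>\<bullet> (\<xi> - support z \<bullet>\<bullet> \<xi>) = 0" for \<xi>
    by (simp add: bop_simps projection_idem projection_support[OF assms])
  then have "z \<bullet>\<bullet> (\<xi> - support z \<bullet>\<bullet> \<xi>) = 0" for \<xi>
    by (simp only: support_apply_eq_zero_iff[OF assms])
  then show "z * support z = z"
    by (intro bop_eqI) (simp add: bop_simps)
  then show "support z * z = z"
    using assms projection_support[OF assms] adj_mult[of z "support z"]
    by (simp add: self_adjoint_def projection_def)
qed

text \<open>This characterises the spectral projection of \<open>y\<close> for the half-line \<open>(\<alpha>, \<infinity>)\<close>.\<close>

definition upper_projection :: "'h::chilbert_space bop \<Rightarrow> real \<Rightarrow> 'h bop \<Rightarrow> bool" where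
  "upper_projection y \<alpha> p \<longleftrightarrow> projection p \<and> p * y = y * p \<and>
     (\<forall>\<xi>. p \<bullet>\<bullet> \<xi> = \<xi> \<and> \<xi> \<noteq> 0 \<longrightarrow> \<alpha> * (norm \<xi>)\<^sup>2 < inner (y \<bullet>\<bullet> \<xi>) \<xi>) \<and>
     (\<forall>\<xi>. p \<bullet>\<bullet> \<xi> = 0 \<longrightarrow> inner (y \<bullet>\<bullet> \<xi>) \<xi> \<le> \<alpha> * (norm \<xi>)\<^sup>2)"

lemma upper_projection_gt:
  "upper_projection y \<alpha> p \<Longrightarrow> p \<bullet>\<bullet> \<xi> = \<xi> \<Longrightarrow> \<xi> \<noteq> 0 \<Longrightarrow> \<alpha> * (norm \<xi>)\<^sup>2 < inner (y \<bullet>\<bullet> \<xi>) \<xi>"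
  unfolding upper_projection_def by blast

lemma upper_projection_le:
  "upper_projection y \<alpha> p \<Longrightarrow> p \<bullet>\<bullet> \<xi> = 0 \<Longrightarrow> inner (y \<bullet>\<bullet> \<xi>) \<xi> \<le> \<alpha> * (norm \<xi>)\<^sup>2"
  unfolding upper_projection_def by blast

text \<open>If \<open>p \<xi> = 0\<close>, then by commutation \<open>q \<xi>\<close> is both in the
  kernel of \<open>p\<close> and in the range of \<open>q\<close>; there the two form inequalities
  contradict each other unless the vector is 0.\<close>

lemma upper_projection_unique:
  assumes p: "upper_projection y \<alpha> p" and q: "upper_projection y \<alpha> q" and pq: "p * q = q * p"
  shows "p = q"
proof (rule projection_eqI)
  have com: "p \<bullet>\<bullet> (q \<bullet>\<bullet> \<xi>) = q \<bullet>\<bullet> (p \<bullet>\<bullet> \<xi>)" for \<xi>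
    using pq by (metis bop_apply_simps(1))
  show proj: "projection p" "projection q"
    using p q by (auto simp: upper_projection_def)
  have no: "\<xi> = 0" if "r \<bullet>\<bullet> \<xi> = 0" "s \<bullet>\<bullet> \<xi> = \<xi>" "upper_projection y \<alpha> r" "upper_projection y \<alpha> s" for r s \<xi>
    using upper_projection_gt[OF that(4,2)] upper_projection_le[OF that(3,1)] by linarith
  show "p \<bullet>\<bullet> \<xi> = 0 \<longleftrightarrow> q \<bullet>\<bullet> \<xi> = 0" for \<xi>
  proof
    assume "p \<bullet>\<bullet> \<xi> = 0"
    then show "q \<bullet>\<bullet> \<xi> = 0"
      using no[of p "q \<bullet>\<bullet> \<xi>" q] p q by (simp add: com bop_simps projection_idem proj)
  next
    assume "q \<bullet>\<bullet> \<xi> = 0"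
    then show "p \<bullet>\<bullet> \<xi> = 0"
      using no[of q "p \<bullet>\<bullet> \<xi>" p] p q by (simp add: com[symmetric] bop_simps projection_idem proj)
  qed
qed

text \<open>Split \<open>f - \<alpha>\<close> into its positive and negative parts, giving
  \<open>u\<close> and \<open>w\<close> with \<open>u * w = 0\<close>. Then \<open>w\<close>
  vanishes on the range of the support of \<open>u\<close>. Strictness holds because
  \<open>u\<close>, being a square, kills every vector at which its form is 0.\<close>

lemma upper_projection_cfc:
  fixes x :: "'h::chilbert_space bop"
  assumes x: "self_adjoint x" and f: "continuous_on (Re ` spectrum x) f"
  shows "upper_projection (cfc f x) \<alpha> (support (cfc (\<lambda>t. max (f t - \<alpha>) 0) x))"
proof -
  define y where "y = cfc f x"
  define u where "u = cfc (\<lambda>t. max (f t - \<alpha>) 0) x"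
  define w where "w = cfc (\<lambda>t. max (\<alpha> - f t) 0) x"
  have cont: "continuous_on (Re ` spectrum x) (\<lambda>t. max (f t - \<alpha>) 0)"
    "continuous_on (Re ` spectrum x) (\<lambda>t. max (\<alpha> - f t) 0)"
    "continuous_on (Re ` spectrum x) (\<lambda>t. f t - \<alpha>)"
    by (intro continuous_intros f)+
  have sa: "self_adjoint u" "self_adjoint w"
    unfolding u_def w_def by (intro self_adjoint_cfc x cont)+
  have pos: "positive u" "positive w"
    unfolding u_def w_def by (intro positive_cfc x cont; simp)+
  have "y - \<alpha> *\<^sub>R 1 = cfc (\<lambda>t. f t - \<alpha>) x"
    by (simp add: y_def cfc_diff[OF x f] cfc_const[OF x])
  also have "\<dots> = cfc (\<lambda>t. max (f t - \<alpha>) 0 - max (\<alpha> - f t) 0) x"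
    by (rule cfc_cong[OF x cont(3)]) (simp add: max_def)
  also have "\<dots> = u - w"
    unfolding u_def w_def by (rule cfc_diff[OF x cont(1,2)])
  finally have y: "y = \<alpha> *\<^sub>R 1 + u - w"
    by (simp add: algebra_simps)
  have "u * w = cfc (\<lambda>t. max (f t - \<alpha>) 0 * max (\<alpha> - f t) 0) x"
    unfolding u_def w_def by (rule cfc_mult[OF x cont(1,2), symmetric])
  also have "(\<lambda>t. max (f t - \<alpha>) 0 * max (\<alpha> - f t) 0) = (\<lambda>t. 0)"
    by (auto simp: max_def)
  finally have uw: "u * w = 0"
    by (simp add: cfc_const[OF x])
  then have wu: "w * u = 0"
    using sa adj_mult[of u w] by (simp add: self_adjoint_def)
  define p where "p = support u"
  note p = support[OF sa(1), folded p_def]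
  have "p * w = 0"
    by (rule bop_eqI) (use arg_cong[OF uw, of "\<lambda>X. X \<bullet>\<bullet> _"] in \<open>simp add: bop_simps p(2)\<close>)
  then have wp: "w * p = 0"
    using sa p(1) adj_mult[of p w] by (simp add: self_adjoint_def projection_def)
  have form: "inner (y \<bullet>\<bullet> \<xi>) \<xi> = \<alpha> * (norm \<xi>)\<^sup>2 + inner (u \<bullet>\<bullet> \<xi>) \<xi> - inner (w \<bullet>\<bullet> \<xi>) \<xi>" for \<xi>
    unfolding y by (simp add: bop_simps inner_add_left inner_diff_left power2_norm_eq_inner)
  have "upper_projection y \<alpha> p"
    unfolding upper_projection_def
  proof (intro conjI allI impI)
    show "projection p" by (rule p)
    have "y * u = u * y"
      unfolding y by (simp add: distrib_left distrib_right left_diff_distrib right_diff_distrib uw wu)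
    then show "p * y = y * p"
      using p(3) by simp
    fix \<xi>
    show "inner (y \<bullet>\<bullet> \<xi>) \<xi> \<le> \<alpha> * (norm \<xi>)\<^sup>2" if "p \<bullet>\<bullet> \<xi> = 0"
      using that positive_inner_nonneg[OF pos(2), of \<xi>] by (simp add: form p(2))
    show "\<alpha> * (norm \<xi>)\<^sup>2 < inner (y \<bullet>\<bullet> \<xi>) \<xi>" if "p \<bullet>\<bullet> \<xi> = \<xi> \<and> \<xi> \<noteq> 0"
    proof -
      have "w \<bullet>\<bullet> \<xi> = 0"
        using arg_cong[OF wp, of "\<lambda>X. X \<bullet>\<bullet> \<xi>"] that by (simp add: bop_simps)
      moreover have "inner (u \<bullet>\<bullet> \<xi>) \<xi> \<noteq> 0"
      proof
        assume 0: "inner (u \<bullet>\<bullet> \<xi>) \<xi> = 0"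
        obtain s where "self_adjoint s" "u = s * s"
          using positive_sqrt[OF pos(1)] by blast
        then have "u \<bullet>\<bullet> \<xi> = 0"
          using 0 inner_square_nonneg[of s \<xi>] by (simp add: bop_simps)
        then show False using p(2)[of \<xi>] that by simp
      qed
      ultimately show ?thesis
        using positive_inner_nonneg[OF pos(1), of \<xi>] by (simp add: form)
    qed
  qed
  then show ?thesis by (simp add: y_def p_def u_def)
qed

section \<open>Spectral measures\<close>

lemma cinner_self_adjoint:
  fixes T :: "'h::chilbert_space bop"
  assumes "self_adjoint T"
  shows "cinner (T \<bullet>\<bullet> \<xi>) \<xi> = complex_of_real (inner (T \<bullet>\<bullet> \<xi>) \<xi>)"
proof -
  have "cinner (T \<bullet>\<bullet> \<xi>) \<xi> = cinner \<xi> (T \<bullet>\<bullet> \<xi>)"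
    using assms by (simp add: cinner_adj self_adjoint_def)
  also have "\<dots> = cnj (cinner (T \<bullet>\<bullet> \<xi>) \<xi>)"
    by (rule cinner_commute)
  finally have "Im (cinner (T \<bullet>\<bullet> \<xi>) \<xi>) = 0"
    by (simp add: complex_eq_iff)
  then show ?thesis
    by (simp add: complex_eq_iff Re_cinner)
qed

section \<open>Scalar measures of a given spectral measure\<close>

lemma sigma_sets_borel: "sigma_sets UNIV (sets borel) = (sets borel :: real set set)"
  using sets.sigma_sets_eq[of "borel :: real measure"] by simp

lemma sets_scalar_measure [simp, measurable_cong]: "sets (scalar_measure E \<xi>) = sets borel"
  unfolding scalar_measure_def by (simp add: sets_measure_of sigma_sets_borel)

lemma space_scalar_measure [simp]: "space (scalar_measure E \<xi>) = UNIV"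
  unfolding scalar_measure_def by (simp add: space_measure_of)

lemma scalar_measure_eqI:
  assumes "sets N = sets borel"
    and "\<And>S. S \<in> sets borel \<Longrightarrow> emeasure N S = ennreal (inner (E S \<bullet>\<bullet> \<xi>) \<xi>)"
  shows "scalar_measure E \<xi> = N"
proof -
  have "scalar_measure E \<xi> = measure_of UNIV (sets borel) (emeasure N)"
    unfolding scalar_measure_def
    by (rule measure_of_eq) (simp_all add: sigma_sets_borel Re_cinner assms(2))
  then show ?thesis
    using measure_of_of_measure[of N] assms(1) sets_eq_imp_space_eq[OF assms(1)] by simp
qed

context
  fixes y :: "'h::chilbert_space bop" and E :: "real set \<Rightarrow> 'h bop"
  assumes E: "spectral_measure y E"
begin

lemma spectral_measure_projection: "S \<in> sets borel \<Longrightarrow> projection (E S)"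
  using E by (simp add: spectral_measure_def)

lemma spectral_measure_UNIV: "E UNIV = 1"
  using E by (simp add: spectral_measure_def)

lemma spectral_measure_sums:
  assumes "range A \<subseteq> sets borel" "disjoint_family A"
  shows "(\<lambda>n. E (A n) \<bullet>\<bullet> \<xi>) sums (E (\<Union>n. A n) \<bullet>\<bullet> \<xi>)"
  using E[unfolded spectral_measure_def, THEN conjunct2, THEN conjunct2, THEN conjunct1, rule_format, of A \<xi>]
    assms by blast

lemma spectral_measure_empty: "E {} = 0"
proof (rule bop_eqI)
  fix \<xi>
  have "(\<lambda>n::nat. E {} \<bullet>\<bullet> \<xi>) sums (E (\<Union>n::nat. {}) \<bullet>\<bullet> \<xi>)"
    by (rule spectral_measure_sums) (auto simp: disjoint_family_on_def)
  then have "(\<lambda>n::nat. E {} \<bullet>\<bullet> \<xi>) \<longlonglongrightarrow> 0"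
    by (intro summable_LIMSEQ_zero sums_summable)
  then show "E {} \<bullet>\<bullet> \<xi> = 0 \<bullet>\<bullet> \<xi>"
    by (simp add: LIMSEQ_const_iff bop_simps)
qed

lemma spectral_measure_Un:
  assumes "A \<in> sets borel" "B \<in> sets borel" "A \<inter> B = {}"
  shows "E (A \<union> B) = E A + E B"
proof (rule bop_eqI)
  fix \<xi>
  have "(\<lambda>n. E (binaryset A B n) \<bullet>\<bullet> \<xi>) sums (E (\<Union>n. binaryset A B n) \<bullet>\<bullet> \<xi>)"
    using assms by (intro spectral_measure_sums)
      (auto simp: range_binaryset_eq, auto simp: disjoint_family_on_def binaryset_def)
  moreover have "(\<lambda>n. E (binaryset A B n) \<bullet>\<bullet> \<xi>) sums (E A \<bullet>\<bullet> \<xi> + E B \<bullet>\<bullet> \<xi>)"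
    by (rule binaryset_sums[where f = "\<lambda>S. E S \<bullet>\<bullet> \<xi>"]) (simp add: spectral_measure_empty bop_simps)
  ultimately show "E (A \<union> B) \<bullet>\<bullet> \<xi> = (E A + E B) \<bullet>\<bullet> \<xi>"
    using sums_unique2 by (fastforce simp: UN_binaryset_eq bop_simps)
qed

text \<open>Multiplicativity is not an axiom of \<open>spectral_measure\<close>. It comes from
  additivity: two projections whose sum is a projection have forms adding up to at most the squared
  norm, so they are orthogonal.\<close>

lemma spectral_measure_disjoint:
  assumes "A \<in> sets borel" "B \<in> sets borel" "A \<inter> B = {}"
  shows "E A * E B = 0"
proof (rule orthogonal_projectionsI)
  fix \<xi>
  have "inner (E A \<bullet>\<bullet> \<xi>) \<xi> + inner (E B \<bullet>\<bullet> \<xi>) \<xi> = inner (E (A \<union> B) \<bullet>\<bullet> \<xi>) \<xi>"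
    using spectral_measure_Un[OF assms] by (simp add: bop_simps inner_add_left)
  also have "\<dots> = (norm (E (A \<union> B) \<bullet>\<bullet> \<xi>))\<^sup>2"
    using assms by (intro projection_inner spectral_measure_projection) auto
  also have "\<dots> \<le> (norm \<xi>)\<^sup>2"
    using assms by (intro power_mono projection_norm_le spectral_measure_projection) auto
  finally show "inner (E A \<bullet>\<bullet> \<xi>) \<xi> + inner (E B \<bullet>\<bullet> \<xi>) \<xi> \<le> (norm \<xi>)\<^sup>2" .
qed (use assms spectral_measure_projection in auto)

lemma spectral_measure_Int:
  assumes A: "A \<in> sets borel" and B: "B \<in> sets borel"
  shows "E A * E B = E (A \<inter> B)"
proof -
  have AB: "A \<inter> B \<in> sets borel" "A - B \<in> sets borel" "B - A \<in> sets borel"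
    using assms by auto
  have "E A = E (A \<inter> B) + E (A - B)"
    using spectral_measure_Un[OF AB(1,2)] by (simp add: Int_Diff_Un Int_Diff_disjoint)
  moreover have "E B = E (A \<inter> B) + E (B - A)"
    using spectral_measure_Un[OF AB(1,3)] by (simp add: Int_commute[of A] Int_Diff_Un Int_Diff_disjoint)
  moreover have "E (A - B) * E (A \<inter> B) = 0" "E (A \<inter> B) * E (B - A) = 0" "E (A - B) * E (B - A) = 0"
    by (intro spectral_measure_disjoint AB; blast)+
  ultimately show ?thesis
    using spectral_measure_projection[OF AB(1)] by (simp add: distrib_left distrib_right projection_def)
qed

lemma emeasure_scalar_measure:
  assumes S: "S \<in> sets borel"
  shows "emeasure (scalar_measure E \<xi>) S = ennreal (inner (E S \<bullet>\<bullet> \<xi>) \<xi>)"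
proof -
  have nonneg: "0 \<le> inner (E A \<bullet>\<bullet> \<xi>) \<xi>" if "A \<in> sets borel" for A
    using projection_inner[OF spectral_measure_projection[OF that]] by simp
  have "emeasure (scalar_measure E \<xi>) S = ennreal (Re (cinner (E S \<bullet>\<bullet> \<xi>) \<xi>))"
  proof (rule emeasure_measure_of[OF scalar_measure_def])
    show "Sigma_Algebra.positive (sets (scalar_measure E \<xi>)) (\<lambda>S. ennreal (Re (cinner (E S \<bullet>\<bullet> \<xi>) \<xi>)))"
      by (simp add: Sigma_Algebra.positive_def spectral_measure_empty bop_simps Re_cinner)
    show "countably_additive (sets (scalar_measure E \<xi>)) (\<lambda>S. ennreal (Re (cinner (E S \<bullet>\<bullet> \<xi>) \<xi>)))"
    proof (rule countably_additiveI)
      fix A :: "nat \<Rightarrow> real set"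
      assume A: "range A \<subseteq> sets (scalar_measure E \<xi>)" "disjoint_family A"
      then have "(\<lambda>n. inner (E (A n) \<bullet>\<bullet> \<xi>) \<xi>) sums inner (E (\<Union>n. A n) \<bullet>\<bullet> \<xi>) \<xi>"
        by (intro bounded_linear.sums[OF bounded_linear_inner_left] spectral_measure_sums) auto
      then show "(\<Sum>i. ennreal (Re (cinner (E (A i) \<bullet>\<bullet> \<xi>) \<xi>))) = ennreal (Re (cinner (E (\<Union>i. A i) \<bullet>\<bullet> \<xi>) \<xi>))"
        using A nonneg by (simp add: Re_cinner) (intro suminf_ennreal_eq; auto)
    qed
  qed (use S in auto)
  then show ?thesis by (simp add: Re_cinner)
qed

lemma finite_scalar_measure: "finite_measure (scalar_measure E \<xi>)"
  by (rule finite_measureI) (simp add: emeasure_scalar_measure)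

lemma measure_scalar_measure_UNIV: "measure (scalar_measure E \<xi>) UNIV = (norm \<xi>)\<^sup>2"
  by (simp add: measure_def emeasure_scalar_measure spectral_measure_UNIV bop_simps power2_norm_eq_inner)

lemma AE_scalar_measure:
  assumes "S \<in> sets borel" "E S \<bullet>\<bullet> \<xi> = \<xi>"
  shows "AE t in scalar_measure E \<xi>. t \<in> S"
proof (rule AE_I[of _ _ "- S"])
  have "E S + E (- S) = 1"
    using spectral_measure_Un[of S "- S"] assms(1) by (simp add: spectral_measure_UNIV)
  then have "E S \<bullet>\<bullet> \<xi> + E (- S) \<bullet>\<bullet> \<xi> = \<xi>"
    by (simp flip: bop_apply_simps(3)) (simp add: bop_simps)
  then have "E (- S) \<bullet>\<bullet> \<xi> = 0"
    using assms(2) by simp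
  then show "emeasure (scalar_measure E \<xi>) (- S) = 0"
    using assms(1) by (simp add: emeasure_scalar_measure borel_comp)
qed (use assms(1) in auto)

lemma integrable_scalar_measure: "integrable (scalar_measure E \<xi>) (\<lambda>t. t)"
proof -
  interpret finite_measure "scalar_measure E \<xi>"
    by (rule finite_scalar_measure)
  obtain R where "E {-R..R} = 1"
    using E by (auto simp: spectral_measure_def)
  then have "AE t in scalar_measure E \<xi>. t \<in> {-R..R}"
    by (intro AE_scalar_measure) (auto simp: bop_simps)
  then have "AE t in scalar_measure E \<xi>. norm t \<le> R"
    by eventually_elim auto
  then show ?thesis
    by (rule integrable_const_bound) measurable
qed

lemma integral_scalar_measure: "(\<integral>t. t \<partial>scalar_measure E \<xi>) = inner (y \<bullet>\<bullet> \<xi>) \<xi>"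
proof -
  have "cinner (y \<bullet>\<bullet> \<xi>) \<xi> = complex_of_real (\<integral>t. t \<partial>scalar_measure E \<xi>)"
    using E by (simp add: spectral_measure_def)
  then show ?thesis
    by (metis Re_cinner Re_complex_of_real)
qed

text \<open>Rests on multiplicativity in the form
  \<open>E S * (E T * E S) = E (T \<inter> S)\<close>. It localises the integral representing
  \<open>y\<close> to a Borel set.\<close>

lemma scalar_measure_apply:
  assumes S: "S \<in> sets borel"
  shows "scalar_measure E (E S \<bullet>\<bullet> \<xi>) = density (scalar_measure E \<xi>) (indicator S)"
proof (rule measure_eqI)
  fix T assume "T \<in> sets (scalar_measure E (E S \<bullet>\<bullet> \<xi>))"
  then have T: "T \<in> sets borel" by simp
  have "E S * (E T * E S) = E (T \<inter> S)"
    using spectral_measure_Int[OF T S] spectral_measure_Int[OF S, of "T \<inter> S"] S T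
    by (simp add: Int_left_commute Int_commute)
  then have "inner (E T \<bullet>\<bullet> (E S \<bullet>\<bullet> \<xi>)) (E S \<bullet>\<bullet> \<xi>) = inner (E (T \<inter> S) \<bullet>\<bullet> \<xi>) \<xi>"
    using inner_self_adjoint[OF projection_self_adjoint[OF spectral_measure_projection[OF S]],
        of "E T \<bullet>\<bullet> (E S \<bullet>\<bullet> \<xi>)" \<xi>]
    by (simp flip: bop_apply_simps(1))
  moreover have "emeasure (density (scalar_measure E \<xi>) (indicator S)) T = emeasure (scalar_measure E \<xi>) (T \<inter> S)"
    using S T by (subst emeasure_density) (auto simp: nn_integral_indicator indicator_inter_arith[symmetric] Int_commute)
  ultimately show "emeasure (scalar_measure E (E S \<bullet>\<bullet> \<xi>)) T = emeasure (density (scalar_measure E \<xi>) (indicator S)) T"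
    using S T by (simp add: emeasure_scalar_measure)
qed simp

text \<open>\<open>y\<close> is tied to \<open>E\<close> only through its quadratic form. Splitting
  the integral over \<open>S\<close> and its complement shows that \<open>y\<close> and its
  block-diagonal part with respect to \<open>p\<close> have the same form, hence are equal.\<close>

lemma spectral_measure_commute:
  assumes S: "S \<in> sets borel" and y: "self_adjoint y"
  shows "E S * y = y * E S"
proof -
  define p where "p = E S"
  have p: "projection p"
    unfolding p_def by (rule spectral_measure_projection[OF S])
  have S': "- S \<in> sets borel"
    using S by (simp add: borel_comp)
  have compl: "E (- S) = 1 - p"
    using spectral_measure_Un[OF S S'] by (simp add: p_def spectral_measure_UNIV eq_diff_eq add.commute)
  have part: "inner (y \<bullet>\<bullet> (E T \<bullet>\<bullet> \<xi>)) (E T \<bullet>\<bullet> \<xi>) = (\<integral>t. indicator T t * t \<partial>scalar_measure E \<xi>)"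
    if T: "T \<in> sets borel" for T \<xi>
  proof -
    have "inner (y \<bullet>\<bullet> (E T \<bullet>\<bullet> \<xi>)) (E T \<bullet>\<bullet> \<xi>) = (\<integral>t. t \<partial>density (scalar_measure E \<xi>) (\<lambda>t. ennreal (indicator T t)))"
      using integral_scalar_measure[of "E T \<bullet>\<bullet> \<xi>"] scalar_measure_apply[OF T, of \<xi>]
      by (simp add: ennreal_indicator)
    also have "\<dots> = (\<integral>t. indicator T t *\<^sub>R t \<partial>scalar_measure E \<xi>)"
      using T by (intro integral_density) auto
    finally show ?thesis by simp
  qed
  have integrable: "integrable (scalar_measure E \<xi>) (\<lambda>t. indicator T t * t)" if "T \<in> sets borel" for T \<xi>
    using integrable_mult_indicator[OF _ integrable_scalar_measure, of T \<xi>] that by simp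
  have "y = p * y * p + (1 - p) * y * (1 - p)"
  proof (rule self_adjoint_eqI[OF y])
    show "self_adjoint (p * y * p + (1 - p) * y * (1 - p))"
      using p y by (simp add: self_adjoint_def projection_def adj_add adj_mult adj_diff mult.assoc)
    fix \<xi>
    have "inner (y \<bullet>\<bullet> \<xi>) \<xi> = (\<integral>t. indicator S t * t + indicator (- S) t * t \<partial>scalar_measure E \<xi>)"
      unfolding integral_scalar_measure[symmetric]
      by (intro Bochner_Integration.integral_cong refl) (simp add: indicator_def)
    also have "\<dots> = inner (y \<bullet>\<bullet> (p \<bullet>\<bullet> \<xi>)) (p \<bullet>\<bullet> \<xi>) + inner (y \<bullet>\<bullet> ((1 - p) \<bullet>\<bullet> \<xi>)) ((1 - p) \<bullet>\<bullet> \<xi>)"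
      using part[OF S] part[OF S'] integrable[OF S] integrable[OF S']
      by (simp add: compl flip: p_def)
    also have "\<dots> = inner ((p * y * p + (1 - p) * y * (1 - p)) \<bullet>\<bullet> \<xi>) \<xi>"
      using inner_self_adjoint[OF projection_self_adjoint[OF p], of _ \<xi>]
        inner_self_adjoint[OF projection_self_adjoint[OF projection_complement[OF p]], of _ \<xi>]
      by (simp only: bop_apply_simps(1,3) inner_add_left)
    finally show "inner (y \<bullet>\<bullet> \<xi>) \<xi> = inner ((p * y * p + (1 - p) * y * (1 - p)) \<bullet>\<bullet> \<xi>) \<xi>" .
  qed
  then have "p * y = p * (p * y * p + (1 - p) * y * (1 - p))" "y * p = (p * y * p + (1 - p) * y * (1 - p)) * p"
    by simp_all
  moreover have "p * (p * y * p + (1 - p) * y * (1 - p)) = p * y * p"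
    "(p * y * p + (1 - p) * y * (1 - p)) * p = p * y * p"
    using p by (simp_all add: projection_def distrib_left distrib_right left_diff_distrib
        right_diff_distrib mult.assoc[symmetric]) (simp_all add: projection_def mult.assoc)
  ultimately show ?thesis by (simp add: p_def)
qed

lemma upper_projection_spectral_measure:
  assumes y: "self_adjoint y"
  shows "upper_projection y \<alpha> (E {\<alpha><..})"
  unfolding upper_projection_def
proof (intro conjI allI impI)
  show "projection (E {\<alpha><..})" "E {\<alpha><..} * y = y * E {\<alpha><..}"
    by (auto intro: spectral_measure_projection spectral_measure_commute[OF _ y])
  fix \<xi>
  interpret finite_measure "scalar_measure E \<xi>"
    by (rule finite_scalar_measure)
  show "inner (y \<bullet>\<bullet> \<xi>) \<xi> \<le> \<alpha> * (norm \<xi>)\<^sup>2" if "E {\<alpha><..} \<bullet>\<bullet> \<xi> = 0"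
  proof -
    have "E {\<alpha><..} + E {..\<alpha>} = 1"
    proof -
      have "{\<alpha><..} \<union> {..\<alpha>} = UNIV" "{\<alpha><..} \<inter> {..\<alpha>} = {}" by auto
      then show ?thesis
        using spectral_measure_Un[of "{\<alpha><..}" "{..\<alpha>}"] by (simp add: spectral_measure_UNIV)
    qed
    then have "E {\<alpha><..} \<bullet>\<bullet> \<xi> + E {..\<alpha>} \<bullet>\<bullet> \<xi> = \<xi>"
      by (simp flip: bop_apply_simps(3)) (simp add: bop_simps)
    then have "AE t in scalar_measure E \<xi>. t \<in> {..\<alpha>}"
      using that by (intro AE_scalar_measure) auto
    then have "(\<integral>t. t \<partial>scalar_measure E \<xi>) \<le> (\<integral>t. \<alpha> \<partial>scalar_measure E \<xi>)"
      by (intro integral_mono_AE integrable_scalar_measure) (auto elim: eventually_mono)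
    then show ?thesis
      by (simp add: measure_scalar_measure_UNIV integral_scalar_measure mult.commute)
  qed
  show "\<alpha> * (norm \<xi>)\<^sup>2 < inner (y \<bullet>\<bullet> \<xi>) \<xi>" if "E {\<alpha><..} \<bullet>\<bullet> \<xi> = \<xi> \<and> \<xi> \<noteq> 0"
  proof (rule ccontr)
    \<comment> \<open>Then the integral of \<open>t - \<alpha>\<close>, positive almost everywhere,
      would be 0. That makes the measure null, whereas its total mass is the squared norm of
      \<open>\<xi>\<close>.\<close>
    assume le: "\<not> \<alpha> * (norm \<xi>)\<^sup>2 < inner (y \<bullet>\<bullet> \<xi>) \<xi>"
    have AE: "AE t in scalar_measure E \<xi>. t \<in> {\<alpha><..}"
      using that by (intro AE_scalar_measure) auto
    have int: "integrable (scalar_measure E \<xi>) (\<lambda>t. t - \<alpha>)"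
      by (intro Bochner_Integration.integrable_diff integrable_scalar_measure) simp
    have nonneg: "AE t in scalar_measure E \<xi>. 0 \<le> t - \<alpha>"
      using AE by eventually_elim simp
    have "(\<integral>t. t - \<alpha> \<partial>scalar_measure E \<xi>) = inner (y \<bullet>\<bullet> \<xi>) \<xi> - \<alpha> * (norm \<xi>)\<^sup>2"
      using integrable_scalar_measure[of \<xi>]
      by (simp add: measure_scalar_measure_UNIV integral_scalar_measure mult.commute)
    moreover have "0 \<le> (\<integral>t. t - \<alpha> \<partial>scalar_measure E \<xi>)"
      by (rule integral_nonneg_AE[OF nonneg])
    ultimately have "(\<integral>t. t - \<alpha> \<partial>scalar_measure E \<xi>) = 0"
      using le by linarith
    then have "AE t in scalar_measure E \<xi>. t - \<alpha> = 0"
      using integral_nonneg_eq_0_iff_AE[OF int nonneg] by simp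
    with AE have "AE t in scalar_measure E \<xi>. False"
      by eventually_elim simp
    then obtain N where "UNIV \<subseteq> N" "emeasure (scalar_measure E \<xi>) N = 0"
      by (elim AE_E) auto
    then have "measure (scalar_measure E \<xi>) UNIV = 0"
      using top.extremum_unique[of N] by (simp add: measure_def)
    then show False
      using that by (simp add: measure_scalar_measure_UNIV)
  qed
qed

end

section \<open>Half-line projections and their distribution functions\<close>

definition spectral_above :: "'h::chilbert_space bop \<Rightarrow> real \<Rightarrow> 'h bop" where
  "spectral_above y t = support (cfc (\<lambda>s. max (s - t) 0) y)"

definition distr_fun :: "'h::chilbert_space bop \<Rightarrow> 'h \<Rightarrow> real \<Rightarrow> real" where
  "distr_fun y \<xi> t = (norm \<xi>)\<^sup>2 - (norm (spectral_above y t \<bullet>\<bullet> \<xi>))\<^sup>2"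

definition spectral_distr :: "'h::chilbert_space bop \<Rightarrow> 'h \<Rightarrow> real measure" where
  "spectral_distr y \<xi> = interval_measure (distr_fun y \<xi>)"

lemma sets_spectral_distr [simp, measurable_cong]: "sets (spectral_distr y \<xi>) = sets borel"
  by (simp add: spectral_distr_def)

lemma space_spectral_distr [simp]: "space (spectral_distr y \<xi>) = UNIV"
  by (simp add: spectral_distr_def)

context
  fixes y :: "'h::chilbert_space bop"
  assumes y: "self_adjoint y"
begin

lemma upper_projection_above: "upper_projection y t (spectral_above y t)"
  using upper_projection_cfc[OF y continuous_on_id, of t] by (simp add: spectral_above_def cfc_id[OF y])

lemma self_adjoint_excess: "self_adjoint (cfc (\<lambda>s. max (s - t) 0) y)"
  by (intro self_adjoint_cfc y continuous_intros)

lemma projection_above: "projection (spectral_above y t)"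
  unfolding spectral_above_def by (rule projection_support[OF self_adjoint_excess])

lemma above_commute: "c * y = y * c \<Longrightarrow> c * spectral_above y t = spectral_above y t * c"
  unfolding spectral_above_def
  by (intro support_commute self_adjoint_excess cfc_commute y continuous_intros)

text \<open>Whatever commutes with \<open>y\<close> commutes with \<open>spectral_above y t\<close>,
  so the uniqueness of upper projections applies. All spectral measures of \<open>y\<close> thus
  agree on these half-lines, which is the uniqueness that the description in
  \<open>spectral_projection\<close> needs there.\<close>

lemma spectral_measure_above:
  assumes "spectral_measure y E"
  shows "E {t<..} = spectral_above y t"
proof (rule upper_projection_unique[OF upper_projection_spectral_measure[OF assms y] upper_projection_above])
  show "E {t<..} * spectral_above y t = spectral_above y t * E {t<..}"
    by (intro above_commute spectral_measure_commute[OF assms _ y]) simp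
qed

text \<open>The truncations satisfy \<open>max (v - t) 0 \<le> max (v - s) 0\<close>. Comparing
  their squares compares the norms of \<open>u t \<xi>\<close> and \<open>u s \<xi>\<close>, hence
  the kernels.\<close>

lemma above_antimono:
  assumes "s \<le> t"
  shows "spectral_above y t * spectral_above y s = spectral_above y t" "spectral_above y s * spectral_above y t = spectral_above y t"
proof -
  have "spectral_above y t \<bullet>\<bullet> \<xi> = 0" if "spectral_above y s \<bullet>\<bullet> \<xi> = 0" for \<xi>
  proof -
    define u where "u r = cfc (\<lambda>v. max (v - r) 0) y" for r
    have u: "self_adjoint (u r)" for r
      unfolding u_def by (rule self_adjoint_excess)
    have uu: "u r * u r = cfc (\<lambda>v. max (v - r) 0 * max (v - r) 0) y" for r
      unfolding u_def by (rule cfc_mult[OF y, symmetric]) (intro continuous_intros)+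
    have "(norm (u t \<bullet>\<bullet> \<xi>))\<^sup>2 \<le> (norm (u s \<bullet>\<bullet> \<xi>))\<^sup>2"
      unfolding inner_square_nonneg[OF u, symmetric] uu using assms
      by (intro cfc_inner_mono y mult_mono continuous_intros) auto
    moreover have "u s \<bullet>\<bullet> \<xi> = 0"
      using that support_apply_eq_zero_iff[OF u, of s \<xi>] by (simp add: spectral_above_def u_def)
    ultimately show ?thesis
      using support_apply_eq_zero_iff[OF u, of t \<xi>] by (simp add: spectral_above_def u_def)
  qed
  moreover have "spectral_above y s \<bullet>\<bullet> (\<xi> - spectral_above y s \<bullet>\<bullet> \<xi>) = 0" for \<xi>
    by (simp add: bop_simps projection_idem projection_above)
  ultimately have "spectral_above y t \<bullet>\<bullet> (\<xi> - spectral_above y s \<bullet>\<bullet> \<xi>) = 0" for \<xi>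
    by blast
  then show 1: "spectral_above y t * spectral_above y s = spectral_above y t"
    by (intro bop_eqI) (simp add: bop_simps)
  then show "spectral_above y s * spectral_above y t = spectral_above y t"
    using projection_above by (metis adj_mult projection_def)
qed

text \<open>Approximate \<open>\<zeta>\<close> by a vector \<open>u s \<eta>\<close>. For
  \<open>t\<close> slightly above \<open>s\<close>, \<open>u t \<eta>\<close> is still near, and
  \<open>spectral_above y t\<close> fixes it while sending \<open>\<zeta>\<close> to its value at
  \<open>\<xi>\<close>. Continuity from the right is the side that an interval measure
  requires.\<close>

lemma above_tendsto: "((\<lambda>t. spectral_above y t \<bullet>\<bullet> \<xi>) \<longlongrightarrow> spectral_above y s \<bullet>\<bullet> \<xi>) (at_right s)"
proof (rule tendstoI)
  fix e :: real assume e: "0 < e"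
  define u where "u r = cfc (\<lambda>v. max (v - r) 0) y" for r
  have u: "self_adjoint (u r)" for r
    unfolding u_def by (rule self_adjoint_excess)
  define \<zeta> where "\<zeta> = spectral_above y s \<bullet>\<bullet> \<xi>"
  obtain \<eta> where \<eta>: "norm (\<zeta> - u s \<bullet>\<bullet> \<eta>) < e / 4"
    using support_approx[OF u, of "e / 4" s \<xi>] e by (auto simp: \<zeta>_def spectral_above_def u_def)
  define \<delta> where "\<delta> = e / (4 * (norm \<eta> + 1))"
  have \<delta>: "0 < \<delta>" "\<delta> * norm \<eta> \<le> e / 4"
    using e by (simp_all add: \<delta>_def field_simps add_pos_nonneg)
  have "dist (spectral_above y t \<bullet>\<bullet> \<xi>) (spectral_above y s \<bullet>\<bullet> \<xi>) < e" if t: "s < t" "t < s + \<delta>" for t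
  proof -
    have "norm (u s - u t) \<le> \<delta>"
    proof -
      have "u s - u t = cfc (\<lambda>v. max (v - s) 0 - max (v - t) 0) y"
        unfolding u_def by (intro cfc_diff[symmetric] y continuous_intros)
      also have "norm \<dots> \<le> \<delta>"
      proof (rule cfc_norm_le[OF y])
        show "\<bar>max (v - s) 0 - max (v - t) 0\<bar> \<le> \<delta>" for v
          using t by (simp add: max_def)
      qed (use \<delta>(1) in \<open>auto intro!: continuous_intros\<close>)
      finally show ?thesis .
    qed
    then have "norm (u s \<bullet>\<bullet> \<eta> - u t \<bullet>\<bullet> \<eta>) \<le> \<delta> * norm \<eta>"
      using norm_bop_apply[of "u s - u t" \<eta>] mult_right_mono[of "norm (u s - u t)" \<delta> "norm \<eta>"]
      by (simp add: bop_simps)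
    then have near: "norm (\<zeta> - u t \<bullet>\<bullet> \<eta>) < e / 2"
      using \<eta> \<delta>(2) norm_triangle_ineq[of "\<zeta> - u s \<bullet>\<bullet> \<eta>" "u s \<bullet>\<bullet> \<eta> - u t \<bullet>\<bullet> \<eta>"] by simp
    have "spectral_above y t \<bullet>\<bullet> \<xi> = spectral_above y t \<bullet>\<bullet> \<zeta>"
      using above_antimono(1)[of s t] t by (simp add: \<zeta>_def flip: bop_apply_simps(1))
    moreover have "spectral_above y t \<bullet>\<bullet> (u t \<bullet>\<bullet> \<eta>) = u t \<bullet>\<bullet> \<eta>"
      using support_mult_self(1)[OF u, of t] by (simp add: spectral_above_def u_def flip: bop_apply_simps(1))
    ultimately have "spectral_above y t \<bullet>\<bullet> \<xi> - \<zeta> = spectral_above y t \<bullet>\<bullet> (\<zeta> - u t \<bullet>\<bullet> \<eta>) - (\<zeta> - u t \<bullet>\<bullet> \<eta>)"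
      by (simp add: bop_simps)
    then have "norm (spectral_above y t \<bullet>\<bullet> \<xi> - \<zeta>) \<le> norm (spectral_above y t \<bullet>\<bullet> (\<zeta> - u t \<bullet>\<bullet> \<eta>)) + norm (\<zeta> - u t \<bullet>\<bullet> \<eta>)"
      by (metis norm_triangle_ineq4)
    also have "\<dots> \<le> norm (\<zeta> - u t \<bullet>\<bullet> \<eta>) + norm (\<zeta> - u t \<bullet>\<bullet> \<eta>)"
      by (intro add_right_mono projection_norm_le projection_above)
    finally have "norm (spectral_above y t \<bullet>\<bullet> \<xi> - \<zeta>) \<le> norm (\<zeta> - u t \<bullet>\<bullet> \<eta>) + norm (\<zeta> - u t \<bullet>\<bullet> \<eta>)" .
    then show ?thesis
      using near by (simp add: dist_norm \<zeta>_def)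
  qed
  then show "\<forall>\<^sub>F t in at_right s. dist (spectral_above y t \<bullet>\<bullet> \<xi>) (spectral_above y s \<bullet>\<bullet> \<xi>) < e"
    using \<delta>(1) by (auto simp: eventually_at_right_field intro!: exI[of _ "s + \<delta>"])
qed

lemma abs_inner_le: "\<bar>inner (y \<bullet>\<bullet> \<xi>) \<xi>\<bar> \<le> norm y * (norm \<xi>)\<^sup>2"
proof -
  have "\<bar>inner (y \<bullet>\<bullet> \<xi>) \<xi>\<bar> \<le> norm (y \<bullet>\<bullet> \<xi>) * norm \<xi>"
    by (rule Cauchy_Schwarz_ineq2)
  also have "\<dots> \<le> norm y * norm \<xi> * norm \<xi>"
    by (intro mult_right_mono norm_bop_apply norm_ge_zero)
  finally show ?thesis by (simp add: power2_eq_square mult.assoc)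
qed

lemma above_eq_0:
  assumes "norm y \<le> t"
  shows "spectral_above y t = 0"
proof (rule bop_eqI)
  fix \<xi>
  define \<zeta> where "\<zeta> = spectral_above y t \<bullet>\<bullet> \<xi>"
  have "\<zeta> = 0"
  proof (rule ccontr)
    assume "\<zeta> \<noteq> 0"
    then have "t * (norm \<zeta>)\<^sup>2 < inner (y \<bullet>\<bullet> \<zeta>) \<zeta>"
      by (intro upper_projection_gt[OF upper_projection_above]) (simp_all add: \<zeta>_def projection_idem projection_above)
    moreover have "norm y * (norm \<zeta>)\<^sup>2 \<le> t * (norm \<zeta>)\<^sup>2"
      by (intro mult_right_mono assms) simp
    ultimately show False using abs_inner_le[of \<zeta>] by linarith
  qed
  then show "spectral_above y t \<bullet>\<bullet> \<xi> = 0 \<bullet>\<bullet> \<xi>"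
    by (simp add: \<zeta>_def bop_simps)
qed

text \<open>The inequality is strict: for \<open>y\<close> equal to minus its norm times the unit,
  the projection at \<open>t = - norm y\<close> is 0.\<close>

lemma above_eq_1:
  assumes "t < - norm y"
  shows "spectral_above y t = 1"
proof (rule bop_eqI)
  fix \<xi>
  define \<zeta> where "\<zeta> = \<xi> - spectral_above y t \<bullet>\<bullet> \<xi>"
  have "\<zeta> = 0"
  proof (rule ccontr)
    assume "\<zeta> \<noteq> 0"
    have "inner (y \<bullet>\<bullet> \<zeta>) \<zeta> \<le> t * (norm \<zeta>)\<^sup>2"
      by (intro upper_projection_le[OF upper_projection_above])
        (simp add: \<zeta>_def bop_simps projection_idem projection_above)
    moreover have "t * (norm \<zeta>)\<^sup>2 < - norm y * (norm \<zeta>)\<^sup>2"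
      using \<open>\<zeta> \<noteq> 0\<close> by (intro mult_strict_right_mono assms) simp
    ultimately show False using abs_inner_le[of \<zeta>] by (simp add: abs_if split: if_splits)
  qed
  then show "spectral_above y t \<bullet>\<bullet> \<xi> = 1 \<bullet>\<bullet> \<xi>"
    by (simp add: \<zeta>_def bop_simps)
qed

lemma inner_above_mono: "s \<le> t \<Longrightarrow> (norm (spectral_above y t \<bullet>\<bullet> \<xi>))\<^sup>2 \<le> (norm (spectral_above y s \<bullet>\<bullet> \<xi>))\<^sup>2"
proof -
  assume "s \<le> t"
  then have "spectral_above y t \<bullet>\<bullet> \<xi> = spectral_above y t \<bullet>\<bullet> (spectral_above y s \<bullet>\<bullet> \<xi>)"
    by (simp add: above_antimono flip: bop_apply_simps(1))
  then have "norm (spectral_above y t \<bullet>\<bullet> \<xi>) \<le> norm (spectral_above y s \<bullet>\<bullet> \<xi>)"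
    using projection_norm_le[OF projection_above] by metis
  then show ?thesis
    by (intro power_mono) auto
qed

lemma distr_fun_mono: "s \<le> t \<Longrightarrow> distr_fun y \<xi> s \<le> distr_fun y \<xi> t"
  using inner_above_mono[of s t \<xi>] by (simp add: distr_fun_def)

lemma distr_fun_right_continuous: "continuous (at_right t) (distr_fun y \<xi>)"
  unfolding distr_fun_def continuous_within by (intro tendsto_intros above_tendsto)

lemma distr_fun_bounds:
  "norm y \<le> t \<Longrightarrow> distr_fun y \<xi> t = (norm \<xi>)\<^sup>2"
  "t < - norm y \<Longrightarrow> distr_fun y \<xi> t = 0"
  by (simp_all add: distr_fun_def above_eq_0 above_eq_1 bop_simps)

lemma emeasure_spectral_distr_Ioc:
  "s \<le> t \<Longrightarrow> emeasure (spectral_distr y \<xi>) {s<..t} = ennreal (distr_fun y \<xi> t - distr_fun y \<xi> s)"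
  unfolding spectral_distr_def
  by (intro emeasure_interval_measure_Ioc distr_fun_mono distr_fun_right_continuous)

lemma emeasure_spectral_distr_UNIV: "emeasure (spectral_distr y \<xi>) UNIV = ennreal ((norm \<xi>)\<^sup>2)"
proof -
  \<comment> \<open>The additional 1 on the left puts the lower endpoint strictly below
    \<open>- norm y\<close>, where the distribution function is 0.\<close>
  define A where "A n = {- norm y - 1 - real n<..norm y + real n}" for n
  have A: "emeasure (spectral_distr y \<xi>) (A n) = ennreal ((norm \<xi>)\<^sup>2)" for n
  proof -
    have "- norm y - 1 - real n \<le> norm y + real n"
      using norm_ge_zero[of y] by linarith
    then show ?thesis
      unfolding A_def by (subst emeasure_spectral_distr_Ioc) (simp_all add: distr_fun_bounds)
  qed
  have "incseq A"
    by (auto simp: incseq_def A_def)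
  then have "(\<lambda>n. emeasure (spectral_distr y \<xi>) (A n)) \<longlonglongrightarrow> emeasure (spectral_distr y \<xi>) (\<Union>n. A n)"
    by (intro Lim_emeasure_incseq) (auto simp: A_def[abs_def])
  moreover have "(\<Union>n. A n) = UNIV"
  proof (intro set_eqI iffI UNIV_I)
    fix t :: real
    obtain n where "\<bar>t\<bar> < real n"
      using reals_Archimedean2 by blast
    then have "- norm y - 1 - real n < t" "t \<le> norm y + real n"
      using norm_ge_zero[of y] by linarith+
    then have "t \<in> A n"
      by (simp add: A_def)
    then show "t \<in> (\<Union>n. A n)" by blast
  qed
  ultimately show ?thesis
    by (simp add: A LIMSEQ_const_iff)
qed

lemma finite_spectral_distr: "finite_measure (spectral_distr y \<xi>)"
  by (rule finite_measureI) (simp add: emeasure_spectral_distr_UNIV)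

lemma measure_spectral_distr_UNIV: "measure (spectral_distr y \<xi>) UNIV = (norm \<xi>)\<^sup>2"
  by (simp add: measure_def emeasure_spectral_distr_UNIV)

lemma measure_spectral_distr_Ioc:
  "s \<le> t \<Longrightarrow> measure (spectral_distr y \<xi>) {s<..t} = distr_fun y \<xi> t - distr_fun y \<xi> s"
  using distr_fun_mono[of s t \<xi>] by (simp add: measure_def emeasure_spectral_distr_Ioc)

text \<open>The Borel sets that carry a spectral projection form a Dynkin system.\<close>

lemma spectral_distr_projection:
  assumes "S \<in> sets borel"
  shows "\<exists>p. projection p \<and> (\<forall>\<xi>. measure (spectral_distr y \<xi>) S = inner (p \<bullet>\<bullet> \<xi>) \<xi>)"
proof -
  define G where "G = range (\<lambda>(i, j). {i<..j::real})"
  have "Int_stable G"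
  proof (rule Int_stableI)
    fix a b assume "a \<in> G" "b \<in> G"
    then obtain i j k l where "a = {i<..j}" "b = {k<..l}"
      by (auto simp: G_def)
    then have "a \<inter> b = (\<lambda>(i, j). {i<..j}) (max i k, min j l)"
      by auto
    then show "a \<inter> b \<in> G"
      unfolding G_def by blast
  qed
  moreover have "G \<subseteq> Pow UNIV" by simp
  moreover have "S \<in> sigma_sets UNIV G"
    using assms by (simp add: G_def borel_sigma_sets_Ioc)
  ultimately show ?thesis
  proof (induction rule: sigma_sets_induct_disjoint)
    case (basic A)
    then obtain i j where A: "A = {i<..j}"
      by (auto simp: G_def)
    show ?case
    proof (cases "i \<le> j")
      case True
      define p where "p = spectral_above y i - spectral_above y j"
      have "projection p"
        using projection_above[of i] projection_above[of j] above_antimono[OF True]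
        by (simp add: p_def projection_def adj_diff left_diff_distrib right_diff_distrib)
      moreover have "measure (spectral_distr y \<xi>) A = inner (p \<bullet>\<bullet> \<xi>) \<xi>" for \<xi>
        unfolding A measure_spectral_distr_Ioc[OF True]
        by (simp add: p_def bop_simps inner_diff_left projection_inner projection_above distr_fun_def)
      ultimately show ?thesis by blast
    next
      case False
      then have "A = {}" by (simp add: A)
      then show ?thesis
        by (intro exI[of _ 0]) (simp add: projection_def bop_simps)
    qed
  next
    case empty
    then show ?case
      by (intro exI[of _ 0]) (simp add: projection_def bop_simps)
  next
    case (compl A)
    then obtain p where p: "projection p" "\<And>\<xi>. measure (spectral_distr y \<xi>) A = inner (p \<bullet>\<bullet> \<xi>) \<xi>"
      by blast
    have "measure (spectral_distr y \<xi>) (UNIV - A) = inner ((1 - p) \<bullet>\<bullet> \<xi>) \<xi>" for \<xi>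
    proof -
      interpret finite_measure "spectral_distr y \<xi>"
        by (rule finite_spectral_distr)
      have "A \<in> sets (spectral_distr y \<xi>)"
        using compl(1) by (simp add: G_def borel_sigma_sets_Ioc)
      then show ?thesis
        using finite_measure_compl[of A] p(2)[of \<xi>]
        by (simp add: measure_spectral_distr_UNIV bop_simps inner_diff_left power2_norm_eq_inner)
    qed
    then show ?case
      using projection_complement[OF p(1)] by blast
  next
    case (union A)
    then have A: "A n \<in> sets borel" for n
      by (auto simp: G_def borel_sigma_sets_Ioc)
    from union obtain P where P: "\<And>n. projection (P n)"
      "\<And>n \<xi>. measure (spectral_distr y \<xi>) (A n) = inner (P n \<bullet>\<bullet> \<xi>) \<xi>"
      by metis
    have disj: "disjoint_family A"
      using union by blast
    \<comment> \<open>The measures of two disjoint sets add up to at most the total mass, which is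
      the form inequality that orthogonality requires.\<close>
    have orth: "P i * P j = 0" if "i \<noteq> j" for i j
    proof (rule orthogonal_projectionsI[OF P(1) P(1)])
      fix \<xi>
      interpret finite_measure "spectral_distr y \<xi>"
        by (rule finite_spectral_distr)
      have "A i \<inter> A j = {}"
        using disj that by (auto simp: disjoint_family_on_def)
      then have "inner (P i \<bullet>\<bullet> \<xi>) \<xi> + inner (P j \<bullet>\<bullet> \<xi>) \<xi> = measure (spectral_distr y \<xi>) (A i \<union> A j)"
        using A by (subst finite_measure_Union) (auto simp: P(2))
      also have "\<dots> \<le> (norm \<xi>)\<^sup>2"
        using bounded_measure[of "A i \<union> A j"] by (simp add: measure_spectral_distr_UNIV)
      finally show "inner (P i \<bullet>\<bullet> \<xi>) \<xi> + inner (P j \<bullet>\<bullet> \<xi>) \<xi> \<le> (norm \<xi>)\<^sup>2" .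
    qed
    obtain W where W: "projection W" "\<And>\<xi>. (\<lambda>n. P n \<bullet>\<bullet> \<xi>) sums (W \<bullet>\<bullet> \<xi>)"
      by (rule projection_sums[of P, OF P(1) orth]) (assumption | rule that)+
    have "measure (spectral_distr y \<xi>) (\<Union>n. A n) = inner (W \<bullet>\<bullet> \<xi>) \<xi>" for \<xi>
    proof -
      interpret finite_measure "spectral_distr y \<xi>"
        by (rule finite_spectral_distr)
      have "(\<lambda>n. measure (spectral_distr y \<xi>) (A n)) sums measure (spectral_distr y \<xi>) (\<Union>n. A n)"
        using A disj by (intro finite_measure_UNION) auto
      moreover have "(\<lambda>n. inner (P n \<bullet>\<bullet> \<xi>) \<xi>) sums inner (W \<bullet>\<bullet> \<xi>) \<xi>"
        by (rule bounded_linear.sums[OF bounded_linear_inner_left W(2)])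
      ultimately show ?thesis
        by (simp add: P(2) sums_unique2)
    qed
    then show ?case
      using W(1) by blast
  qed
qed

lemma AE_spectral_distr: "AE t in spectral_distr y \<xi>. t \<in> {- norm y - 1<..norm y}"
proof (rule AE_I[of _ _ "UNIV - {- norm y - 1<..norm y}"])
  have le: "- norm y - 1 \<le> norm y"
    using norm_ge_zero[of y] by linarith
  have "emeasure (spectral_distr y \<xi>) (UNIV - {- norm y - 1<..norm y}) =
      emeasure (spectral_distr y \<xi>) (space (spectral_distr y \<xi>)) - emeasure (spectral_distr y \<xi>) {- norm y - 1<..norm y}"
    using emeasure_spectral_distr_Ioc[OF le, of \<xi>] emeasure_compl[of "{- norm y - 1<..norm y}" "spectral_distr y \<xi>"]
    by simp
  then show "emeasure (spectral_distr y \<xi>) (UNIV - {- norm y - 1<..norm y}) = 0"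
    using emeasure_spectral_distr_Ioc[OF le, of \<xi>] by (simp add: emeasure_spectral_distr_UNIV distr_fun_bounds)
qed auto

lemma integrable_spectral_distr: "integrable (spectral_distr y \<xi>) (\<lambda>t. t)"
proof -
  interpret finite_measure "spectral_distr y \<xi>"
    by (rule finite_spectral_distr)
  have "AE t in spectral_distr y \<xi>. norm t \<le> norm y + 1"
    using AE_spectral_distr[of \<xi>] by eventually_elim auto
  then show ?thesis
    by (rule integrable_const_bound) measurable
qed

end

text \<open>Subdivide \<open>[a, b]\<close> into \<open>n\<close> equal parts and let \<open>n\<close> tend to infinity.\<close>

lemma constant_of_increments:
  fixes D F :: "real \<Rightarrow> real"
  assumes D: "\<And>s t. s \<le> t \<Longrightarrow> \<bar>D t - D s\<bar> \<le> (t - s) * (F t - F s)" and "a \<le> b"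
  shows "D b = D a"
proof -
  have bound: "\<bar>D b - D a\<bar> \<le> inverse (real (Suc n)) * ((b - a) * (F b - F a))" for n
  proof -
    define h where "h = (b - a) / real (Suc n)"
    define p where "p i = a + real i * h" for i
    have h: "0 \<le> h" using assms(2) by (simp add: h_def)
    have p: "p 0 = a" "p (Suc n) = b"
      by (simp_all add: p_def h_def)
    have step: "p (Suc i) - p i = h" for i
      by (simp add: p_def algebra_simps)
    have telescope: "(\<Sum>i<Suc n. G (p (Suc i)) - G (p i)) = G b - G a" for G :: "real \<Rightarrow> real"
      using sum_lessThan_telescope[of "\<lambda>i. G (p i)" "Suc n"] by (simp only: p)
    have "\<bar>D b - D a\<bar> = \<bar>\<Sum>i<Suc n. D (p (Suc i)) - D (p i)\<bar>"
      by (simp only: telescope)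
    also have "\<dots> \<le> (\<Sum>i<Suc n. \<bar>D (p (Suc i)) - D (p i)\<bar>)"
      by (rule sum_abs)
    also have "\<dots> \<le> (\<Sum>i<Suc n. h * (F (p (Suc i)) - F (p i)))"
    proof (rule sum_mono)
      fix i
      have "p i \<le> p (Suc i)" using step[of i] h by linarith
      then show "\<bar>D (p (Suc i)) - D (p i)\<bar> \<le> h * (F (p (Suc i)) - F (p i))"
        using D[of "p i" "p (Suc i)"] by (simp add: step)
    qed
    also have "\<dots> = h * (F b - F a)"
      by (simp only: telescope flip: sum_distrib_left)
    finally show ?thesis
      by (simp add: h_def divide_inverse mult_ac)
  qed
  have "(\<lambda>n. inverse (real (Suc n)) * ((b - a) * (F b - F a))) \<longlonglongrightarrow> 0 * ((b - a) * (F b - F a))"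
    by (intro tendsto_intros LIMSEQ_inverse_real_of_nat)
  then have "\<bar>D b - D a\<bar> \<le> 0 * ((b - a) * (F b - F a))"
    using bound by (intro LIMSEQ_le_const) auto
  then show ?thesis by simp
qed

section \<open>The integral representation and the spectral measure itself\<close>

context
  fixes y :: "'h::chilbert_space bop"
  assumes y: "self_adjoint y"
begin

text \<open>\<open>D t\<close> compares the form of \<open>y\<close> on the part of
  \<open>\<xi>\<close> below \<open>t\<close> with the integral up to \<open>t\<close>. Over
  \<open>(s, t]\<close> both quantities grow by an amount between \<open>s\<close> and
  \<open>t\<close> times the increment of the distribution function, so
  \<open>constant_of_increments\<close> makes \<open>D\<close> constant. It vanishes at
  \<open>a\<close>, and its value at \<open>b\<close> is the difference sought.\<close>

lemma integral_spectral_distr: "(\<integral>t. t \<partial>spectral_distr y \<xi>) = inner (y \<bullet>\<bullet> \<xi>) \<xi>"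
proof -
  let ?\<mu> = "spectral_distr y \<xi>"
  let ?F = "distr_fun y \<xi>"
  define a b where "a = - norm y - 1" and "b = norm y"
  have ab: "a \<le> b"
    using norm_ge_zero[of y] unfolding a_def b_def by linarith
  interpret finite_measure ?\<mu>
    by (rule finite_spectral_distr[OF y])
  have int: "integrable ?\<mu> (\<lambda>t. indicator S t * t)" if "S \<in> sets borel" for S
    using integrable_mult_indicator[OF _ integrable_spectral_distr[OF y], of S \<xi>] that by simp
  define D where "D t = inner (y \<bullet>\<bullet> (\<xi> - spectral_above y t \<bullet>\<bullet> \<xi>)) \<xi> - (\<integral>u. indicator {..t} u * u \<partial>?\<mu>)" for t
  have "\<bar>D t - D s\<bar> \<le> (t - s) * (?F t - ?F s)" if st: "s \<le> t" for s t
  proof -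
    define r where "r = spectral_above y s - spectral_above y t"
    define \<zeta> where "\<zeta> = r \<bullet>\<bullet> \<xi>"
    have r: "projection r"
      using projection_above[OF y, of s] projection_above[OF y, of t] above_antimono[OF y st]
      by (simp add: r_def projection_def adj_diff left_diff_distrib right_diff_distrib)
    have ry: "r * y = y * r"
      using above_commute[OF y, of y s] above_commute[OF y, of y t]
      by (simp add: r_def left_diff_distrib right_diff_distrib)
    have norm_\<zeta>: "(norm \<zeta>)\<^sup>2 = ?F t - ?F s"
      using projection_inner[OF r, of \<xi>] projection_inner[OF projection_above[OF y], of _ \<xi>]
      by (simp add: \<zeta>_def r_def distr_fun_def bop_simps inner_diff_left)
    have "inner (y \<bullet>\<bullet> (r \<bullet>\<bullet> \<xi>)) \<xi> = inner (y \<bullet>\<bullet> \<zeta>) \<zeta>"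
    proof -
      have "y * r = r * (y * r)"
        using r ry by (metis mult.assoc projection_def)
      then have "y \<bullet>\<bullet> (r \<bullet>\<bullet> \<xi>) = r \<bullet>\<bullet> (y \<bullet>\<bullet> (r \<bullet>\<bullet> \<xi>))"
        by (metis bop_apply_simps(1))
      then show ?thesis
        using inner_self_adjoint[OF projection_self_adjoint[OF r], of "y \<bullet>\<bullet> (r \<bullet>\<bullet> \<xi>)" \<xi>]
        by (simp add: \<zeta>_def)
    qed
    moreover have "inner (y \<bullet>\<bullet> \<zeta>) \<zeta> \<le> t * (norm \<zeta>)\<^sup>2"
    proof (rule upper_projection_le[OF upper_projection_above[OF y]])
      show "spectral_above y t \<bullet>\<bullet> \<zeta> = 0"
        using above_antimono(1)[OF y st] projection_idem[OF projection_above[OF y], of t \<xi>]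
        by (simp add: \<zeta>_def r_def bop_simps flip: bop_apply_simps(1))
    qed
    moreover have "s * (norm \<zeta>)\<^sup>2 \<le> inner (y \<bullet>\<bullet> \<zeta>) \<zeta>"
    proof (cases "\<zeta> = 0")
      case False
      have "spectral_above y s \<bullet>\<bullet> \<zeta> = \<zeta>"
        using above_antimono(2)[OF y st] projection_idem[OF projection_above[OF y], of s \<xi>]
        by (simp add: \<zeta>_def r_def bop_simps flip: bop_apply_simps(1))
      then show ?thesis
        using upper_projection_gt[OF upper_projection_above[OF y] _ False, of s] by simp
    qed (simp add: bop_simps)
    ultimately have 1: "s * (?F t - ?F s) \<le> inner (y \<bullet>\<bullet> (r \<bullet>\<bullet> \<xi>)) \<xi>"
      "inner (y \<bullet>\<bullet> (r \<bullet>\<bullet> \<xi>)) \<xi> \<le> t * (?F t - ?F s)"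
      by (simp_all add: norm_\<zeta>)
    define J where "J = (\<integral>u. indicator {s<..t} u * u \<partial>?\<mu>)"
    have int_const: "integrable ?\<mu> (\<lambda>u. indicator {s<..t} u * c)" for c :: real
      by (intro integrable_mult_left integrable_real_indicator) (auto simp: emeasure_eq_measure)
    have const: "(\<integral>u. indicator {s<..t} u * c \<partial>?\<mu>) = c * (?F t - ?F s)" for c
      using measure_spectral_distr_Ioc[OF y st, of \<xi>] by simp
    have "s * (?F t - ?F s) \<le> J"
      unfolding J_def const[symmetric]
      by (intro integral_mono int int_const) (auto simp: indicator_def)
    moreover have "J \<le> t * (?F t - ?F s)"
      unfolding J_def const[symmetric]
      by (intro integral_mono int int_const) (auto simp: indicator_def)
    moreover have "(\<integral>u. indicator {..t} u * u \<partial>?\<mu>) - (\<integral>u. indicator {..s} u * u \<partial>?\<mu>) = J"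
    proof -
      have "J = (\<integral>u. indicator {..t} u * u - indicator {..s} u * u \<partial>?\<mu>)"
        unfolding J_def using st by (intro Bochner_Integration.integral_cong) (auto simp: indicator_def)
      then show ?thesis
        by (simp add: int)
    qed
    moreover have "D t - D s = inner (y \<bullet>\<bullet> (r \<bullet>\<bullet> \<xi>)) \<xi> -
        ((\<integral>u. indicator {..t} u * u \<partial>?\<mu>) - (\<integral>u. indicator {..s} u * u \<partial>?\<mu>))"
      by (simp add: D_def r_def bop_simps inner_diff_left)
    moreover have "t * (?F t - ?F s) - s * (?F t - ?F s) = (t - s) * (?F t - ?F s)"
      by (simp add: left_diff_distrib)
    ultimately show ?thesis
      using 1 by linarith
  qed
  then have "D b = D a"
    using ab by (rule constant_of_increments)
  moreover have "D a = 0"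
  proof -
    have "(\<integral>u. indicator {..a} u * u \<partial>?\<mu>) = (\<integral>u. 0 \<partial>?\<mu>)"
    proof (rule integral_cong_AE)
      show "AE u in ?\<mu>. indicator {..a} u * u = 0"
        using AE_spectral_distr[OF y, of \<xi>] by eventually_elim (simp add: a_def)
    qed auto
    then show ?thesis
      by (simp add: D_def a_def above_eq_1[OF y] bop_simps)
  qed
  moreover have "D b = inner (y \<bullet>\<bullet> \<xi>) \<xi> - (\<integral>t. t \<partial>?\<mu>)"
  proof -
    have "(\<integral>u. indicator {..b} u * u \<partial>?\<mu>) = (\<integral>u. u \<partial>?\<mu>)"
    proof (rule integral_cong_AE)
      show "AE u in ?\<mu>. indicator {..b} u * u = u"
        using AE_spectral_distr[OF y, of \<xi>] by eventually_elim (simp add: b_def)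
    qed auto
    then show ?thesis
      by (simp add: D_def b_def above_eq_0[OF y] bop_simps)
  qed
  ultimately show ?thesis by simp
qed

text \<open>The measures determine each \<open>E S\<close> through its quadratic form, but countable
  additivity is required strongly. For disjoint sets the projections are orthogonal, so their series
  converges strongly to a projection \<open>W\<close>; summing the measures shows that
  \<open>W\<close> has the form of \<open>E\<close> at the union.\<close>

lemma spectral_measure_exists: "\<exists>E. spectral_measure y E"
proof -
  obtain E where E: "\<And>S. S \<in> sets borel \<Longrightarrow> projection (E S)"
    "\<And>S \<xi>. S \<in> sets borel \<Longrightarrow> measure (spectral_distr y \<xi>) S = inner (E S \<bullet>\<bullet> \<xi>) \<xi>"
    using spectral_distr_projection[OF y] by metis
  have one: "E S = 1" if "S \<in> sets borel" "\<And>\<xi>. measure (spectral_distr y \<xi>) S = (norm \<xi>)\<^sup>2" for S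
    using that E by (intro self_adjoint_eqI projection_self_adjoint self_adjoint_one)
      (simp_all add: bop_simps power2_norm_eq_inner)
  have sm: "scalar_measure E \<xi> = spectral_distr y \<xi>" for \<xi>
  proof (rule scalar_measure_eqI)
    interpret finite_measure "spectral_distr y \<xi>"
      by (rule finite_spectral_distr[OF y])
    show "emeasure (spectral_distr y \<xi>) S = ennreal (inner (E S \<bullet>\<bullet> \<xi>) \<xi>)" if "S \<in> sets borel" for S
      using E(2)[OF that, of \<xi>] by (simp add: emeasure_eq_measure)
  qed (simp add: y)
  have "spectral_measure y E"
    unfolding spectral_measure_def
  proof (intro conjI allI impI ballI)
    show "projection (E S)" if "S \<in> sets borel" for S
      by (rule E(1)[OF that])
    show "E UNIV = 1"
      by (rule one) (simp_all add: measure_spectral_distr_UNIV[OF y])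
    show "cinner (y \<bullet>\<bullet> \<xi>) \<xi> = complex_of_real (\<integral>t. t \<partial>scalar_measure E \<xi>)" for \<xi>
      by (simp add: sm integral_spectral_distr cinner_self_adjoint[OF y])
    show "\<exists>R. E {-R..R} = 1"
    proof (intro exI one)
      fix \<xi>
      interpret finite_measure "spectral_distr y \<xi>"
        by (rule finite_spectral_distr[OF y])
      have "AE t in spectral_distr y \<xi>. (t \<in> {-(norm y + 1)..norm y + 1}) = (t \<in> UNIV)"
        using AE_spectral_distr[OF y, of \<xi>] by eventually_elim auto
      then show "measure (spectral_distr y \<xi>) {-(norm y + 1)..norm y + 1} = (norm \<xi>)\<^sup>2"
        using finite_measure_eq_AE[of "{-(norm y + 1)..norm y + 1}" UNIV]
        by (simp add: measure_spectral_distr_UNIV[OF y] y)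
    qed simp
    fix A :: "nat \<Rightarrow> real set" and \<xi>
    assume A: "range A \<subseteq> sets borel \<and> disjoint_family A"
    have orth: "E (A i) * E (A j) = 0" if "i \<noteq> j" for i j
    proof (rule orthogonal_projectionsI)
      fix \<eta>
      interpret finite_measure "spectral_distr y \<eta>"
        by (rule finite_spectral_distr[OF y])
      have "A i \<inter> A j = {}" "A i \<in> sets borel" "A j \<in> sets borel"
        using A that by (auto simp: disjoint_family_on_def)
      then have "inner (E (A i) \<bullet>\<bullet> \<eta>) \<eta> + inner (E (A j) \<bullet>\<bullet> \<eta>) \<eta> = measure (spectral_distr y \<eta>) (A i \<union> A j)"
        by (subst finite_measure_Union) (auto simp: E(2) y)
      also have "\<dots> \<le> (norm \<eta>)\<^sup>2"
        using bounded_measure[of "A i \<union> A j"] by (simp add: measure_spectral_distr_UNIV[OF y] y)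
      finally show "inner (E (A i) \<bullet>\<bullet> \<eta>) \<eta> + inner (E (A j) \<bullet>\<bullet> \<eta>) \<eta> \<le> (norm \<eta>)\<^sup>2" .
    qed (use A E(1) in auto)
    have EA: "projection (E (A n))" for n
      using A by (intro E(1)) auto
    obtain W where W: "projection W" "\<And>\<eta>. (\<lambda>n. E (A n) \<bullet>\<bullet> \<eta>) sums (W \<bullet>\<bullet> \<eta>)"
      by (rule projection_sums[of "\<lambda>n. E (A n)", OF EA orth]) (assumption | rule that)+
    have "W = E (\<Union>n. A n)"
    proof (rule self_adjoint_eqI)
      show "self_adjoint W" "self_adjoint (E (\<Union>n. A n))"
        using W(1) A E(1) by (auto intro!: projection_self_adjoint)
      fix \<eta>
      interpret finite_measure "spectral_distr y \<eta>"
        by (rule finite_spectral_distr[OF y])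
      have "(\<lambda>n. measure (spectral_distr y \<eta>) (A n)) sums measure (spectral_distr y \<eta>) (\<Union>n. A n)"
        using A by (intro finite_measure_UNION) (auto simp: y)
      moreover have "measure (spectral_distr y \<eta>) (A n) = inner (E (A n) \<bullet>\<bullet> \<eta>) \<eta>" for n
        using A by (intro E(2)) auto
      moreover have "measure (spectral_distr y \<eta>) (\<Union>n. A n) = inner (E (\<Union>n. A n) \<bullet>\<bullet> \<eta>) \<eta>"
        using A by (intro E(2)) auto
      moreover have "(\<lambda>n. inner (E (A n) \<bullet>\<bullet> \<eta>) \<eta>) sums inner (W \<bullet>\<bullet> \<eta>) \<eta>"
        by (rule bounded_linear.sums[OF bounded_linear_inner_left W(2)])
      ultimately show "inner (W \<bullet>\<bullet> \<eta>) \<eta> = inner (E (\<Union>n. A n) \<bullet>\<bullet> \<eta>) \<eta>"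
        by (simp add: sums_unique2)
    qed
    then show "(\<lambda>n. E (A n) \<bullet>\<bullet> \<xi>) sums (E (\<Union>n. A n) \<bullet>\<bullet> \<xi>)"
      using W(2) by simp
  qed
  then show ?thesis by blast
qed

lemma spectral_projection_greaterThan: "spectral_projection {t<..} y = spectral_above y t"
proof -
  obtain E where E: "spectral_measure y E"
    using spectral_measure_exists by blast
  show ?thesis
    unfolding spectral_projection_def
  proof (rule the_equality)
    show "\<exists>E. spectral_measure y E \<and> spectral_above y t = E {t<..}"
      using E spectral_measure_above[OF y E, of t] by metis
    show "p = spectral_above y t" if "\<exists>E. spectral_measure y E \<and> p = E {t<..}" for p
      using that spectral_measure_above[OF y] by metis
  qed
qed

end

section \<open>Comparison of projections\<close>

text \<open>With the bicommutant description, membership becomes a commutation property. Every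
  element constructed here inherits it, so no closure in an operator topology has to be
  invoked.\<close>

lemma von_neumann_algebra_memI:
  assumes "von_neumann_algebra M" and "\<And>c. (\<And>x. x \<in> M \<Longrightarrow> c * x = x * c) \<Longrightarrow> c * z = z * c"
  shows "z \<in> M"
proof -
  have "z \<in> commutant (commutant M)"
    unfolding commutant_def using assms(2) by auto
  then show ?thesis
    using assms(1) by (simp add: von_neumann_algebra_def)
qed

lemma adj_mem: "von_neumann_algebra M \<Longrightarrow> x \<in> M \<Longrightarrow> adj x \<in> M"
  by (simp add: von_neumann_algebra_def)

lemma mult_mem:
  assumes M: "von_neumann_algebra M" and "x \<in> M" "y \<in> M"
  shows "x * y \<in> M"
proof (rule von_neumann_algebra_memI[OF M])
  fix c assume c: "\<And>x. x \<in> M \<Longrightarrow> c * x = x * c"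
  have "c * (x * y) = x * (c * y)"
    using c[OF assms(2)] by (metis mult.assoc)
  also have "\<dots> = x * y * c"
    using c[OF assms(3)] by (simp add: mult.assoc)
  finally show "c * (x * y) = x * y * c" .
qed

lemma cfc_mem:
  assumes "von_neumann_algebra M" "x \<in> M" "self_adjoint x" "continuous_on (Re ` spectrum x) f"
  shows "cfc f x \<in> M"
  by (rule von_neumann_algebra_memI[OF assms(1)]) (simp add: cfc_commute assms)

lemma above_mem:
  assumes "von_neumann_algebra M" "x \<in> M" "self_adjoint x"
  shows "spectral_above x t \<in> M"
  by (rule von_neumann_algebra_memI[OF assms(1)]) (simp add: above_commute assms)

text \<open>The partial isometry is the one in the polar decomposition of \<open>q p\<close>, which has the same
  kernel as \<open>p\<close>.\<close>

lemma projection_comparison: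
  assumes M: "von_neumann_algebra M" and p: "projection p" "p \<in> M" and q: "projection q" "q \<in> M"
    and disj: "\<And>\<xi>. p \<bullet>\<bullet> \<xi> = \<xi> \<Longrightarrow> q \<bullet>\<bullet> \<xi> = 0 \<Longrightarrow> \<xi> = 0"
  shows "\<exists>r\<in>M. subprojection r q \<and> mvn_equivalent M p r"
proof -
  define T where "T = q * p"
  have T: "T \<in> M" "adj T \<in> M"
    unfolding T_def by (intro mult_mem adj_mem M p q)+
  obtain v where v: "projection (adj v * v)" "\<And>\<xi>. (adj v * v) \<bullet>\<bullet> \<xi> = 0 \<longleftrightarrow> T \<bullet>\<bullet> \<xi> = 0"
    "\<And>c. c * T = T * c \<Longrightarrow> c * adj T = adj T * c \<Longrightarrow> c * v = v * c"
    "\<And>q. q * T = T \<Longrightarrow> q * v = v"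
    "\<And>\<xi> e. 0 < e \<Longrightarrow> \<exists>\<eta>. norm ((adj v * v) \<bullet>\<bullet> \<xi> - adj T \<bullet>\<bullet> \<eta>) < e"
    by (rule polar_decomposition[of T]) (rule that)
  have vM: "v \<in> M"
    by (rule von_neumann_algebra_memI[OF M], rule v(3)) (simp_all add: T)
  \<comment> \<open>If \<open>q (p \<xi>) = 0\<close>, then \<open>p \<xi>\<close> lies in the range
    of \<open>p\<close> and the kernel of \<open>q\<close>, so it is 0 by
    \<open>disj\<close>.\<close>
  have "T \<bullet>\<bullet> \<xi> = 0 \<longleftrightarrow> p \<bullet>\<bullet> \<xi> = 0" for \<xi>
    using disj[of "p \<bullet>\<bullet> \<xi>"] by (auto simp: T_def bop_simps projection_idem[OF p(1)])
  then have vv: "adj v * v = p"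
    by (intro projection_eqI v(1) p(1)) (simp only: v(2))
  have "q * T = T"
    using q(1) by (simp add: T_def projection_def flip: mult.assoc)
  then have qv: "q * v = v" by (rule v(4))
  \<comment> \<open>The squared norm of \<open>v \<zeta>\<close> is the form of \<open>p\<close> at
    \<open>\<zeta>\<close>, which vanishes for \<open>\<zeta> = \<xi> - p \<xi>\<close>.\<close>
  have vp: "v * p = v"
  proof (rule bop_eqI)
    fix \<xi>
    have "(norm (v \<bullet>\<bullet> (\<xi> - p \<bullet>\<bullet> \<xi>)))\<^sup>2 = 0"
      unfolding norm_bop_apply_square vv by (simp add: bop_simps projection_idem[OF p(1)])
    then show "(v * p) \<bullet>\<bullet> \<xi> = v \<bullet>\<bullet> \<xi>"
      by (simp add: bop_simps)
  qed
  define r where "r = v * adj v"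
  have "r * r = v * (adj v * v) * adj v"
    by (simp add: r_def mult.assoc)
  then have r: "projection r"
    by (simp add: vv vp projection_def) (simp add: r_def adj_mult adj_adj)
  have "q * r = r"
    by (simp add: r_def qv flip: mult.assoc)
  then have "subprojection r q"
    using r q by (simp add: subprojection_def)
  moreover have "mvn_equivalent M p r"
    unfolding mvn_equivalent_def using p(1) r vM vv r_def by blast
  moreover have "r \<in> M"
    unfolding r_def by (intro mult_mem adj_mem M vM)
  ultimately show ?thesis by blast
qed

lemma projection_le:
  assumes p: "projection p" and q: "projection q" and "\<And>\<xi>. q \<bullet>\<bullet> \<xi> = 0 \<Longrightarrow> p \<bullet>\<bullet> \<xi> = 0"
  shows "p * q = p" "q * p = p"
proof -
  have "q \<bullet>\<bullet> (\<xi> - q \<bullet>\<bullet> \<xi>) = 0" for \<xi>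
    by (simp add: bop_simps projection_idem q)
  then have "p \<bullet>\<bullet> (\<xi> - q \<bullet>\<bullet> \<xi>) = 0" for \<xi>
    by (rule assms(3))
  then show "p * q = p"
    by (intro bop_eqI) (simp add: bop_simps)
  then show "q * p = p"
    using p q by (metis adj_mult projection_def)
qed

section \<open>Jensen's inequality\<close>

text \<open>On the compact set where \<open>g \<ge> e\<close> the function \<open>h\<close> has a
  positive minimum and \<open>g\<close> a maximum; \<open>C\<close> is their quotient.\<close>

lemma le_epsilon_plus_multiple:
  fixes g h :: "'a::topological_space \<Rightarrow> real"
  assumes S: "compact S" and g: "continuous_on S g" and h: "continuous_on S h"
    and h0: "\<And>t. t \<in> S \<Longrightarrow> 0 \<le> h t" and gh: "\<And>t. t \<in> S \<Longrightarrow> h t = 0 \<Longrightarrow> g t \<le> 0" and e: "0 < e"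
  obtains C where "\<And>t. t \<in> S \<Longrightarrow> g t \<le> e + C * h t"
proof -
  define T where "T = S \<inter> g -` {e..}"
  have T: "compact T"
    unfolding T_def using S continuous_closedin_preimage[OF g closed_atLeast]
    by (rule closedin_compact)
  show ?thesis
  proof (cases "T = {}")
    case True
    then have "g t \<le> e + 0 * h t" if "t \<in> S" for t
      using that by (force simp: T_def)
    then show ?thesis by (rule that)
  next
    case False
    have TS: "T \<subseteq> S" by (auto simp: T_def)
    obtain t0 where t0: "t0 \<in> T" "\<And>t. t \<in> T \<Longrightarrow> h t0 \<le> h t"
      using continuous_attains_inf[OF T False continuous_on_subset[OF h TS]] by blast
    obtain t1 where t1: "t1 \<in> T" "\<And>t. t \<in> T \<Longrightarrow> g t \<le> g t1"
      using continuous_attains_sup[OF T False continuous_on_subset[OF g TS]] by blast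
    have "h t0 \<noteq> 0" "0 < g t1"
      using t0(1) t1(1) gh[of t0] e by (auto simp: T_def)
    then have pos: "0 < h t0"
      using h0[of t0] t0(1) TS by force
    have "g t \<le> e + g t1 / h t0 * h t" if "t \<in> S" for t
    proof (cases "t \<in> T")
      case True
      have "g t \<le> g t1 / h t0 * h t0"
        using t1(2)[OF True] pos by simp
      also have "\<dots> \<le> g t1 / h t0 * h t"
        using t0(2)[OF True] pos \<open>0 < g t1\<close> by (intro mult_left_mono) auto
      finally show ?thesis using e by simp
    next
      case False
      then have "g t \<le> e" using that by (auto simp: T_def)
      moreover have "0 \<le> g t1 / h t0 * h t"
        using pos \<open>0 < g t1\<close> h0[OF that] by simp
      ultimately show ?thesis by simp
    qed
    then show ?thesis by (rule that)
  qed
qed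

text \<open>A continuous \<open>g\<close> that vanishes wherever \<open>h\<close> does need not be
  bounded by a multiple of \<open>h\<close>. But its square is at most \<open>e + C * h\<close> for
  every \<open>e > 0\<close>, so at a vector killed by \<open>cfc h x\<close> the squared norm of
  \<open>G \<xi>\<close> is at most \<open>e\<close> times that of \<open>\<xi>\<close>.\<close>

lemma support_cfc_mono:
  fixes x :: "'h::chilbert_space bop"
  assumes x: "self_adjoint x" and g: "continuous_on (Re ` spectrum x) g" and h: "continuous_on (Re ` spectrum x) h"
    and h0: "\<And>t. t \<in> Re ` spectrum x \<Longrightarrow> 0 \<le> h t"
    and gh: "\<And>t. t \<in> Re ` spectrum x \<Longrightarrow> h t = 0 \<Longrightarrow> g t = 0"
  shows "support (cfc h x) * support (cfc g x) = support (cfc g x)"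
proof (rule projection_le(2))
  define G where "G = cfc g x"
  have G: "self_adjoint G" and H: "self_adjoint (cfc h x)"
    unfolding G_def by (intro self_adjoint_cfc x g h)+
  show "projection (support (cfc g x))" "projection (support (cfc h x))"
    using G H by (auto simp: G_def intro: projection_support)
  fix \<xi> assume "support (cfc h x) \<bullet>\<bullet> \<xi> = 0"
  then have ker: "cfc h x \<bullet>\<bullet> \<xi> = 0"
    by (simp add: support_apply_eq_zero_iff[OF H])
  have "(norm (G \<bullet>\<bullet> \<xi>))\<^sup>2 \<le> e * (norm \<xi>)\<^sup>2" if e: "0 < e" for e
  proof -
    have comp: "compact (Re ` spectrum x)"
      by (intro compact_continuous_image compact_spectrum continuous_intros)
    obtain C where C: "\<And>t. t \<in> Re ` spectrum x \<Longrightarrow> g t * g t \<le> e + C * h t"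
      by (rule le_epsilon_plus_multiple[OF comp continuous_on_mult[OF g g] h h0 _ e])
        (use gh in \<open>auto intro: that\<close>)
    have "(norm (G \<bullet>\<bullet> \<xi>))\<^sup>2 = inner (cfc (\<lambda>t. g t * g t) x \<bullet>\<bullet> \<xi>) \<xi>"
      using inner_square_nonneg[OF G] by (simp add: G_def cfc_mult[OF x g g])
    also have "\<dots> \<le> inner (cfc (\<lambda>t. e + C * h t) x \<bullet>\<bullet> \<xi>) \<xi>"
      by (intro cfc_inner_mono x C continuous_intros g h)
    also have "cfc (\<lambda>t. e + C * h t) x = e *\<^sub>R 1 + C *\<^sub>R cfc h x"
      using h by (subst cfc_add[OF x]) (simp_all add: cfc_const[OF x] cfc_scaleR[OF x h] continuous_on_mult)
    finally show ?thesis
      by (simp add: bop_simps ker power2_norm_eq_inner)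
  qed
  note le = this
  have "(norm (G \<bullet>\<bullet> \<xi>))\<^sup>2 \<le> 0"
  proof (rule tendsto_lowerbound)
    show "((\<lambda>e. e * (norm \<xi>)\<^sup>2) \<longlongrightarrow> 0) (at_right 0)"
      by (auto intro!: tendsto_eq_intros)
    show "\<forall>\<^sub>F e in at_right 0. (norm (G \<bullet>\<bullet> \<xi>))\<^sup>2 \<le> e * (norm \<xi>)\<^sup>2"
      using eventually_at_right_less[of 0] by eventually_elim (rule le)
  qed simp
  then show "support (cfc g x) \<bullet>\<bullet> \<xi> = 0"
    using support_apply_eq_zero_iff[OF G, of \<xi>] by (simp add: G_def)
qed

lemma positive_diff_cfc:
  assumes x: "self_adjoint x" and "\<And>t. t \<in> Re ` spectrum x \<Longrightarrow> m \<le> t"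
  shows "positive (x - m *\<^sub>R 1)"
proof -
  have "positive (cfc (\<lambda>t. t - m) x)"
    by (intro positive_cfc x continuous_intros) (simp add: assms(2))
  then show ?thesis
    by (simp add: cfc_diff[OF x] cfc_const[OF x] cfc_id[OF x] continuous_on_id)
qed

lemma positive_cfc_diff:
  assumes x: "self_adjoint x" and "\<And>t. t \<in> Re ` spectrum x \<Longrightarrow> t \<le> m"
  shows "positive (m *\<^sub>R 1 - x)"
proof -
  have "positive (cfc (\<lambda>t. m - t) x)"
    by (intro positive_cfc x continuous_intros) (simp add: assms(2))
  then show ?thesis
    by (simp add: cfc_diff[OF x] cfc_const[OF x] cfc_id[OF x] continuous_on_id)
qed

lemma spectrum_ge_of_positive:
  assumes "positive (x - m *\<^sub>R 1)" "c \<in> spectrum x"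
  shows "m \<le> Re c"
proof -
  have "c - complex_of_real m \<in> spectrum (x - m *\<^sub>R 1)"
    using assms(2) by (simp add: spectrum_diff_scaleC flip: scaleC_of_real)
  then show ?thesis
    using assms(1) by (auto simp: positive_def complex_eq_iff)
qed

lemma spectrum_le_of_positive:
  assumes "positive (m *\<^sub>R 1 - x)" "c \<in> spectrum x"
  shows "Re c \<le> m"
proof -
  have "complex_of_real m - c \<in> spectrum (m *\<^sub>R 1 - x)"
  proof (rule ccontr)
    assume "complex_of_real m - c \<notin> spectrum (m *\<^sub>R 1 - x)"
    then have "has_inverse ((-1) *\<^sub>C (m *\<^sub>R 1 - x - (complex_of_real m - c) *\<^sub>C 1))"
      by (intro has_inverse_scaleC) (simp_all add: spectrum_iff)
    moreover have "(-1) *\<^sub>C (m *\<^sub>R 1 - x - (complex_of_real m - c) *\<^sub>C 1) = x - c *\<^sub>C 1"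
      by (simp add: scaleC_minus_left scaleC_diff_left scaleC_of_real)
    ultimately show False
      using assms(2) by (simp add: spectrum_iff)
  qed
  then show ?thesis
    using assms(1) by (auto simp: positive_def complex_eq_iff)
qed

section \<open>Positive unital maps and their vector states\<close>

context
  fixes \<phi> :: "'a::cstar_algebra \<Rightarrow> 'h::chilbert_space bop"
  assumes linear: "complex_linear \<phi>" and pos: "positive_map \<phi>" and unital: "\<phi> 1 = 1"
begin

lemma positive_map_add: "\<phi> (x + y) = \<phi> x + \<phi> y"
  using linear by (simp add: complex_linear_def)

lemma positive_map_scaleR: "\<phi> (r *\<^sub>R x) = r *\<^sub>R \<phi> x"
proof -
  have "\<phi> (complex_of_real r *\<^sub>C x) = complex_of_real r *\<^sub>C \<phi> x"
    using linear by (simp add: complex_linear_def)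
  then show ?thesis by (simp only: scaleC_of_real)
qed

lemma positive_map_diff: "\<phi> (x - y) = \<phi> x - \<phi> y"
  using positive_map_add[of "x - y" y] by simp

text \<open>Positivity of \<open>\<phi>\<close> speaks only of positive elements, and adding
  \<open>norm x\<close> times the unit makes \<open>x\<close> one of them.\<close>

lemma positive_map_self_adjoint:
  assumes x: "self_adjoint x"
  shows "self_adjoint (\<phi> x)"
proof -
  have "- norm x \<le> t" if t: "t \<in> Re ` spectrum x" for t
  proof -
    obtain c where c: "c \<in> spectrum x" "t = Re c"
      using t by blast
    then have "\<bar>t\<bar> \<le> norm x"
      using order_trans[OF abs_Re_le_cmod spectrum_norm_le[OF c(1)]] by simp
    then show ?thesis by simp
  qed
  then have "positive (x - (- norm x) *\<^sub>R 1)"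
    by (intro positive_diff_cfc x)
  then have "self_adjoint (\<phi> (x - (- norm x) *\<^sub>R 1))"
    using pos by (simp add: positive_map_def positive_def)
  then have "self_adjoint (\<phi> x - (- norm x) *\<^sub>R 1)"
    by (simp only: positive_map_diff positive_map_scaleR unital)
  then have "self_adjoint (\<phi> x - (- norm x) *\<^sub>R 1 + (- norm x) *\<^sub>R 1)"
    by (intro self_adjoint_add self_adjoint_scaleR self_adjoint_one)
  then show ?thesis by simp
qed

context
  fixes a :: 'a and I :: "real set"
  assumes a: "self_adjoint a" and I: "is_interval I" "spectrum a \<subseteq> complex_of_real ` I"
begin

text \<open>The bounds are the least and greatest spectral values of \<open>a\<close>, so they
  belong to \<open>I\<close> itself. They exist because the spectrum is compact and, the unit of the
  source being nonzero with that of the target, not empty.\<close>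

lemma positive_map_bounds:
  assumes "(1::'h bop) \<noteq> 0"
  obtains m M where "m \<in> I" "M \<in> I" "positive (\<phi> a - m *\<^sub>R 1)" "positive (M *\<^sub>R 1 - \<phi> a)"
proof -
  define K where "K = Re ` spectrum a"
  have "compact K"
    unfolding K_def by (intro compact_continuous_image compact_spectrum continuous_intros)
  have "(1::'a) \<noteq> 0"
  proof
    assume "(1::'a) = 0"
    then have "\<phi> 1 = \<phi> (1 + 1)" by simp
    then show False
      unfolding positive_map_add unital using assms by simp
  qed
  then have "K \<noteq> {}"
    using norm_in_spectrum[OF a] by (auto simp: K_def)
  obtain m where m: "m \<in> K" "\<And>t. t \<in> K \<Longrightarrow> m \<le> t"
    using compact_attains_inf[OF \<open>compact K\<close> \<open>K \<noteq> {}\<close>] by blast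
  obtain M where M: "M \<in> K" "\<And>t. t \<in> K \<Longrightarrow> t \<le> M"
    using compact_attains_sup[OF \<open>compact K\<close> \<open>K \<noteq> {}\<close>] by blast
  have KI: "K \<subseteq> I"
    using I(2) by (auto simp: K_def)
  have "positive (\<phi> (a - m *\<^sub>R 1))" "positive (\<phi> (M *\<^sub>R 1 - a))"
    using pos positive_diff_cfc[OF a, of m] positive_cfc_diff[OF a, of M] m(2) M(2)
    by (auto simp: positive_map_def K_def)
  then show ?thesis
    using that[of m M] m(1) M(1) KI by (auto simp: positive_map_diff positive_map_scaleR unital)
qed

lemma positive_map_spectrum: "Re ` spectrum (\<phi> a) \<subseteq> I"
proof (cases "(1::'h bop) = 0")
  case True
  \<comment> \<open>On the zero Hilbert space every operator is invertible, so the spectrum is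
    empty.\<close>
  have "z = 0" for z :: "'h bop"
    using True by (metis mult_1_left mult_zero_left)
  then have "has_inverse z" for z :: "'h bop"
    unfolding has_inverse_def by metis
  then show ?thesis by (auto simp: spectrum_iff)
next
  case False
  obtain m M where mM: "m \<in> I" "M \<in> I" "positive (\<phi> a - m *\<^sub>R 1)" "positive (M *\<^sub>R 1 - \<phi> a)"
    by (rule positive_map_bounds[OF False])
  show ?thesis
  proof (rule image_subsetI)
    fix c assume c: "c \<in> spectrum (\<phi> a)"
    show "Re c \<in> I"
      using mem_is_interval_1_I[OF I(1) mM(1,2)] spectrum_ge_of_positive[OF mM(3) c]
        spectrum_le_of_positive[OF mM(4) c] by blast
  qed
qed

lemma positive_map_inner_mem:
  assumes "norm \<xi> = 1"
  shows "inner (\<phi> a \<bullet>\<bullet> \<xi>) \<xi> \<in> I"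
proof -
  have "(1::'h bop) \<noteq> 0"
  proof
    assume "(1::'h bop) = 0"
    then have "(1::'h bop) \<bullet>\<bullet> \<xi> = 0 \<bullet>\<bullet> \<xi>" by simp
    then show False
      using assms by (simp add: bop_simps)
  qed
  then obtain m M where mM: "m \<in> I" "M \<in> I" "positive (\<phi> a - m *\<^sub>R 1)" "positive (M *\<^sub>R 1 - \<phi> a)"
    by (rule positive_map_bounds)
  have "inner \<xi> \<xi> = 1"
    using assms by (simp flip: power2_norm_eq_inner)
  then show ?thesis
    using positive_inner_nonneg[OF mM(3), of \<xi>] positive_inner_nonneg[OF mM(4), of \<xi>]
    by (intro mem_is_interval_1_I[OF I(1) mM(1,2)]) (simp_all add: bop_simps inner_diff_left)
qed

text \<open>A supporting line of \<open>f\<close> at the mean \<open>s\<close> lies below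
  \<open>f\<close> on the spectrum of \<open>a\<close>. The positive map preserves this inequality,
  and in the state of \<open>\<xi>\<close> the line takes the value \<open>f s\<close>.\<close>

lemma Jensen_vector_state:
  assumes "open I" "convex_on I f" "norm \<xi> = 1"
  shows "f (inner (\<phi> a \<bullet>\<bullet> \<xi>) \<xi>) \<le> inner (\<phi> (cfc f a) \<bullet>\<bullet> \<xi>) \<xi>"
proof -
  define s where "s = inner (\<phi> a \<bullet>\<bullet> \<xi>) \<xi>"
  have s: "s \<in> I"
    unfolding s_def by (rule positive_map_inner_mem[OF assms(3)])
  \<comment> \<open>The infimum of the difference quotients to the right of \<open>s\<close>, that
    is, the right derivative of \<open>f\<close>; since \<open>I\<close> is open, \<open>s\<close>
    is an interior point and this is the slope of a supporting line.\<close>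
  define c where "c = Inf ((\<lambda>t. (f s - f t) / (s - t)) ` ({s<..} \<inter> I))"
  have line: "f s + c * (t - s) \<le> f t" if "t \<in> I" for t
    unfolding c_def using that s assms(1,2)
    by (intro convex_le_Inf_differential) (auto simp: interior_open)
  have KI: "Re ` spectrum a \<subseteq> I"
    using I(2) by auto
  have f: "continuous_on (Re ` spectrum a) f"
    using convex_on_continuous[OF assms(1,2)] KI by (rule continuous_on_subset)
  have "positive (cfc (\<lambda>t. f t - (f s + c * (t - s))) a)"
    using line KI by (intro positive_cfc a continuous_intros f) auto
  also have "cfc (\<lambda>t. f t - (f s + c * (t - s))) a = cfc f a - cfc (\<lambda>t. f s + c * (t - s)) a"
    by (intro cfc_diff a continuous_intros f)
  also have "cfc (\<lambda>t. f s + c * (t - s)) a = cfc (\<lambda>t. f s) a + cfc (\<lambda>t. c * (t - s)) a"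
    by (intro cfc_add a continuous_intros)
  also have "cfc (\<lambda>t. c * (t - s)) a = c *\<^sub>R cfc (\<lambda>t. t - s) a"
    by (intro cfc_scaleR a continuous_intros)
  also have "cfc (\<lambda>t. t - s) a = cfc (\<lambda>t. t) a - cfc (\<lambda>t. s) a"
    by (intro cfc_diff a continuous_intros)
  finally have "positive (cfc f a - (f s *\<^sub>R 1 + c *\<^sub>R (a - s *\<^sub>R 1)))"
    by (simp add: cfc_const[OF a] cfc_id[OF a])
  then have "positive (\<phi> (cfc f a - (f s *\<^sub>R 1 + c *\<^sub>R (a - s *\<^sub>R 1))))"
    using pos by (simp add: positive_map_def)
  then have "positive (\<phi> (cfc f a) - (f s *\<^sub>R 1 + c *\<^sub>R (\<phi> a - s *\<^sub>R 1)))"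
    by (simp only: positive_map_add positive_map_diff positive_map_scaleR unital)
  from positive_inner_nonneg[OF this, of \<xi>]
  have "0 \<le> inner (\<phi> (cfc f a) \<bullet>\<bullet> \<xi>) \<xi> - (f s * inner \<xi> \<xi> + c * (s - s * inner \<xi> \<xi>))"
    by (simp add: bop_simps inner_diff_left inner_add_left s_def)
  moreover have "inner \<xi> \<xi> = 1"
    using assms(3) by (simp flip: power2_norm_eq_inner)
  ultimately show ?thesis by (simp add: s_def)
qed

end

end

text \<open>For a monotone \<open>f\<close>, a unit vector \<open>\<xi>\<close> in the range of the spectral projection of \<open>f x\<close> for
  \<open>(\<alpha>, \<infinity>)\<close> satisfies \<open>f \<langle>x \<xi>, \<xi>\<rangle> > \<alpha>\<close>; \<open>s\<close> is the direction of monotonicity.\<close>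

lemma monotone_value_above:
  fixes x :: "'h::chilbert_space bop" and s :: real
  assumes x: "self_adjoint x" and f: "continuous_on (Re ` spectrum x) f"
    and \<xi>: "spectral_above (cfc f x) \<alpha> \<bullet>\<bullet> \<xi> = \<xi>" "norm \<xi> = 1"
    and mono: "\<And>t. t \<in> Re ` spectrum x \<Longrightarrow> s * t \<le> s * inner (x \<bullet>\<bullet> \<xi>) \<xi> \<Longrightarrow> f t \<le> f (inner (x \<bullet>\<bullet> \<xi>) \<xi>)"
  shows "\<alpha> < f (inner (x \<bullet>\<bullet> \<xi>) \<xi>)"
proof (rule ccontr)
  define u where "u = inner (x \<bullet>\<bullet> \<xi>) \<xi>"
  assume "\<not> \<alpha> < f (inner (x \<bullet>\<bullet> \<xi>) \<xi>)"
  then have le: "f u \<le> \<alpha>" by (simp add: u_def)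
  define p where "p = support (cfc (\<lambda>t. max (f t - \<alpha>) 0) x)"
  define q where "q = support (cfc (\<lambda>t. max (s * t - s * u) 0) x)"
  have y: "self_adjoint (cfc f x)"
    by (rule self_adjoint_cfc[OF x f])
  \<comment> \<open>\<open>p\<close> is formed in the calculus of \<open>x\<close>,
    \<open>spectral_above\<close> in that of \<open>cfc f x\<close>. Uniqueness of upper projections
    identifies them and replaces a composition rule for \<open>cfc\<close>.\<close>
  have up: "upper_projection (cfc f x) \<alpha> p"
    unfolding p_def by (rule upper_projection_cfc[OF x f])
  then have "p * spectral_above (cfc f x) \<alpha> = spectral_above (cfc f x) \<alpha> * p"
    by (intro above_commute y) (simp add: upper_projection_def)
  then have p: "p = spectral_above (cfc f x) \<alpha>"
    by (rule upper_projection_unique[OF up upper_projection_above[OF y]])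
  have st: "continuous_on (Re ` spectrum x) (\<lambda>t. s * t)"
    by (intro continuous_intros)
  \<comment> \<open>Where \<open>s * t \<le> s * u\<close>, monotonicity gives
    \<open>f t \<le> f u \<le> \<alpha>\<close>. So \<open>p\<close> lies below the projection
    \<open>q\<close> of \<open>s x\<close> for the half-line above \<open>s * u\<close>, and the
    form of \<open>s x\<close> at \<open>\<xi>\<close> would strictly exceed \<open>s * u\<close>,
    its actual value.\<close>
  have "q * p = p"
    unfolding q_def p_def
  proof (rule support_cfc_mono[OF x])
    show "max (f t - \<alpha>) 0 = 0" if "t \<in> Re ` spectrum x" "max (s * t - s * u) 0 = 0" for t
      using mono[OF that(1)] that(2) le by (simp add: u_def max_def split: if_splits)
  qed (intro continuous_intros f | simp)+
  then have "q \<bullet>\<bullet> \<xi> = \<xi>"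
    using \<xi>(1) unfolding p[symmetric] by (metis bop_apply_simps(1))
  moreover have "upper_projection (cfc (\<lambda>t. s * t) x) (s * u) q"
    unfolding q_def by (rule upper_projection_cfc[OF x st])
  moreover have "\<xi> \<noteq> 0" using \<xi>(2) by auto
  ultimately have "s * u * (norm \<xi>)\<^sup>2 < inner (cfc (\<lambda>t. s * t) x \<bullet>\<bullet> \<xi>) \<xi>"
    using upper_projection_gt by blast
  also have "cfc (\<lambda>t. s * t) x = s *\<^sub>R x"
    by (simp add: cfc_scaleR[OF x continuous_on_id] cfc_id[OF x])
  finally show False
    using \<xi>(2) by (simp add: bop_simps u_def)
qed

theorem theorem3p1:
  fixes M :: "'h::chilbert_space bop set"
    and \<phi> :: "'a::cstar_algebra \<Rightarrow> 'h bop"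
    and f :: "real \<Rightarrow> real" and I :: "real set" and a :: 'a
  assumes "von_neumann_algebra M"
    and "range \<phi> \<subseteq> M"
    and "complex_linear \<phi>" and "positive_map \<phi>" and "\<phi> 1 = 1"
    and "open I" and "is_interval I"
    and "convex_on I f" and "mono_on I f \<or> antimono_on I f"
    and "self_adjoint a" and "spectrum a \<subseteq> complex_of_real ` I"
  shows "spectral_le M (cfc f (\<phi> a)) (\<phi> (cfc f a))"
proof -
  note \<phi> = assms(3-5)
  note aI = assms(10) assms(7) assms(11)
  define x where "x = \<phi> a"
  define y where "y = \<phi> (cfc f a)"
  have M: "x \<in> M" "y \<in> M"
    using assms(2) by (auto simp: x_def y_def)
  have x: "self_adjoint x"
    unfolding x_def by (rule positive_map_self_adjoint[OF \<phi> assms(10)])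
  have spec: "Re ` spectrum x \<subseteq> I"
    unfolding x_def by (rule positive_map_spectrum[OF \<phi> aI])
  have cont: "continuous_on I f"
    by (rule convex_on_continuous[OF assms(6,8)])
  then have f: "continuous_on (Re ` spectrum x) f"
    using spec by (rule continuous_on_subset)
  have "Re ` spectrum a \<subseteq> I"
    using assms(11) by auto
  then have y: "self_adjoint y"
    unfolding y_def
    by (intro positive_map_self_adjoint[OF \<phi>] self_adjoint_cfc assms(10) continuous_on_subset[OF cont])
  have fx: "self_adjoint (cfc f x)" "cfc f x \<in> M"
    by (intro self_adjoint_cfc cfc_mem assms(1) M x f)+
  \<comment> \<open>The sign 1 or -1 handles both directions of monotonicity at once.\<close>
  obtain s :: real where s: "\<And>t u. t \<in> I \<Longrightarrow> u \<in> I \<Longrightarrow> s * t \<le> s * u \<Longrightarrow> f t \<le> f u"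
  proof (cases "mono_on I f")
    case True
    then show ?thesis
      using that[of 1] by (auto simp: monotone_on_def)
  next
    case False
    then show ?thesis
      using that[of "-1"] assms(9) by (auto simp: monotone_on_def)
  qed
  have "\<exists>r\<in>M. subprojection r (spectral_above y \<alpha>) \<and> mvn_equivalent M (spectral_above (cfc f x) \<alpha>) r" for \<alpha>
  proof (rule projection_comparison[OF assms(1)])
    show "projection (spectral_above (cfc f x) \<alpha>)" "projection (spectral_above y \<alpha>)"
      by (intro projection_above fx y)+
    show "spectral_above (cfc f x) \<alpha> \<in> M" "spectral_above y \<alpha> \<in> M"
      by (intro above_mem assms(1) fx y M)+
    fix \<xi> assume \<xi>: "spectral_above (cfc f x) \<alpha> \<bullet>\<bullet> \<xi> = \<xi>" "spectral_above y \<alpha> \<bullet>\<bullet> \<xi> = 0"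
    show "\<xi> = 0"
    proof (rule ccontr)
      assume "\<xi> \<noteq> 0"
      \<comment> \<open>The quadratic form of \<open>x\<close> is a mean lying in \<open>I\<close>
        only for unit vectors.\<close>
      define \<eta> where "\<eta> = (1 / norm \<xi>) *\<^sub>R \<xi>"
      have \<eta>: "norm \<eta> = 1" "spectral_above (cfc f x) \<alpha> \<bullet>\<bullet> \<eta> = \<eta>" "spectral_above y \<alpha> \<bullet>\<bullet> \<eta> = 0"
        using \<xi> \<open>\<xi> \<noteq> 0\<close> by (simp_all add: \<eta>_def bop_simps)
      have mem: "inner (x \<bullet>\<bullet> \<eta>) \<eta> \<in> I"
        unfolding x_def by (rule positive_map_inner_mem[OF \<phi> aI \<eta>(1)])
      have "\<alpha> < f (inner (x \<bullet>\<bullet> \<eta>) \<eta>)"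
        using spec mem by (intro monotone_value_above[OF x f \<eta>(2,1)] s) auto
      also have "\<dots> \<le> inner (y \<bullet>\<bullet> \<eta>) \<eta>"
        unfolding x_def y_def by (rule Jensen_vector_state[OF \<phi> aI assms(6,8) \<eta>(1)])
      also have "\<dots> \<le> \<alpha>"
        using upper_projection_le[OF upper_projection_above[OF y] \<eta>(3)] \<eta>(1) by simp
      finally show False by simp
    qed
  qed
  then have "spectral_le M (cfc f x) y"
    unfolding spectral_le_def
    by (simp add: fx y M spectral_projection_greaterThan[OF fx(1)] spectral_projection_greaterThan[OF y])
  then show ?thesis by (simp add: x_def y_def)
qed

end
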